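(* Let $n>1$, let the opponents' aggregate contribution process $\hat C^{-i}$ be given, and let Assumption U and Assumption P (stated in the context) hold. Then $(\hat x^i,\hat C^i)\in\mathcal{B}_{w^i}$ attains $$V^i(\hat C^{-i}):=\sup_{(x^i,C^i)\in\mathcal{B}_{w^i}}U^i(x^i,C^i;\hat C^{-i})$$ if and only if there exists a Lagrange multiplier $\hat\lambda^i>0$ such that, with $\hat C:=\hat C^i+\hat C^{-i}$, the following conditions hold: $$E\Big[\int_0^T\psi_x(t)\hat x^i(t)\,dt+\int_0^T\psi_c(t)\,d\hat C^i(t)\Big]=w^i;$$ $$E\Big[\int_\tau^Te^{-\int_0^tr(s)ds}u^i_c(\hat x^i(t),\hat C(t))\,dt\,\Big|\,\mathcal{F}_\tau\Big]\le\hat\lambda^i\psi_c(\tau)\quad P\text{-a.s. for all }\tau\in\mathcal{T};$$ $$E\Big[\int_0^T\Big(E\Big[\int_t^Te^{-\int_0^sr(u)du}u^i_c(\hat x^i(s),\hat C(s))\,ds\,\Big|\,\mathcal{F}_t\Big]-\hat\lambda^i\psi_c(t)\Big)d\hat C^i(t)\Big]=0;$$ $$e^{-\int_0^tr(u)du}u^i_x(\hat x^i(t),\hat C(t))\le\hat\lambda^i\psi_x(t)\quad P\otimes dt\text{-a.e., with equality on }\{\hat x^i>0\}.$$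
   Context: Setting. Fix $0<T\le\infty$, a number $n$ of agents, and a filtered probability space $(\Omega,\mathcal{F},\{\mathcal{F}_t\}_{t\in[0,T]},P)$ satisfying the usual conditions, with expectation $E$. $\mathcal{T}$ is the set of all $(\mathcal{F}_t)$-stopping times with values in $[0,T]$ a.s. Let $w^i>0$ be initial wealths, $\psi_x,\psi_c$ strictly positive price processes, $r$ a discount rate process. For nonnegative processes set $$\Psi(x^i,C^i):=E\Big[\int_0^T\psi_x(t)x^i(t)\,dt+\int_0^T\psi_c(t)\,dC^i(t)\Big].$$ For a nondecreasing right-continuous $C$, $\int_0^T(\cdot)\,dC(t)$ denotes the Lebesgue–Stieltjes integral over $[0,T]$, including a possible point mass $C(0)$ at $t=0$ (convention $C(0-)=0$). The budget sets are $$\mathcal{B}_{w^i}:=\{(x^i,C^i):\Omega\times[0,T]\to\mathbb{R}_+^2\text{ optional}:\ C^i\text{ right-continuous, nondecreasing},\ C^i(0-)=0\ P\text{-a.s.},\ \Psi(x^i,C^i)\le w^i\}.$$ Payoffs: with $C:=\sum_{j}C^j$, $C^{-i}:=\sum_{j\ne i}C^j$ and $u^i:\mathbb{R}_+^2\to\mathbb{R}_+$, $$U^i(x^i,C^i;C^{-i}):=E\Big[\int_0^T e^{-\int_0^t r(s)ds}u^i(x^i(t),C(t))\,dt\Big].$$ Subscripts on $u^i$ denote partial derivatives. The given process is $\hat C^{-i}=\sum_{j\ne i}\hat C^j$, where $(\hat x^j,\hat C^j)\in\mathcal{B}_{w^j}$ are the opponents' strategies. Assumption U. (i) Each $u^i$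 is increasing and strictly concave on $\mathbb{R}_+^2$ and twice continuously differentiable on $\mathbb{R}_{++}^2$ with negative definite Hessian; moreover $\lim_{x\downarrow0}u^i_x(x,c)=+\infty$ and $\lim_{x\uparrow\infty}u^i_x(x,c)=0$ for any $c>0$. (ii) For each $i$ the family $e^{-\int_0^t r(\omega,s)ds}u^i(x^i(\omega,t),C(\omega,t))$, indexed by $((x^j,C^j))_{j}\in\prod_{j=1}^n\mathcal{B}_{w^j}$ with $C=\sum_jC^j$, is $P\otimes dt$-uniformly integrable. Assumption P. (i) $\psi_c=\{\psi_c(t),t\in[0,T]\}$ is adapted, right-continuous, $\psi_c(t)=e^{-\int_0^t r_c(s)ds}\mathcal{E}_c(t)$ a.s. for every $t\in[0,T]$, with $r_c$ a uniformly bounded, strictly positive process and $\mathcal{E}_c=\{\mathcal{E}_c(t),t\in[0,T]\}$ an exponential martingale (strictly positive, mean one); if $T=\infty$ then $\psi_c(T)=0$ a.s. (ii) $\psi_x$ is adapted, right-continuous, $\psi_x(t)=e^{-\int_0^t r_x(s)ds}\mathcal{E}_x(t)$ a.s. for every $t\in[0,T]$, with $r_x$ uniformly bounded and strictly positive and $\mathcal{E}_x$ an exponential martingale. (iii) $r$ is optional, strictly positive and uniformly bounded.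
   Formalization: Added premise: almost everywhere on {Ĉ=0} the gradient (u_x,u_c) exists at (x̂,Ĉ) as a one-sided, possibly infinite directional derivative; Assumption U leaves it undefined there, and at (0,0) the equivalence can fail with one-sided partials. *)

theory Defs
  imports "HOL-Probability.Probability"
begin

section \<open>Time, filtrations and processes\<close>

text \<open>
  Time is measured in \<^typ>\<open>ennreal\<close>, so that \<open>{..T}\<close> is the closed interval \<open>[0,T]\<close>, also for
  \<open>T = \<infinity>\<close>. Processes are functions of \<open>(\<omega>, t)\<close>; what they do after \<open>T\<close> never matters.
\<close>

type_synonym 'a process = "'a \<Rightarrow> ennreal \<Rightarrow> real"

text \<open>
  The measure \<open>dt\<close> on \<open>[0,T]\<close>. Restricting to \<open>{0..}\<close> first is essential, because
  \<^const>\<open>ennreal\<close> sends the negative reals to \<open>0\<close>.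
\<close>

definition lebesgue_time :: "ennreal \<Rightarrow> ennreal measure" where
  "lebesgue_time T = restrict_space (distr (restrict_space lborel {0..}) borel ennreal) {..T}"

text \<open>
  Probability space and filtration satisfying the usual conditions. Only the filtration on
  \<open>[0,T]\<close> is relevant; any filtration on \<open>[0,T]\<close> extends, being constant after \<open>T\<close>, to one
  indexed by all of \<^typ>\<open>ennreal\<close>, as the library's \<^locale>\<open>filtration\<close> requires.
\<close>

locale usual_filtered_space =
  prob_space M + complete_measure M + filtration "space M" F
  for M :: "'a measure" and F :: "ennreal \<Rightarrow> 'a measure" +
  fixes T :: ennreal
  assumes T_pos: "0 < T"
    and sets_F_subset: "\<And>t. sets (F t) \<subseteq> sets M"
    and null_sets_subset: "null_sets M \<subseteq> sets (F 0)"
    and right_continuous_F: "\<And>t. t < T \<Longrightarrow> (\<Inter>s\<in>{t<..T}. sets (F s)) \<subseteq> sets (F t)"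

definition adapted :: "(ennreal \<Rightarrow> 'a measure) \<Rightarrow> ennreal \<Rightarrow> 'a process \<Rightarrow> bool" where
  "adapted F T X \<longleftrightarrow> (\<forall>t\<le>T. (\<lambda>\<omega>. X \<omega> t) \<in> borel_measurable (F t))"

definition right_continuous_path :: "ennreal \<Rightarrow> (ennreal \<Rightarrow> real) \<Rightarrow> bool" where
  "right_continuous_path T f \<longleftrightarrow> (\<forall>t<T. continuous (at_right t) f)"

definition cadlag_path :: "ennreal \<Rightarrow> (ennreal \<Rightarrow> real) \<Rightarrow> bool" where
  "cadlag_path T f \<longleftrightarrow>
     right_continuous_path T f \<and> (\<forall>t. 0 < t \<and> t \<le> T \<longrightarrow> (\<exists>l. (f \<longlongrightarrow> l) (at_left t)))"

definition optional_sigma ::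
  "'a measure \<Rightarrow> (ennreal \<Rightarrow> 'a measure) \<Rightarrow> ennreal \<Rightarrow> ('a \<times> ennreal) measure" where
  "optional_sigma M F T = sigma (space M \<times> {..T})
     {{(\<omega>, t) \<in> space M \<times> {..T}. X \<omega> t \<in> B} | X B.
        adapted F T X \<and> (\<forall>\<omega>\<in>space M. cadlag_path T (X \<omega>)) \<and> B \<in> sets borel}"

definition optional ::
  "'a measure \<Rightarrow> (ennreal \<Rightarrow> 'a measure) \<Rightarrow> ennreal \<Rightarrow> ('a \<Rightarrow> ennreal \<Rightarrow> 'b::topological_space) \<Rightarrow> bool" where
  "optional M F T X \<longleftrightarrow> (\<lambda>(\<omega>, t). X \<omega> t) \<in> borel_measurable (optional_sigma M F T)"

definition stopping_times ::
  "'a measure \<Rightarrow> (ennreal \<Rightarrow> 'a measure) \<Rightarrow> ennreal \<Rightarrow> ('a \<Rightarrow> ennreal) set" where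
  "stopping_times M F T = {\<tau>. stopping_time F \<tau> \<and> (AE \<omega> in M. \<tau> \<omega> \<le> T)}"

definition discount :: "'a process \<Rightarrow> 'a process" where
  "discount r \<omega> t = exp (- (\<integral>s. r \<omega> s \<partial>lebesgue_time t))"


section \<open>Lebesgue--Stieltjes integration over \<open>[0,T]\<close>\<close>

text \<open>
  The measure \<open>dC\<close> is determined by \<open>dC [0,t] = C(t)\<close> for \<open>t \<in> [0,T]\<close>. It thus has the atom
  \<open>C(0)\<close> at \<open>0\<close>, which is the convention \<open>C(0-) = 0\<close>, and the atom \<open>C(T) - C(T-)\<close> at \<open>T\<close>.
\<close>

definition stieltjes_measure :: "ennreal \<Rightarrow> (ennreal \<Rightarrow> real) \<Rightarrow> ennreal measure" where
  "stieltjes_measure T C = extend_measure {..T} {..T} (\<lambda>t. {..t}) (\<lambda>t. ennreal (C t))"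

lemma emeasure_stieltjes_measure:
  assumes nonneg: "\<And>t. t \<le> T \<Longrightarrow> 0 \<le> C t"
    and mono: "mono_on {..T} C"
    and rc: "right_continuous_path T C"
    and t: "t \<le> T"
  shows "emeasure (stieltjes_measure T C) {..t} = ennreal (C t)"
proof -
  define q where "q y = Inf {s. s \<le> T \<and> y \<le> C s}" for y
  let ?S = "sigma {..T} ((\<lambda>t. {..t}) ` {..T})"
  let ?L = "restrict_space lborel {0<..C T}"
  have q_le: "q y \<le> s \<longleftrightarrow> y \<le> C s" if s: "s \<le> T" and y: "y \<le> C T" for y s
  proof
    assume "y \<le> C s"
    then show "q y \<le> s" unfolding q_def using s by (auto intro: Inf_lower)
  next
    assume q: "q y \<le> s"
    show "y \<le> C s"
    proof (rule ccontr)
      assume "\<not> y \<le> C s"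
      then have less: "C s < y" by simp
      then have "s \<noteq> T" using y by auto
      then have sT: "s < T" using s by simp
      then have "(C \<longlongrightarrow> C s) (at_right s)"
        using rc unfolding right_continuous_path_def continuous_within by blast
      then have "eventually (\<lambda>v. C v < y) (at_right s)"
        using less by (rule order_tendstoD)
      then obtain b where b: "b > s" "\<And>v. s < v \<Longrightarrow> v < b \<Longrightarrow> C v < y"
        using sT by (auto simp: eventually_at_right[of s T])
      have "min b T \<le> q y" unfolding q_def
      proof (rule Inf_greatest)
        fix v assume "v \<in> {s. s \<le> T \<and> y \<le> C s}"
        then have v: "v \<le> T" "y \<le> C v" by auto
        have "s < v"
          using monotone_onD[OF mono, of v s] v less s by (force simp: not_less[symmetric])
        then show "min b T \<le> v" using b(2)[of v] v by (force simp: min_le_iff_disj)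
      qed
      then show False using q b(1) sT by (auto simp: min_le_iff_disj)
    qed
  qed
  have vimage: "q -` {..s} \<inter> space ?L = {0<..C s}" if s: "s \<le> T" for s
    using q_le[OF s] monotone_onD[OF mono, of s T] s
    by (fastforce simp: space_restrict_space)
  have qT: "q y \<le> T" if "y \<in> space ?L" for y
    using that q_le[of T y] by (simp add: space_restrict_space)
  have meas: "q \<in> measurable ?L ?S"
  proof (rule measurable_measure_of)
    show "(\<lambda>t. {..t}) ` {..T} \<subseteq> Pow {..T}" by auto
    show "q \<in> space ?L \<rightarrow> {..T}" using qT by auto
    fix A assume "A \<in> (\<lambda>t. {..t}) ` {..T}"
    then obtain s where s: "s \<le> T" "A = {..s}" by auto
    have "{0<..C s} \<subseteq> {0<..C T}" using monotone_onD[OF mono, of s T] s by auto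
    then show "q -` A \<inter> space ?L \<in> sets ?L"
      using vimage[OF s(1)] s(2) by (simp add: sets_restrict_space_iff)
  qed
  let ?D = "distr ?L ?S q"
  have D: "emeasure ?D {..s} = ennreal (C s)" if s: "s \<le> T" for s
  proof -
    have sub: "{0<..C s} \<subseteq> {0<..C T}" using monotone_onD[OF mono, of s T] s by auto
    have "{..s} \<in> sets ?S" using s by (auto intro: sigma_sets.Basic simp: subset_eq image_iff)
    then have "emeasure ?D {..s} = emeasure ?L {0<..C s}"
      using meas vimage[OF s] by (simp add: emeasure_distr)
    also have "\<dots> = emeasure lborel {0<..C s}"
      using sub by (simp add: emeasure_restrict_space)
    also have "\<dots> = ennreal (C s)" using nonneg[OF s] by simp
    finally show ?thesis .
  qed
  have sub: "(\<lambda>t. {..t}) ` {..T} \<subseteq> Pow {..T}" by auto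
  have setsD: "sets ?D = sigma_sets {..T} ((\<lambda>t. {..t}) ` {..T})"
    using sub by simp
  show ?thesis
  proof (rule emeasure_extend_measure[OF stieltjes_measure_def])
    show "emeasure ?D {..i} = ennreal (C i)" if "i \<in> {..T}" for i
      using D that by simp
    show "(\<lambda>t. {..t}) ` {..T} \<subseteq> Pow {..T}" by (fact sub)
    show "positive (sets (stieltjes_measure T C)) (emeasure ?D)"
      by (simp add: positive_def)
    have "sets (stieltjes_measure T C) = sets ?D"
      using sub unfolding stieltjes_measure_def by (simp add: sets_extend_measure)
    then show "countably_additive (sets (stieltjes_measure T C)) (emeasure ?D)"
      using emeasure_countably_additive[of ?D] by simp
    show "t \<in> {..T}" using t by simp
  qed
qed

text \<open>
  \<open>E[\<integral>\<^sub>0\<^sup>T f dC]\<close> for an extended real integrand, as positive part minus negative part. The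
  Bochner integral would be \<open>0\<close> for every non-integrable \<open>f\<close>; here \<open>\<infinity> - \<infinity> = \<infinity>\<close> in
  \<^typ>\<open>ereal\<close>, so that the value is finite only if \<open>f\<close> is integrable.
\<close>

definition stieltjes_expectation ::
  "'a measure \<Rightarrow> ennreal \<Rightarrow> ('a \<Rightarrow> ennreal \<Rightarrow> ereal) \<Rightarrow> 'a process \<Rightarrow> ereal" where
  "stieltjes_expectation M T f C =
     enn2ereal (\<integral>\<^sup>+ \<omega>. (\<integral>\<^sup>+ t. e2ennreal (f \<omega> t) \<partial>stieltjes_measure T (C \<omega>)) \<partial>M)
   - enn2ereal (\<integral>\<^sup>+ \<omega>. (\<integral>\<^sup>+ t. e2ennreal (- f \<omega> t) \<partial>stieltjes_measure T (C \<omega>)) \<partial>M)"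


section \<open>Prices\<close>

text \<open>
  For \<open>T = \<infinity>\<close> the martingale representation is imposed at all finite times only, the value of
  \<open>\<psi>\<^sub>c\<close> at infinity being fixed separately: a martingale on the closed interval \<open>[0,\<infinity>]\<close> would
  be uniformly integrable, which already fails for geometric Brownian motion.
\<close>

definition exponential_martingale ::
  "'a measure \<Rightarrow> (ennreal \<Rightarrow> 'a measure) \<Rightarrow> ennreal \<Rightarrow> 'a process \<Rightarrow> bool" where
  "exponential_martingale M F T X \<longleftrightarrow>
     (\<forall>t\<le>T. t < \<infinity> \<longrightarrow>
        (\<lambda>\<omega>. X \<omega> t) \<in> borel_measurable (F t) \<and> integrable M (\<lambda>\<omega>. X \<omega> t) \<and>
        (\<forall>\<omega>\<in>space M. 0 < X \<omega> t) \<and> (\<integral>\<omega>. X \<omega> t \<partial>M) = 1 \<and>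
        (\<forall>s\<le>t. AE \<omega> in M. real_cond_exp M (F s) (\<lambda>\<omega>. X \<omega> t) \<omega> = X \<omega> s))"

definition bounded_positive :: "'a measure \<Rightarrow> ennreal \<Rightarrow> 'a process \<Rightarrow> bool" where
  "bounded_positive M T r \<longleftrightarrow> (\<exists>K. \<forall>\<omega>\<in>space M. \<forall>t\<le>T. 0 < r \<omega> t \<and> r \<omega> t \<le> K)"

definition price_process ::
  "'a measure \<Rightarrow> (ennreal \<Rightarrow> 'a measure) \<Rightarrow> ennreal \<Rightarrow> 'a process \<Rightarrow> bool" where
  "price_process M F T \<psi> \<longleftrightarrow>
     adapted F T \<psi> \<and>
     (\<forall>\<omega>\<in>space M. right_continuous_path T (\<psi> \<omega>)) \<and>
     (\<forall>\<omega>\<in>space M. \<forall>t\<le>T. t < \<infinity> \<longrightarrow> 0 < \<psi> \<omega> t) \<and>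
     (\<exists>\<rho> X. (\<lambda>(\<omega>, t). \<rho> \<omega> t) \<in> borel_measurable (M \<Otimes>\<^sub>M lebesgue_time T) \<and>
        bounded_positive M T \<rho> \<and>
        exponential_martingale M F T X \<and>
        (\<forall>t\<le>T. t < \<infinity> \<longrightarrow> (AE \<omega> in M. \<psi> \<omega> t = discount \<rho> \<omega> t * X \<omega> t)))"

definition price_assumption ::
  "'a measure \<Rightarrow> (ennreal \<Rightarrow> 'a measure) \<Rightarrow> ennreal \<Rightarrow> 'a process \<Rightarrow> 'a process \<Rightarrow> 'a process \<Rightarrow> bool" where
  "price_assumption M F T \<psi>x \<psi>c r \<longleftrightarrow>
     price_process M F T \<psi>c \<and> (T = \<infinity> \<longrightarrow> (AE \<omega> in M. \<psi>c \<omega> T = 0)) \<and>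
     price_process M F T \<psi>x \<and>
     optional M F T r \<and> bounded_positive M T r"


section \<open>Budget sets and payoffs\<close>

definition expenditure ::
  "'a measure \<Rightarrow> ennreal \<Rightarrow> 'a process \<Rightarrow> 'a process \<Rightarrow> 'a process \<Rightarrow> 'a process \<Rightarrow> ennreal" where
  "expenditure M T \<psi>x \<psi>c x C =
     (\<integral>\<^sup>+ \<omega>. (\<integral>\<^sup>+ t. ennreal (\<psi>x \<omega> t * x \<omega> t) \<partial>lebesgue_time T)
          + (\<integral>\<^sup>+ t. ennreal (\<psi>c \<omega> t) \<partial>stieltjes_measure T (C \<omega>)) \<partial>M)"

definition budget_set ::
  "'a measure \<Rightarrow> (ennreal \<Rightarrow> 'a measure) \<Rightarrow> ennreal \<Rightarrow> 'a process \<Rightarrow> 'a process \<Rightarrow> real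
    \<Rightarrow> ('a process \<times> 'a process) set" where
  "budget_set M F T \<psi>x \<psi>c w = {(x, C).
     optional M F T x \<and> optional M F T C \<and>
     (\<forall>\<omega>\<in>space M. \<forall>t\<le>T. 0 \<le> x \<omega> t \<and> 0 \<le> C \<omega> t) \<and>
     (AE \<omega> in M. right_continuous_path T (C \<omega>) \<and> mono_on {..T} (C \<omega>)) \<and>
     expenditure M T \<psi>x \<psi>c x C \<le> ennreal w}"

definition aggregate :: "nat set \<Rightarrow> (nat \<Rightarrow> 'a process) \<Rightarrow> 'a process" where
  "aggregate J C \<omega> t = (\<Sum>j\<in>J. C j \<omega> t)"

text \<open>The payoff \<open>U(x, C; D)\<close>, where \<open>D\<close> is the aggregate contribution of the opponents.\<close>

definition payoff ::
  "'a measure \<Rightarrow> ennreal \<Rightarrow> 'a process \<Rightarrow> (real \<Rightarrow> real \<Rightarrow> real)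
    \<Rightarrow> 'a process \<Rightarrow> 'a process \<Rightarrow> 'a process \<Rightarrow> ennreal" where
  "payoff M T r u x C D =
     (\<integral>\<^sup>+ \<omega>. (\<integral>\<^sup>+ t. ennreal (discount r \<omega> t * u (x \<omega> t) (C \<omega> t + D \<omega> t)) \<partial>lebesgue_time T) \<partial>M)"


section \<open>Utility functions\<close>

definition strictly_concave_on_quadrant :: "(real \<Rightarrow> real \<Rightarrow> real) \<Rightarrow> bool" where
  "strictly_concave_on_quadrant u \<longleftrightarrow>
     (\<forall>x c x' c' \<theta>. 0 \<le> x \<and> 0 \<le> c \<and> 0 \<le> x' \<and> 0 \<le> c' \<and> (x, c) \<noteq> (x', c') \<and> 0 < \<theta> \<and> \<theta> < 1 \<longrightarrow>
        \<theta> * u x c + (1 - \<theta>) * u x' c' < u (\<theta> * x + (1 - \<theta>) * x') (\<theta> * c + (1 - \<theta>) * c'))"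

definition deriv_x :: "(real \<Rightarrow> real \<Rightarrow> real) \<Rightarrow> real \<Rightarrow> real \<Rightarrow> real" where
  "deriv_x u x c = deriv (\<lambda>y. u y c) x"

definition deriv_c :: "(real \<Rightarrow> real \<Rightarrow> real) \<Rightarrow> real \<Rightarrow> real \<Rightarrow> real" where
  "deriv_c u x c = deriv (\<lambda>d. u x d) c"

definition C1_on_open_quadrant :: "(real \<Rightarrow> real \<Rightarrow> real) \<Rightarrow> bool" where
  "C1_on_open_quadrant u \<longleftrightarrow>
     (\<forall>x>0. \<forall>c>0. (\<lambda>y. u y c) field_differentiable (at x) \<and>
                     (\<lambda>d. u x d) field_differentiable (at c)) \<and>
     continuous_on ({0<..} \<times> {0<..}) (\<lambda>(x, c). deriv_x u x c) \<and>
     continuous_on ({0<..} \<times> {0<..}) (\<lambda>(x, c). deriv_c u x c)"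

definition C2_on_open_quadrant :: "(real \<Rightarrow> real \<Rightarrow> real) \<Rightarrow> bool" where
  "C2_on_open_quadrant u \<longleftrightarrow>
     C1_on_open_quadrant u \<and> C1_on_open_quadrant (deriv_x u) \<and> C1_on_open_quadrant (deriv_c u)"

definition negative_definite_hessian :: "(real \<Rightarrow> real \<Rightarrow> real) \<Rightarrow> bool" where
  "negative_definite_hessian u \<longleftrightarrow>
     (\<forall>x>0. \<forall>c>0. \<forall>h k. (h, k) \<noteq> (0, 0) \<longrightarrow>
        deriv_x (deriv_x u) x c * h * h + deriv_c (deriv_x u) x c * h * k
        + deriv_x (deriv_c u) x c * k * h + deriv_c (deriv_c u) x c * k * k < 0)"

definition utility_function :: "(real \<Rightarrow> real \<Rightarrow> real) \<Rightarrow> bool" where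
  "utility_function u \<longleftrightarrow>
     (\<forall>x\<ge>0. \<forall>c\<ge>0. 0 \<le> u x c) \<and>
     (\<forall>x c x' c'. 0 \<le> x \<and> x \<le> x' \<and> 0 \<le> c \<and> c \<le> c' \<longrightarrow> u x c \<le> u x' c') \<and>
     strictly_concave_on_quadrant u \<and>
     C2_on_open_quadrant u \<and> negative_definite_hessian u \<and>
     (\<forall>c>0. filterlim (\<lambda>x. deriv_x u x c) at_top (at_right 0) \<and>
             ((\<lambda>x. deriv_x u x c) \<longlongrightarrow> 0) at_top)"

text \<open>
  For \<open>T = \<infinity>\<close> the measure \<open>P \<otimes> dt\<close> is infinite, and truncating at constants would not even make
  the family integrable. Truncating at integrable functions instead of constants is the usual
  notion on a \<open>\<sigma>\<close>-finite measure space; on a finite measure space the two coincide.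
\<close>

definition uniformly_integrable :: "'b measure \<Rightarrow> ('b \<Rightarrow> real) set \<Rightarrow> bool" where
  "uniformly_integrable N H \<longleftrightarrow>
     (\<forall>f\<in>H. f \<in> borel_measurable N) \<and>
     (\<forall>\<epsilon>>0. \<exists>g. integrable N g \<and> (\<forall>z\<in>space N. 0 \<le> g z) \<and>
        (\<forall>f\<in>H. (\<integral>\<^sup>+ z. ennreal \<bar>f z\<bar> * indicator {z. g z < \<bar>f z\<bar>} z \<partial>N) \<le> ennreal \<epsilon>))"

definition utility_assumption ::
  "'a measure \<Rightarrow> (ennreal \<Rightarrow> 'a measure) \<Rightarrow> ennreal \<Rightarrow> nat \<Rightarrow> (nat \<Rightarrow> real)
    \<Rightarrow> 'a process \<Rightarrow> 'a process \<Rightarrow> 'a process \<Rightarrow> (nat \<Rightarrow> real \<Rightarrow> real \<Rightarrow> real) \<Rightarrow> bool" where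
  "utility_assumption M F T n w \<psi>x \<psi>c r u \<longleftrightarrow>
     (\<forall>i\<in>{1..n}. utility_function (u i) \<and>
        uniformly_integrable (M \<Otimes>\<^sub>M lebesgue_time T)
          {\<lambda>(\<omega>, t). discount r \<omega> t * u i (x i \<omega> t) (aggregate {1..n} C \<omega> t) | x C.
             \<forall>j\<in>{1..n}. (x j, C j) \<in> budget_set M F T \<psi>x \<psi>c (w j)})"

text \<open>
  Partial derivatives on the closed quadrant, with values in \<open>[0,\<infinity>]\<close>: on the edges \<open>x = 0\<close>
  and \<open>c = 0\<close> the respective derivative is one-sided and may be infinite. Difference quotients
  of an increasing function are nonnegative, so no information is lost in \<^typ>\<open>ennreal\<close>.
\<close>

definition partial_x :: "(real \<Rightarrow> real \<Rightarrow> real) \<Rightarrow> real \<Rightarrow> real \<Rightarrow> ennreal" where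
  "partial_x u x c = Lim (at x within {0..}) (\<lambda>y. ennreal ((u y c - u x c) / (y - x)))"

definition partial_c :: "(real \<Rightarrow> real \<Rightarrow> real) \<Rightarrow> real \<Rightarrow> real \<Rightarrow> ennreal" where
  "partial_c u x c = Lim (at c within {0..}) (\<lambda>d. ennreal ((u x d - u x c) / (d - c)))"

lemma at_within_nonneg: "0 < (x::real) \<Longrightarrow> at x within {0..} = at x"
  by (rule at_within_interior) simp

lemma partial_x_eq_deriv_x:
  assumes "0 < x" and "(\<lambda>y. u y c) field_differentiable (at x)"
  shows "partial_x u x c = ennreal (deriv_x u x c)"
proof -
  have "((\<lambda>y. u y c) has_field_derivative deriv_x u x c) (at x)"
    using assms(2) by (simp add: deriv_x_def DERIV_deriv_iff_field_differentiable)
  then have "((\<lambda>y. ennreal ((u y c - u x c) / (y - x))) \<longlongrightarrow> ennreal (deriv_x u x c)) (at x)"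
    by (intro tendsto_ennrealI) (simp add: has_field_derivative_iff)
  then show ?thesis
    unfolding partial_x_def at_within_nonneg[OF assms(1)] by (intro tendsto_Lim) auto
qed

lemma partial_c_eq_deriv_c:
  assumes "0 < c" and "(\<lambda>d. u x d) field_differentiable (at c)"
  shows "partial_c u x c = ennreal (deriv_c u x c)"
proof -
  have "((\<lambda>d. u x d) has_field_derivative deriv_c u x c) (at c)"
    using assms(2) by (simp add: deriv_c_def DERIV_deriv_iff_field_differentiable)
  then have "((\<lambda>d. ennreal ((u x d - u x c) / (d - c))) \<longlongrightarrow> ennreal (deriv_c u x c)) (at c)"
    by (intro tendsto_ennrealI) (simp add: has_field_derivative_iff)
  then show ?thesis
    unfolding partial_c_def at_within_nonneg[OF assms(1)] by (intro tendsto_Lim) auto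
qed

text \<open>
  The smoothness assumptions on \<open>u\<close> only concern the open quadrant, so on the edge \<open>c = 0\<close> the
  gradient \<open>(u\<^sub>x, u\<^sub>c)\<close> need not exist: \<open>u(\<cdot>, 0)\<close> may have a kink, and at the corner the
  one-sided partial derivatives need not describe \<open>u\<close> to first order (think of a term
  \<open>\<surd>(x c)\<close>). The following says that the gradient exists at \<open>(x, c)\<close> as a (one-sided,
  possibly infinite) Gateaux derivative in all directions pointing into the quadrant.
\<close>

definition gradient_exists :: "(real \<Rightarrow> real \<Rightarrow> real) \<Rightarrow> real \<Rightarrow> real \<Rightarrow> bool" where
  "gradient_exists u x c \<longleftrightarrow>
     (\<forall>h k. 0 \<le> x + h \<and> 0 \<le> c + k \<longrightarrow>
        ((\<lambda>\<epsilon>. ereal ((u (x + \<epsilon> * h) (c + \<epsilon> * k) - u x c) / \<epsilon>))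
           \<longlongrightarrow> enn2ereal (partial_x u x c) * ereal h + enn2ereal (partial_c u x c) * ereal k)
        (at_right 0))"


section \<open>First-order conditions\<close>

text \<open>Discounted marginal utilities \<open>e\<^bsup>-\<integral>r\<^esup> u\<^sub>x(x, Q)\<close> and \<open>e\<^bsup>-\<integral>r\<^esup> u\<^sub>c(x, Q)\<close> along
  consumption \<open>x\<close> and total contribution \<open>Q\<close>.\<close>

definition marginal_x ::
  "'a process \<Rightarrow> (real \<Rightarrow> real \<Rightarrow> real) \<Rightarrow> 'a process \<Rightarrow> 'a process \<Rightarrow> 'a \<Rightarrow> ennreal \<Rightarrow> ennreal" where
  "marginal_x r u x Q \<omega> t = ennreal (discount r \<omega> t) * partial_x u (x \<omega> t) (Q \<omega> t)"

definition marginal_c ::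
  "'a process \<Rightarrow> (real \<Rightarrow> real \<Rightarrow> real) \<Rightarrow> 'a process \<Rightarrow> 'a process \<Rightarrow> 'a \<Rightarrow> ennreal \<Rightarrow> ennreal" where
  "marginal_c r u x Q \<omega> t = ennreal (discount r \<omega> t) * partial_c u (x \<omega> t) (Q \<omega> t)"

text \<open>\<open>E[\<integral>\<^sub>\<tau>\<^sup>T \<xi>(t) dt | \<F>\<^sub>\<tau>]\<close>\<close>

definition cond_remaining ::
  "'a measure \<Rightarrow> (ennreal \<Rightarrow> 'a measure) \<Rightarrow> ennreal \<Rightarrow> ('a \<Rightarrow> ennreal \<Rightarrow> ennreal)
    \<Rightarrow> ('a \<Rightarrow> ennreal) \<Rightarrow> 'a \<Rightarrow> ennreal" where
  "cond_remaining M F T \<xi> \<tau> =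
     nn_cond_exp M (filtration.pre_sigma (space M) F \<tau>)
       (\<lambda>\<omega>. \<integral>\<^sup>+ t. \<xi> \<omega> t * indicator {\<tau> \<omega>..} t \<partial>lebesgue_time T)"

text \<open>
  For each single \<open>t\<close> the conditional expectation \<open>E[\<integral>\<^sub>t\<^sup>T \<xi>(s) ds | \<F>\<^sub>t]\<close> is determined only almost
  surely. To integrate it against \<open>dC\<close> it has to be read as its optional version (the optional
  projection of \<open>\<integral>\<^sub>t\<^sup>T \<xi>(s) ds\<close>), which is unique up to indistinguishability.
\<close>

definition optional_version ::
  "'a measure \<Rightarrow> (ennreal \<Rightarrow> 'a measure) \<Rightarrow> ennreal \<Rightarrow> ('a \<Rightarrow> ennreal \<Rightarrow> ennreal)
    \<Rightarrow> ('a \<Rightarrow> ennreal \<Rightarrow> ennreal) \<Rightarrow> bool" where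
  "optional_version M F T \<xi> Y \<longleftrightarrow>
     optional M F T Y \<and>
     (\<forall>\<tau>\<in>stopping_times M F T. AE \<omega> in M. Y \<omega> (\<tau> \<omega>) = cond_remaining M F T \<xi> \<tau> \<omega>)"

end

(*
Sufficiency is the gradient inequality for the concave utility, integrated over Omega x [0,T].

For necessity, the difference quotients of the payoff along feasible directions and Fatou's lemma
show that the optimum maximises the linear functional
  L(x, C) = E int (e^{-int r} u_x x + e^{-int r} u_c C) dt
over the budget set. Since budget set and L are homogeneous, the multiplier is simply L(optimum)/w,
and L is dominated by lambda times the expenditure of every plan. Testing with C = 1_A 1_[tau,T] and
with x = 1_S yields the two inequalities; complementary slackness is equality at the optimum. The
Inada condition forces the optimal consumption to be positive wherever the total contribution is,
so the gradient exists almost everywhere along the optimum.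

Both directions rest on E int u_c C dt = E int Y dC, where Y is the optional projection of
Z_t = int_t^T u_c ds. Changing time by the stopping times inf {t. C(t) >= y} reduces this to
Y_tau = E[Z_tau | F_tau]. The projection is obtained by a monotone class argument from cadlag
versions of the martingales P(A | F_t), which exist by Doob's upcrossing inequality on a countable
dense set of times.
*)

theory Submission
  imports Defs
begin

section \<open>Time grids\<close>

text \<open>Marginal utilities may be infinite on the edges of the quadrant, and the integrals of
  gradients may be infinite too. Everything therefore takes place in [0,\<infinity>]: inequalities
  are written with sums on both sides instead of differences, and a common term is cancelled only
  once it is known to be finite. The decisive finite quantity is L at the optimum: the gradient
  inequality, tested against the zero plan, bounds it by the optimal payoff. This forces the order
  of the necessity argument. Positivity of consumption has to come from difference quotients alone;
  only afterwards do gradients exist almost everywhere, so that L can be compared with the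
  quotients. Optional projections are characterised by integrals over events of the past of a
  stopping time. Such identities are additive in Z, as a monotone class argument requires, and they
  are what the change of time consumes: it evaluates processes only at hitting times, on the events
  {y \<le> C(T)}, which belong to the past of those times. Hence integrals against dC can be
  compared without any regularity of Y in time.\<close>

definition dense_time :: "nat \<Rightarrow> ennreal" where
  "dense_time = (SOME d. \<forall>X. open X \<longrightarrow> X \<noteq> {} \<longrightarrow> (\<exists>k. d k \<in> X))"

lemma dense_time_open:
  assumes "open X" "X \<noteq> {}"
  obtains k where "dense_time k \<in> X"
proof -
  obtain D :: "ennreal set" where D: "countable D" "\<And>X. open X \<Longrightarrow> X \<noteq> {} \<Longrightarrow> \<exists>d\<in>D. d \<in> X"
    using countable_dense_setE by blast
  have "D \<noteq> {}" using D(2)[of UNIV] by auto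
  then have "\<forall>X. open X \<longrightarrow> X \<noteq> {} \<longrightarrow> (\<exists>k. from_nat_into D k \<in> X)"
    using D by (metis from_nat_into_surj)
  then have "\<forall>X. open X \<longrightarrow> X \<noteq> {} \<longrightarrow> (\<exists>k. dense_time k \<in> X)"
    unfolding dense_time_def
    by (rule someI[where P="\<lambda>d. \<forall>X. open X \<longrightarrow> X \<noteq> {} \<longrightarrow> (\<exists>k. d k \<in> X)"])
  then show thesis using assms that by blast
qed

lemma dense_time_between:
  assumes "a < b" obtains k where "a < dense_time k" "dense_time k < b"
proof -
  obtain c where "a < c" "c < b" using dense[OF assms] by blast
  then have "{a<..<b} \<noteq> {}" by auto
  then obtain k where "dense_time k \<in> {a<..<b}"
    using dense_time_open[OF open_greaterThanLessThan] by blast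
  then show thesis using that by auto
qed

text \<open>The least point of \<open>grid_points T n\<close> strictly above t, with T as fallback.
  Strictness matters: for t < T the points tend to t through its right neighbourhood, so
  right-continuity and right limits can be read along them, and a stopping time is rounded
  up.\<close>

primrec grid :: "ennreal \<Rightarrow> nat \<Rightarrow> ennreal \<Rightarrow> ennreal" where
  "grid T 0 t = T"
| "grid T (Suc n) t = (if t < dense_time n \<and> dense_time n < grid T n t then dense_time n else grid T n t)"

definition grid_points :: "ennreal \<Rightarrow> nat \<Rightarrow> ennreal set" where
  "grid_points T n = insert T (dense_time ` {..<n} \<inter> {..T})"

lemma finite_grid_points [simp]: "finite (grid_points T n)"
  by (simp add: grid_points_def)

lemma grid_points_mono: "m \<le> n \<Longrightarrow> grid_points T m \<subseteq> grid_points T n"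
  by (auto simp: grid_points_def)

lemma grid_points_le: "q \<in> grid_points T n \<Longrightarrow> q \<le> T"
  by (auto simp: grid_points_def)

lemma T_in_grid_points [simp]: "T \<in> grid_points T n"
  by (simp add: grid_points_def)

lemma grid_le: "grid T n t \<le> T"
  by (induction n) (auto intro: less_imp_le order_trans)

lemma grid_gt: "t < T \<Longrightarrow> t < grid T n t"
  by (induction n) auto

lemma grid_ge: "t \<le> T \<Longrightarrow> t \<le> grid T n t"
  by (induction n) auto

lemma grid_end [simp]: "grid T n T = T"
  by (induction n) auto

lemma grid_in_points: "grid T n t \<in> grid_points T n"
proof (induction n)
  case (Suc n)
  then show ?case using grid_le[of T n t] by (auto simp: grid_points_def)
qed (simp add: grid_points_def)

lemma grid_least: "q \<in> grid_points T n \<Longrightarrow> t < q \<Longrightarrow> grid T n t \<le> q"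
proof (induction n)
  case (Suc n)
  from Suc.prems consider "q \<in> grid_points T n" | "q = dense_time n" "q \<le> T"
    by (auto simp: grid_points_def less_Suc_eq)
  then show ?case
  proof cases
    case 1
    then show ?thesis using Suc by auto
  next
    case 2
    then show ?thesis using Suc.prems(2) by auto
  qed
qed (simp add: grid_points_def)

lemma grid_tendsto: assumes "t \<le> T" shows "(\<lambda>n. grid T n t) \<longlonglongrightarrow> t"
proof (cases "t = T")
  case False
  then have "t < T" using assms by simp
  show ?thesis
  proof (rule order_tendstoI)
    fix a assume "a < t"
    then show "eventually (\<lambda>n. a < grid T n t) sequentially"
      using grid_ge[OF assms] by (intro always_eventually allI) (auto intro: less_le_trans)
  next
    fix a assume "t < a"
    then have "t < min a T" using \<open>t < T\<close> by simp
    then obtain k where k: "t < dense_time k" "dense_time k < min a T"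
      using dense_time_between by blast
    have "grid T n t \<le> dense_time k" if "n \<ge> Suc k" for n
      using that k by (intro grid_least) (auto simp: grid_points_def)
    then show "eventually (\<lambda>n. grid T n t < a) sequentially"
      using k by (intro eventually_sequentiallyI[of "Suc k"]) (auto intro: le_less_trans)
  qed
qed simp

lemma grid_tendsto_right: assumes "t < T" shows "filterlim (\<lambda>n. grid T n t) (at_right t) sequentially"
  unfolding filterlim_at using grid_tendsto[of t T] grid_gt[OF assms] assms
  by (auto intro!: always_eventually) (metis less_irrefl)

lemma right_continuous_grid:
  fixes f :: "ennreal \<Rightarrow> 'b::topological_space"
  assumes "t \<le> T" "t < T \<Longrightarrow> continuous (at_right t) f"
  shows "(\<lambda>n. f (grid T n t)) \<longlonglongrightarrow> f t"
proof (cases "t = T")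
  case False
  then have "t < T" using assms by simp
  then have "(f \<longlongrightarrow> f t) (at_right t)" using assms by (auto simp: continuous_within)
  then show ?thesis by (rule filterlim_compose) (rule grid_tendsto_right[OF \<open>t < T\<close>])
qed simp

lemma measurable_grid [measurable]: "grid T n \<in> borel_measurable borel"
  by (induction n) (simp_all del: not_less)

lemma measurable_grid_count [measurable]: "grid T n \<in> measurable borel (count_space (grid_points T n))"
proof -
  have "grid T n -` {a} \<in> sets borel" for a
    using measurable_sets[OF measurable_grid[of T n], of "{a}"] by simp
  then show ?thesis
    using grid_in_points by (auto simp: measurable_count_space_eq2)
qed

section \<open>Lebesgue measure on time\<close>

text \<open>Lebesgue measure before the cut at T. One measure then serves all horizons, and
  integrals over {..s} and {..t} differ only by an indicator.\<close>

definition time_measure :: "ennreal measure" where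
  "time_measure = distr (restrict_space lborel {0..}) borel ennreal"

lemma lebesgue_time_restrict: "lebesgue_time T = restrict_space time_measure {..T}"
  by (simp add: lebesgue_time_def time_measure_def)

lemma sets_time_measure [measurable_cong, simp]: "sets time_measure = sets borel"
  by (simp add: time_measure_def)

lemma space_time_measure [simp]: "space time_measure = UNIV"
  by (simp add: time_measure_def)

lemma space_lebesgue_time [simp]: "space (lebesgue_time T) = {..T}"
  by (simp add: lebesgue_time_restrict space_restrict_space)

lemma sets_lebesgue_time [measurable_cong]: "sets (lebesgue_time T) = sets (restrict_space borel {..T})"
  unfolding lebesgue_time_restrict by (rule sets_restrict_space_cong) simp

lemma measurable_ennreal_restrict: "ennreal \<in> measurable (restrict_space lborel {0..}) borel"
  by (rule measurable_restrict_space1) simp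

lemma emeasure_time_measure:
  assumes [measurable]: "A \<in> sets borel"
  shows "emeasure time_measure A = emeasure lborel {x. 0 \<le> x \<and> ennreal x \<in> A}"
proof -
  have "emeasure time_measure A = emeasure (restrict_space lborel {0..}) (ennreal -` A \<inter> {0..})"
    unfolding time_measure_def
    by (subst emeasure_distr[OF measurable_ennreal_restrict]) (auto simp: space_restrict_space)
  also have "\<dots> = emeasure lborel (ennreal -` A \<inter> {0..})"
    by (rule emeasure_restrict_space) auto
  also have "ennreal -` A \<inter> {0..} = {x. 0 \<le> x \<and> ennreal x \<in> A}" by auto
  finally show ?thesis .
qed

lemma emeasure_time_Ioc: "emeasure time_measure {s<..ennreal b} \<le> ennreal b - s"
proof (cases "s < ennreal b")
  case True
  then obtain a where s: "s = ennreal a" "0 \<le> a" by (cases s) auto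
  have "{x. 0 \<le> x \<and> ennreal x \<in> {s<..ennreal b}} = {a<..b}"
    using s True by (auto simp: ennreal_less_iff ennreal_le_iff2)
  then show ?thesis using True s
    by (subst emeasure_time_measure) (auto simp: ennreal_less_iff ennreal_minus)
qed (auto simp: emeasure_time_measure not_less)

lemma emeasure_time_atMost: "emeasure time_measure {..ennreal b} \<le> ennreal b"
proof (cases "0 \<le> b")
  case True
  have "{x. 0 \<le> x \<and> ennreal x \<in> {..ennreal b}} = {0..b}"
    using True by (auto simp: ennreal_le_iff)
  then show ?thesis using True by (subst emeasure_time_measure) auto
next
  case False
  \<comment> \<open>A negative b is sent to 0 by \<open>ennreal\<close>, so the interval shrinks to
    a point.\<close>
  then have "{x. 0 \<le> x \<and> ennreal x \<in> {..ennreal b}} = {0}"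
    by (auto simp: ennreal_neg)
  then show ?thesis by (subst emeasure_time_measure) auto
qed

lemma emeasure_time_countable:
  assumes "countable A" shows "emeasure time_measure A = 0"
proof -
  have A[measurable]: "A \<in> sets borel" using assms by (rule sets.countable[rotated]) auto
  have "{x. 0 \<le> x \<and> ennreal x \<in> A} \<subseteq> enn2real ` A"
    by (auto simp: image_iff intro!: bexI[of _ "ennreal _"] enn2real_ennreal[symmetric])
  then have "countable {x. 0 \<le> x \<and> ennreal x \<in> A}"
    using assms by (blast intro: countable_subset countable_image)
  then show ?thesis by (subst emeasure_time_measure) (auto intro: null_setsD1 countable_imp_null_set_lborel)
qed

lemma sigma_finite_time_measure: "sigma_finite_measure time_measure"
proof
  \<comment> \<open>The point \<infinity> lies in no bounded interval and is added separately; it is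
    a null set.\<close>
  let ?A = "insert {\<infinity>} (range (\<lambda>n. {..ennreal (real n)}))"
  have "x \<in> \<Union>?A" for x :: ennreal
  proof (cases x)
    case (real y)
    obtain n where "y \<le> real n" using real_arch_simple by blast
    then show ?thesis using real by (auto intro!: exI[of _ n] ennreal_leI)
  qed auto
  moreover have "emeasure time_measure {..ennreal (real n)} \<noteq> \<infinity>" for n
    using emeasure_time_atMost[of "real n"] by (auto simp: top_unique)
  moreover have "emeasure time_measure {\<infinity>} \<noteq> \<infinity>"
    by (subst emeasure_time_countable) auto
  ultimately show "\<exists>A. countable A \<and> A \<subseteq> sets time_measure \<and> \<Union> A = space time_measure
      \<and> (\<forall>a\<in>A. emeasure time_measure a \<noteq> \<infinity>)"
    by (intro exI[of _ ?A]) (auto simp del: UN_iff UN_insert Union_insert)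
qed

lemma sigma_finite_lebesgue_time: "sigma_finite_measure (lebesgue_time T)"
  unfolding lebesgue_time_restrict
  by (rule sigma_finite_measure_restrict_space[OF sigma_finite_time_measure]) simp

interpretation lebesgue_time: sigma_finite_measure "lebesgue_time T" for T
  by (rule sigma_finite_lebesgue_time)

lemma nn_integral_lebesgue_time:
  "(\<integral>\<^sup>+t. f t \<partial>lebesgue_time T) = (\<integral>\<^sup>+t. f t * indicator {..T} t \<partial>time_measure)"
  unfolding lebesgue_time_restrict by (rule nn_integral_restrict_space) simp

lemma AE_lebesgue_time_countable:
  assumes "countable A" shows "AE t in lebesgue_time T. t \<notin> A"
proof (rule AE_I')
  have A[measurable]: "A \<in> sets borel" using assms by (rule sets.countable[rotated]) auto
  show "A \<inter> {..T} \<in> null_sets (lebesgue_time T)"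
  proof (rule null_setsI)
    have "emeasure (lebesgue_time T) (A \<inter> {..T}) = emeasure time_measure (A \<inter> {..T})"
      unfolding lebesgue_time_restrict by (rule emeasure_restrict_space) auto
    also have "\<dots> = 0" by (rule emeasure_time_countable) (auto intro: countable_subset[OF _ assms])
    finally show "emeasure (lebesgue_time T) (A \<inter> {..T}) = 0" .
    show "A \<inter> {..T} \<in> sets (lebesgue_time T)"
      unfolding sets_lebesgue_time by (auto simp: sets_restrict_space_iff)
  qed
qed auto

lemma AE_lebesgue_time_finite: "AE t in lebesgue_time T. t \<noteq> \<infinity>"
  using AE_lebesgue_time_countable[of "{\<infinity>}"] by simp

section \<open>Stieltjes measures\<close>

text \<open>The generalised inverse of C. The cut at T yields a genuine time even for levels above
  C(T), where the infimum is that of the empty set, namely \<infinity>.\<close>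

definition hitting :: "ennreal \<Rightarrow> (ennreal \<Rightarrow> real) \<Rightarrow> real \<Rightarrow> ennreal" where
  "hitting T C y = min T (Inf {s. s \<le> T \<and> y \<le> C s})"

definition increasing_path :: "ennreal \<Rightarrow> (ennreal \<Rightarrow> real) \<Rightarrow> bool" where
  "increasing_path T C \<longleftrightarrow> (\<forall>t\<le>T. 0 \<le> C t) \<and> mono_on {..T} C \<and> right_continuous_path T C"

lemma hitting_le: "hitting T C y \<le> T"
  by (simp add: hitting_def)

text \<open>By right-continuity the level is already attained at the infimum. At s = T the left side
  would always hold because of the cut, hence the strict bound on s.\<close>

lemma hitting_le_iff:
  assumes C: "increasing_path T C" and s: "s < T"
  shows "hitting T C y \<le> s \<longleftrightarrow> y \<le> C s"
proof
  have sT: "s \<le> T" using s by simp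
  have mono: "mono_on {..T} C" and rc: "right_continuous_path T C"
    using C by (auto simp: increasing_path_def)
  show "hitting T C y \<le> s" if "y \<le> C s"
    unfolding hitting_def using that sT by (auto intro!: min.coboundedI2 Inf_lower)
  assume q: "hitting T C y \<le> s"
  show "y \<le> C s"
  proof (rule ccontr)
    assume "\<not> y \<le> C s"
    then have less: "C s < y" by simp
    have "(C \<longlongrightarrow> C s) (at_right s)"
      using rc s unfolding right_continuous_path_def continuous_within by blast
    then have "eventually (\<lambda>v. C v < y) (at_right s)"
      using less by (rule order_tendstoD)
    then obtain b where b: "b > s" "\<And>v. s < v \<Longrightarrow> v < b \<Longrightarrow> C v < y"
      using s by (auto simp: eventually_at_right[of s T])
    have "min b T \<le> Inf {s. s \<le> T \<and> y \<le> C s}"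
    proof (rule Inf_greatest)
      fix v assume "v \<in> {s. s \<le> T \<and> y \<le> C s}"
      then have v: "v \<le> T" "y \<le> C v" by auto
      have "s < v"
        using monotone_onD[OF mono, of v s] v less sT by (force simp: not_less[symmetric])
      then show "min b T \<le> v" using b(2)[of v] v by (force simp: min_le_iff_disj)
    qed
    then have "min b T \<le> hitting T C y" by (simp add: hitting_def)
    then show False using q b(1) s by (auto simp: min_le_iff_disj)
  qed
qed

text \<open>\<open>extend_measure\<close> carries the sigma-algebra generated by its intervals;
  identifying it with the Borel trace makes the usual measurability facts available for Stieltjes
  measures.\<close>

lemma sigma_atMost_restrict:
  "sets (restrict_space borel {..T}) = sigma_sets {..T} ((\<lambda>t. {..t}) ` {..(T::ennreal)})"
proof (intro equalityI subsetI)
  let ?E = "(\<lambda>t. {..t}) ` {..T}"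
  have E: "?E \<subseteq> Pow {..T}" by auto
  fix A assume "A \<in> sets (restrict_space borel {..T})"
  then obtain B where B: "B \<in> sets borel" "A = B \<inter> {..T}"
    by (auto simp: sets_restrict_space)
  have "(\<lambda>x. x) \<in> borel_measurable (sigma {..T} ?E)"
  proof (rule borel_measurableI_le)
    fix y
    have "{x \<in> space (sigma {..T} ?E). x \<le> y} = {..min y T}" by (auto simp: space_measure_of[OF E])
    also have "\<dots> \<in> sets (sigma {..T} ?E)"
      unfolding sets_measure_of[OF E] by (intro sigma_sets.Basic image_eqI[OF refl]) simp
    finally show "{x \<in> space (sigma {..T} ?E). x \<le> y} \<in> sets (sigma {..T} ?E)" .
  qed
  from measurable_sets[OF this B(1)] show "A \<in> sigma_sets {..T} ?E"
    using E B(2) by simp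
next
  fix A assume "A \<in> sigma_sets {..T} ((\<lambda>t. {..t}) ` {..T})"
  moreover have "(\<lambda>t. {..t}) ` {..T} \<subseteq> sets (restrict_space borel {..T})"
    by (auto simp: sets_restrict_space_iff)
  ultimately show "A \<in> sets (restrict_space borel {..T})"
    using sets.sigma_sets_subset[of _ "restrict_space borel {..T}"] by (auto simp: space_restrict_space)
qed

lemma sets_stieltjes_measure [measurable_cong]:
  "sets (stieltjes_measure T C) = sets (restrict_space borel {..T})"
  unfolding sigma_atMost_restrict stieltjes_measure_def by (rule sets_extend_measure) auto

lemma space_stieltjes_measure [simp]: "space (stieltjes_measure T C) = {..T}"
  unfolding stieltjes_measure_def by (rule space_extend_measure) auto

lemma emeasure_stieltjes_atMost:
  assumes "increasing_path T C" "t \<le> T"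
  shows "emeasure (stieltjes_measure T C) {..t} = ennreal (C t)"
  using assms by (intro emeasure_stieltjes_measure) (auto simp: increasing_path_def)

lemma measurable_hitting:
  assumes "increasing_path T C"
  shows "hitting T C \<in> borel_measurable borel"
proof (rule borel_measurableI_le)
  fix s
  have "{y \<in> space borel. hitting T C y \<le> s} = (if s < T then {..C s} else UNIV)"
    using hitting_le_iff[OF assms, of s] order_trans[OF hitting_le[of T C], of s] by auto
  then show "{y \<in> space borel. hitting T C y \<le> s} \<in> sets borel" by simp
qed

text \<open>The quantile transform: the levels in (0, C(T)] are carried to the times at which they
  are reached. Levels in (0, C(0)] go to time 0 and produce the atom there. Both measures are finite
  and agree on the intersection-stable intervals {..s}.\<close>

lemma stieltjes_measure_eq_distr:
  assumes C: "increasing_path T C"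
  shows "stieltjes_measure T C = distr (restrict_space lborel {0<..C T}) (restrict_space borel {..T}) (hitting T C)"
    (is "_ = ?D")
proof (rule measure_eqI_generator_eq[where E="(\<lambda>t. {..t}) ` {..T}" and \<Omega>="{..T}" and A="\<lambda>_. {..T}"])
  let ?E = "(\<lambda>t. {..t}) ` {..T}"
  have meas: "hitting T C \<in> measurable (restrict_space lborel {0<..C T}) (restrict_space borel {..T})"
    by (intro measurable_restrict_space2 measurable_restrict_space1)
       (use measurable_hitting[OF C] hitting_le in auto)
  show "Int_stable ?E"
  proof (rule Int_stableI)
    fix a b assume "a \<in> ?E" "b \<in> ?E"
    then obtain s t where "a = {..s}" "b = {..t}" "s \<le> T" "t \<le> T" by auto
    then show "a \<inter> b \<in> ?E" by (intro image_eqI[of _ _ "min s t"]) (auto simp: min.coboundedI1)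
  qed
  show "sets (stieltjes_measure T C) = sigma_sets {..T} ?E"
    by (simp add: sets_stieltjes_measure sigma_atMost_restrict)
  show "sets ?D = sigma_sets {..T} ?E"
    by (simp add: sigma_atMost_restrict)
  fix X assume "X \<in> ?E"
  then obtain s where s: "s \<le> T" "X = {..s}" by auto
  have CT: "C s \<le> C T" using C s by (auto simp: increasing_path_def intro: monotone_onD)
  have X: "X \<in> sets (restrict_space borel {..T})"
    using s by (auto simp: sets_restrict_space_iff)
  have "emeasure ?D X = emeasure (restrict_space lborel {0<..C T}) (hitting T C -` X \<inter> {0<..C T})"
    by (simp add: emeasure_distr[OF meas X] space_restrict_space)
  also have "hitting T C -` X \<inter> {0<..C T} = {0<..C s}"
    using hitting_le_iff[OF C, of s] s CT hitting_le[of T C]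
    by (cases "s = T") (auto simp: less_le)
  also have "emeasure (restrict_space lborel {0<..C T}) \<dots> = emeasure lborel {0<..C s}"
    using CT by (intro emeasure_restrict_space) auto
  also have "\<dots> = ennreal (C s)" using C s by (simp add: increasing_path_def)
  finally show "emeasure (stieltjes_measure T C) X = emeasure ?D X"
    using emeasure_stieltjes_atMost[OF C s(1)] s by simp
next
  show "emeasure (stieltjes_measure T C) {..T} \<noteq> \<infinity>" for i :: nat
    using emeasure_stieltjes_atMost[OF C] by simp
qed auto

lemma nn_integral_stieltjes:
  assumes C: "increasing_path T C" and f: "f \<in> borel_measurable (restrict_space borel {..T})"
  shows "(\<integral>\<^sup>+t. f t \<partial>stieltjes_measure T C)
    = (\<integral>\<^sup>+y. f (hitting T C y) * indicator {0<..C T} y \<partial>lborel)"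
proof -
  have meas: "hitting T C \<in> measurable (restrict_space lborel {0<..C T}) (restrict_space borel {..T})"
    by (intro measurable_restrict_space2 measurable_restrict_space1)
       (use measurable_hitting[OF C] hitting_le in auto)
  show ?thesis
    unfolding stieltjes_measure_eq_distr[OF C]
    using f by (subst nn_integral_distr[OF meas], simp, subst nn_integral_restrict_space) auto
qed

lemma finite_stieltjes_measure:
  assumes C: "increasing_path T C"
  shows "finite_measure (stieltjes_measure T C)"
  by (rule finite_measureI) (simp add: emeasure_stieltjes_atMost[OF C])

lemma increasing_path_lincomb:
  assumes "increasing_path T C" "increasing_path T C'" "0 \<le> a" "0 \<le> b"
  shows "increasing_path T (\<lambda>t. a * C t + b * C' t)"
  using assms unfolding increasing_path_def right_continuous_path_def
  by (auto intro!: continuous_intros mono_onI add_mono mult_left_mono dest: monotone_onD)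

text \<open>A Stieltjes measure is known explicitly only on the intervals {..s}, where linearity in
  C is evident; Dynkin's argument transports it to all Borel sets.\<close>

lemma emeasure_stieltjes_lincomb:
  assumes C: "increasing_path T C" "increasing_path T C'" "0 \<le> a" "0 \<le> b"
    and A: "A \<in> sets (restrict_space borel {..T})"
  shows "emeasure (stieltjes_measure T (\<lambda>t. a * C t + b * C' t)) A
    = ennreal a * emeasure (stieltjes_measure T C) A + ennreal b * emeasure (stieltjes_measure T C') A"
proof -
  let ?E = "(\<lambda>t. {..t}) ` {..T}" and ?\<mu> = "emeasure (stieltjes_measure T (\<lambda>t. a * C t + b * C' t))"
  let ?\<mu>1 = "emeasure (stieltjes_measure T C)" and ?\<mu>2 = "emeasure (stieltjes_measure T C')"
  note C' = increasing_path_lincomb[OF C]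
  interpret S: finite_measure "stieltjes_measure T (\<lambda>t. a * C t + b * C' t)"
    by (rule finite_stieltjes_measure[OF C'])
  interpret S1: finite_measure "stieltjes_measure T C" by (rule finite_stieltjes_measure[OF C(1)])
  interpret S2: finite_measure "stieltjes_measure T C'" by (rule finite_stieltjes_measure[OF C(2)])
  have top: "?\<mu> {..s} = ennreal a * ?\<mu>1 {..s} + ennreal b * ?\<mu>2 {..s}" if "s \<le> T" for s
    using that C by (simp add: emeasure_stieltjes_atMost[OF C'] emeasure_stieltjes_atMost[OF C(1)]
        emeasure_stieltjes_atMost[OF C(2)] ennreal_plus ennreal_mult' increasing_path_def)
  have "Int_stable ?E"
  proof (rule Int_stableI)
    fix a b assume "a \<in> ?E" "b \<in> ?E"
    then obtain s t where "a = {..s}" "b = {..t}" "s \<le> T" "t \<le> T" by auto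
    then show "a \<inter> b \<in> ?E" by (intro image_eqI[of _ _ "min s t"]) (auto simp: min.coboundedI1)
  qed
  moreover have "?E \<subseteq> Pow {..T}" by auto
  moreover have "A \<in> sigma_sets {..T} ?E" using A by (simp add: sigma_atMost_restrict)
  ultimately show ?thesis
  proof (induction rule: sigma_sets_induct_disjoint)
    case (basic A)
    then show ?case using top by auto
  next
    case empty
    then show ?case by simp
  next
    case (compl A)
    have A: "A \<in> sets (stieltjes_measure T D)" for D
      using compl(1) by (simp add: sets_stieltjes_measure sigma_atMost_restrict)
    have e: "emeasure (stieltjes_measure T D) ({..T} - A) + emeasure (stieltjes_measure T D) A
        = emeasure (stieltjes_measure T D) {..T}" for D
      using A[of D] sets.sets_into_space[OF A[of D]]
      using sets.top[of "stieltjes_measure T D"]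
      by (subst plus_emeasure) (auto simp: Un_absorb2 intro!: sets.Diff)
    have "?\<mu> ({..T} - A) + ?\<mu> A
        = (ennreal a * ?\<mu>1 ({..T} - A) + ennreal b * ?\<mu>2 ({..T} - A)) + ?\<mu> A"
      using top[of T] unfolding e[symmetric] compl(2) by (simp add: algebra_simps)
    \<comment> \<open>Complements require a cancellation in [0,\<infinity>], which is legitimate
      because the measure of A is finite.\<close>
    then show ?case using S.emeasure_finite[of A] by (simp add: add.commute[of _ "?\<mu> A"] ennreal_add_left_cancel)
  next
    case (union A)
    have A: "range A \<subseteq> sets (stieltjes_measure T D)" for D
      using union(2) by (auto simp: sets_stieltjes_measure sigma_atMost_restrict)
    note sums = suminf_emeasure[OF A union(1), symmetric]
    have "?\<mu> (\<Union>i. A i) = (\<Sum>i. ennreal a * ?\<mu>1 (A i) + ennreal b * ?\<mu>2 (A i))"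
      unfolding sums union(3) ..
    also have "\<dots> = (\<Sum>i. ennreal a * ?\<mu>1 (A i)) + (\<Sum>i. ennreal b * ?\<mu>2 (A i))"
      by (rule suminf_add[symmetric]) auto
    finally show ?case unfolding sums by simp
  qed
qed

lemma nn_integral_stieltjes_lincomb:
  assumes C: "increasing_path T C" "increasing_path T C'" "0 \<le> a" "0 \<le> b"
    and f: "f \<in> borel_measurable (restrict_space borel {..T})"
  shows "(\<integral>\<^sup>+t. f t \<partial>stieltjes_measure T (\<lambda>t. a * C t + b * C' t))
    = ennreal a * (\<integral>\<^sup>+t. f t \<partial>stieltjes_measure T C) + ennreal b * (\<integral>\<^sup>+t. f t \<partial>stieltjes_measure T C')"
  using f
proof (induction rule: borel_measurable_induct)
  case (cong f g)
  have "(\<integral>\<^sup>+t. g t \<partial>stieltjes_measure T D) = (\<integral>\<^sup>+t. f t \<partial>stieltjes_measure T D)" for D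
    using cong(3) by (intro nn_integral_cong) (auto simp: space_restrict_space)
  then show ?case using cong(4) by simp
next
  case (set A)
  then have "A \<in> sets (stieltjes_measure T D)" for D by (simp add: sets_stieltjes_measure)
  then show ?case using emeasure_stieltjes_lincomb[OF C set] by simp
next
  case (mult u c)
  then have "u \<in> borel_measurable (stieltjes_measure T D)" for D
    by (simp add: measurable_cong_sets[OF sets_stieltjes_measure refl])
  then show ?case using mult by (simp add: nn_integral_cmult algebra_simps)
next
  case (add u v)
  then have "u \<in> borel_measurable (stieltjes_measure T D)" "v \<in> borel_measurable (stieltjes_measure T D)" for D
    by (simp_all add: measurable_cong_sets[OF sets_stieltjes_measure refl])
  then show ?case using add by (simp add: nn_integral_add algebra_simps)
next
  case (seq U)
  have m: "U i \<in> borel_measurable (stieltjes_measure T D)" for i D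
    using seq(1) by (simp add: measurable_cong_sets[OF sets_stieltjes_measure refl])
  have inc: "incseq (\<lambda>i. \<integral>\<^sup>+t. U i t \<partial>stieltjes_measure T D)" for D
    using seq(3) by (auto simp: incseq_def le_fun_def intro!: nn_integral_mono)
  have e: "(\<integral>\<^sup>+t. (SUP i. U i t) \<partial>stieltjes_measure T D) = (SUP i. \<integral>\<^sup>+t. U i t \<partial>stieltjes_measure T D)" for D
    by (rule nn_integral_monotone_convergence_SUP[OF seq(3) m])
  have "incseq (\<lambda>i. ennreal c * \<integral>\<^sup>+t. U i t \<partial>stieltjes_measure T D)" for c D
    using inc by (auto simp: incseq_def intro: mult_left_mono)
  note add = ennreal_SUP_add[OF this[of a C] this[of b C']]
  show ?case
    by (simp add: \<open>f = Sup (range U)\<close> SUP_apply image_comp e SUP_mult_left_ennreal seq.IH add[symmetric])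
qed

section \<open>Progressive and optional processes\<close>

text \<open>The greatest among 0 and those of the first n dense times that do not exceed t. Sampling
  there uses only the past, while \<open>grid\<close> looks ahead; in exchange, convergence of the
  samples is guaranteed only at continuity points.\<close>

primrec left_grid :: "nat \<Rightarrow> ennreal \<Rightarrow> ennreal" where
  "left_grid 0 t = 0"
| "left_grid (Suc n) t = (if dense_time n \<le> t \<and> left_grid n t < dense_time n then dense_time n else left_grid n t)"

lemma left_grid_le: "left_grid n t \<le> t"
  by (induction n) auto

lemma left_grid_ge: "k < n \<Longrightarrow> dense_time k \<le> t \<Longrightarrow> dense_time k \<le> left_grid n t"
  by (induction n) (auto simp: less_Suc_eq)

lemma left_grid_tendsto: "(\<lambda>n. left_grid n t) \<longlonglongrightarrow> t"
proof (rule order_tendstoI)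
  fix a assume "t < a"
  then show "eventually (\<lambda>n. left_grid n t < a) sequentially"
    using left_grid_le by (intro always_eventually allI) (rule le_less_trans)
next
  fix a assume "a < t"
  then obtain k where k: "a < dense_time k" "dense_time k < t"
    using dense_time_between by blast
  then have "a < left_grid n t" if "n \<ge> Suc k" for n
    using left_grid_ge[of k n t] that by (auto intro: less_le_trans)
  then show "eventually (\<lambda>n. a < left_grid n t) sequentially"
    by (rule eventually_sequentiallyI)
qed

lemma left_grid_in: "left_grid n t \<in> insert 0 (range dense_time)"
  by (induction n) auto

lemma measurable_left_grid [measurable]: "left_grid n \<in> borel_measurable borel"
  by (induction n) simp_all

lemma measurable_left_grid_count [measurable]:
  "left_grid n \<in> measurable borel (count_space (insert 0 (range dense_time)))"
proof -
  have "left_grid n -` {a} \<in> sets borel" for a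
    using measurable_sets[OF measurable_left_grid[of n], of "{a}"] by simp
  then show ?thesis
    using left_grid_in by (subst measurable_count_space_eq_countable) auto
qed

text \<open>Fix e. Right-continuity at t gives an interval to the right of t in which every point
  has oscillation below e. The intervals attached to the points of larger oscillation are therefore
  disjoint; each contains a dense time, and the indices of these times count the points.\<close>

lemma countable_right_continuous_discontinuities:
  fixes f :: "ennreal \<Rightarrow> real"
  assumes rc: "right_continuous_path T f"
  shows "countable {t. t < T \<and> \<not> isCont f t}"
proof -
  define J where "J e t \<longleftrightarrow> (\<exists>U. open U \<and> t \<in> U \<and> (\<forall>u\<in>U. \<forall>v\<in>U. \<bar>f u - f v\<bar> < e))" for e t
  have "countable {t. t < T \<and> \<not> J (1 / real (Suc k)) t}" for k
  proof -
    define e :: real where "e = 1 / real (Suc k)"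
    have e: "0 < e" by (simp add: e_def)
    have "\<exists>b>t. \<forall>u. t < u \<and> u < b \<longrightarrow> \<bar>f u - f t\<bar> < e / 2" if "t < T" for t
    proof -
      have "(f \<longlongrightarrow> f t) (at_right t)"
        using rc that unfolding right_continuous_path_def continuous_within by blast
      then have "eventually (\<lambda>u. dist (f u) (f t) < e / 2) (at_right t)"
        using e by (intro tendstoD) auto
      then show ?thesis using that by (auto simp: eventually_at_right[of t T] dist_real_def)
    qed
    then obtain b where b: "\<And>t. t < T \<Longrightarrow> b t > t"
      "\<And>t u. t < T \<Longrightarrow> t < u \<Longrightarrow> u < b t \<Longrightarrow> \<bar>f u - f t\<bar> < e / 2"
      by metis
    have J: "J e s" if "t < T" "t < s" "s < b t" for s t
      unfolding J_def
    proof (intro exI[of _ "{t<..<b t}"] conjI ballI)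
      fix u v assume "u \<in> {t<..<b t}" "v \<in> {t<..<b t}"
      then show "\<bar>f u - f v\<bar> < e" using b(2)[OF that(1), of u] b(2)[OF that(1), of v]
        unfolding greaterThanLessThan_iff by linarith
    qed (use that in auto)
    have "\<exists>k. t < dense_time k \<and> dense_time k < b t" if "t < T" for t
      using dense_time_between[OF b(1)[OF that]] by blast
    then obtain \<kappa> where \<kappa>: "\<And>t. t < T \<Longrightarrow> t < dense_time (\<kappa> t)" "\<And>t. t < T \<Longrightarrow> dense_time (\<kappa> t) < b t"
      by metis
    let ?S = "{t. t < T \<and> \<not> J e t}"
    have "\<kappa> s \<noteq> \<kappa> t" if "s \<in> ?S" "t \<in> ?S" "s < t" for s t
    proof -
      have "b s \<le> t" using J[of s t] that by (auto simp: not_less[symmetric])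
      then have "dense_time (\<kappa> s) < dense_time (\<kappa> t)"
        using \<kappa>(2)[of s] \<kappa>(1)[of t] that by (auto dest: less_le_trans less_trans)
      then show ?thesis by auto
    qed
    then have "inj_on \<kappa> ?S" by (intro inj_onI) (metis linorder_less_linear)
    then show ?thesis unfolding e_def[symmetric] by (rule countableI)
  qed
  then have "countable (\<Union>k. {t. t < T \<and> \<not> J (1 / real (Suc k)) t})" by auto
  moreover have "{t. t < T \<and> \<not> isCont f t} \<subseteq> (\<Union>k. {t. t < T \<and> \<not> J (1 / real (Suc k)) t})"
  proof safe
    fix t assume t: "t < T" "\<not> isCont f t"
    have "\<exists>k. \<not> J (1 / real (Suc k)) t"
    proof (rule ccontr)
      assume "\<not> ?thesis"
      then have J: "J (1 / real (Suc k)) t" for k by auto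
      have "(f \<longlongrightarrow> f t) (at t)"
      proof (rule tendstoI)
        fix e :: real assume "0 < e"
        then obtain k where "1 / real (Suc k) < e" using nat_approx_posE by blast
        moreover obtain U where "open U" "t \<in> U" "\<And>u v. u \<in> U \<Longrightarrow> v \<in> U \<Longrightarrow> \<bar>f u - f v\<bar> < 1 / real (Suc k)"
          using J[of k] unfolding J_def by blast
        ultimately show "eventually (\<lambda>x. dist (f x) (f t) < e) (at t)"
          unfolding eventually_at_topological dist_real_def by (metis less_trans)
      qed
      then show False using t by (simp add: continuous_within)
    qed
    then show "t \<in> (\<Union>k. {t. t < T \<and> \<not> J (1 / real (Suc k)) t})" using t by auto
  qed
  ultimately show ?thesis by (rule countable_subset[rotated])
qed

context usual_filtered_space
begin

lemma subalgebra_F: "subalgebra M (F t)"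
  using sets_F_subset space_F by (auto simp: subalgebra_def)

lemma measurable_F_M: "f \<in> measurable (F t) N \<Longrightarrow> f \<in> measurable M N"
  by (rule measurable_from_subalg[OF subalgebra_F])

lemma null_subset_F: "N \<in> null_sets M \<Longrightarrow> A \<subseteq> N \<Longrightarrow> A \<in> sets (F t)"
proof -
  assume "N \<in> null_sets M" "A \<subseteq> N"
  then have "A \<in> null_sets M" using complete2 by blast
  then show ?thesis using null_sets_subset sets_F_mono[of 0 t] by auto
qed

text \<open>Completeness of the filtration enters here: the symmetric difference lies in a null set,
  all of whose subsets belong to \<open>F t\<close>.\<close>

lemma AE_eq_sets_F:
  assumes A: "A \<in> sets (F t)" and B: "B \<subseteq> space M" and eq: "AE \<omega> in M. \<omega> \<in> A \<longleftrightarrow> \<omega> \<in> B"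
  shows "B \<in> sets (F t)"
proof -
  have As: "A \<subseteq> space M" using sets.sets_into_space[OF A] space_F by auto
  obtain N where N: "N \<in> null_sets M" "{\<omega>\<in>space M. \<not> (\<omega> \<in> A \<longleftrightarrow> \<omega> \<in> B)} \<subseteq> N"
    using eq by (auto elim!: AE_E simp: null_sets_def)
  have "A - B \<in> sets (F t)" "B - A \<in> sets (F t)"
    by (rule null_subset_F[OF N(1)]; use N(2) As B in auto)+
  then have "(A - (A - B)) \<union> (B - A) \<in> sets (F t)" using A by auto
  also have "(A - (A - B)) \<union> (B - A) = B" by auto
  finally show ?thesis .
qed

lemma AE_eq_measurable_F:
  assumes f: "f \<in> measurable (F t) N" and g: "\<And>\<omega>. \<omega> \<in> space M \<Longrightarrow> g \<omega> \<in> space N"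
    and eq: "AE \<omega> in M. f \<omega> = g \<omega>"
  shows "g \<in> measurable (F t) N"
proof (rule measurableI)
  show "g \<omega> \<in> space N" if "\<omega> \<in> space (F t)" for \<omega> using that g space_F by auto
  fix A assume A: "A \<in> sets N"
  have "AE \<omega> in M. \<omega> \<in> f -` A \<inter> space (F t) \<longleftrightarrow> \<omega> \<in> g -` A \<inter> space (F t)"
    using eq by eventually_elim auto
  then show "g -` A \<inter> space (F t) \<in> sets (F t)"
    by (rule AE_eq_sets_F[OF measurable_sets[OF f A], rotated]) (auto simp: space_F)
qed

lemma AE_eq_measurable_M:
  assumes f: "f \<in> measurable M N" and g: "\<And>\<omega>. \<omega> \<in> space M \<Longrightarrow> g \<omega> \<in> space N"
    and eq: "AE \<omega> in M. f \<omega> = g \<omega>"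
  shows "g \<in> measurable M N"
proof (rule measurableI)
  fix A assume A: "A \<in> sets N"
  show "g -` A \<inter> space M \<in> sets M"
    by (rule in_sets_AE[OF _ measurable_sets[OF f A]])
       (use eq in \<open>auto elim!: eventually_mono\<close>)
qed (use g in auto)

text \<open>The notion between optional and adapted that survives stopping: to evaluate X at the
  minimum of \<tau> and t with the information of \<open>F t\<close>, joint measurability on [0,t]
  with respect to \<open>F t\<close> is required.\<close>

definition progressive :: "'b measure \<Rightarrow> ('a \<Rightarrow> ennreal \<Rightarrow> 'b) \<Rightarrow> bool" where
  "progressive N X \<longleftrightarrow>
     (\<forall>t\<le>T. (\<lambda>(\<omega>, s). X \<omega> s) \<in> measurable (F t \<Otimes>\<^sub>M restrict_space borel {..t}) N)"

lemma progressive_adapted: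
  assumes "progressive N X" "t \<le> T" shows "(\<lambda>\<omega>. X \<omega> t) \<in> measurable (F t) N"
proof -
  have "(\<lambda>\<omega>. (\<omega>, t)) \<in> measurable (F t) (F t \<Otimes>\<^sub>M restrict_space borel {..t})"
    by (intro measurable_Pair measurable_ident_sets refl) (auto simp: space_restrict_space)
  moreover have "(\<lambda>(\<omega>, s). X \<omega> s) \<in> measurable (F t \<Otimes>\<^sub>M restrict_space borel {..t}) N"
    using assms by (simp add: progressive_def)
  ultimately have "(\<lambda>\<omega>. (\<lambda>(\<omega>, s). X \<omega> s) (\<omega>, t)) \<in> measurable (F t) N" by (rule measurable_compose)
  then show ?thesis by simp
qed

lemma progressive_measurable:
  assumes "progressive N X" shows "(\<lambda>(\<omega>, s). X \<omega> s) \<in> measurable (M \<Otimes>\<^sub>M lebesgue_time T) N"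
proof -
  have 1: "(\<lambda>\<omega>. \<omega>) \<in> measurable M (F T)"
    by (rule measurable_F_M[OF measurable_ident_sets[OF refl]])
  have 2: "(\<lambda>t. t) \<in> measurable (lebesgue_time T) (restrict_space borel {..T})"
    by (rule measurable_ident_sets[OF sets_lebesgue_time])
  have "(\<lambda>z. (fst z, snd z)) \<in> measurable (M \<Otimes>\<^sub>M lebesgue_time T) (F T \<Otimes>\<^sub>M restrict_space borel {..T})"
    by (rule measurable_Pair[OF measurable_compose[OF measurable_fst 1] measurable_compose[OF measurable_snd 2]])
  moreover have "(\<lambda>(\<omega>, s). X \<omega> s) \<in> measurable (F T \<Otimes>\<^sub>M restrict_space borel {..T}) N"
    using assms by (simp add: progressive_def)
  ultimately have "(\<lambda>z. (\<lambda>(\<omega>, s). X \<omega> s) (fst z, snd z)) \<in> measurable (M \<Otimes>\<^sub>M lebesgue_time T) N"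
    by (rule measurable_compose)
  then show ?thesis by (simp add: case_prod_beta')
qed

lemma right_continuous_progressive:
  fixes X :: "'a process"
  assumes "adapted F T X" "\<forall>\<omega>\<in>space M. right_continuous_path T (X \<omega>)"
  shows "progressive borel X"
  unfolding progressive_def
proof (intro allI impI)
  fix t assume t: "t \<le> T"
  show "(\<lambda>(\<omega>, s). X \<omega> s) \<in> borel_measurable (F t \<Otimes>\<^sub>M restrict_space borel {..t})"
  proof (rule borel_measurable_LIMSEQ_metric)
    fix n
    \<comment> \<open>The grid has horizon t instead of T: all sampled times are at most t, so the
      samples are known at t although the grid looks to the right.\<close>
    have g: "(\<lambda>z. grid t n (snd z)) \<in> measurable (F t \<Otimes>\<^sub>M restrict_space borel {..t}) (count_space (grid_points t n))"
      by (rule measurable_compose[OF measurable_snd measurable_restrict_space1[OF measurable_grid_count]])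
    have f: "(\<lambda>z. X (fst z) q) \<in> borel_measurable (F t \<Otimes>\<^sub>M restrict_space borel {..t})"
      if "q \<in> grid_points t n" for q
    proof -
      have q: "q \<le> t" using grid_points_le[OF that] .
      then have "(\<lambda>\<omega>. X \<omega> q) \<in> borel_measurable (F q)"
        using assms t by (auto simp: adapted_def)
      moreover have "subalgebra (F t) (F q)"
        using q sets_F_mono by (auto simp: subalgebra_def space_F)
      ultimately have "(\<lambda>\<omega>. X \<omega> q) \<in> borel_measurable (F t)" by (metis measurable_from_subalg)
      then show ?thesis by (rule measurable_compose[OF measurable_fst])
    qed
    show "(\<lambda>z. X (fst z) (grid t n (snd z))) \<in> borel_measurable (F t \<Otimes>\<^sub>M restrict_space borel {..t})"
      using measurable_compose_countable'[where f="\<lambda>q z. X (fst z) q", OF f g countable_finite[OF finite_grid_points]] .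
  next
    fix z assume "z \<in> space (F t \<Otimes>\<^sub>M restrict_space borel {..t})"
    then have z: "fst z \<in> space M" "snd z \<le> t"
      by (auto simp: space_pair_measure space_F space_restrict_space)
    have "(\<lambda>n. X (fst z) (grid t n (snd z))) \<longlonglongrightarrow> X (fst z) (snd z)"
      using z assms(2) t
      by (intro right_continuous_grid) (auto simp: right_continuous_path_def)
    then show "(\<lambda>n. X (fst z) (grid t n (snd z))) \<longlonglongrightarrow> (case z of (\<omega>, s) \<Rightarrow> X \<omega> s)"
      by (simp add: case_prod_beta)
  qed
qed

lemma optional_generator_subset:
  "{{(\<omega>, t) \<in> space M \<times> {..T}. X \<omega> t \<in> B} | X B.
     adapted F T X \<and> (\<forall>\<omega>\<in>space M. cadlag_path T (X \<omega>)) \<and> B \<in> sets borel} \<subseteq> Pow (space M \<times> {..T})"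
  by auto

lemma space_optional_sigma: "space (optional_sigma M F T) = space M \<times> {..T}"
  unfolding optional_sigma_def by (rule space_measure_of[OF optional_generator_subset])

lemma cadlag_optional:
  fixes X :: "'a process"
  assumes "adapted F T X" "\<forall>\<omega>\<in>space M. cadlag_path T (X \<omega>)"
  shows "(\<lambda>(\<omega>, t). X \<omega> t) \<in> borel_measurable (optional_sigma M F T)"
proof (rule measurableI)
  fix B :: "real set" assume B: "B \<in> sets borel"
  have "(\<lambda>(\<omega>, t). X \<omega> t) -` B \<inter> space (optional_sigma M F T) = {(\<omega>, t) \<in> space M \<times> {..T}. X \<omega> t \<in> B}"
    unfolding space_optional_sigma by auto
  also have "\<dots> \<in> sets (optional_sigma M F T)"
    unfolding optional_sigma_def sets_measure_of[OF optional_generator_subset]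
    using assms B by (intro sigma_sets.Basic) blast
  finally show "(\<lambda>(\<omega>, t). X \<omega> t) -` B \<inter> space (optional_sigma M F T) \<in> sets (optional_sigma M F T)" .
qed auto

lemma optional_progressive:
  assumes "(\<lambda>(\<omega>, t). X \<omega> t) \<in> measurable (optional_sigma M F T) N"
  shows "progressive N X"
  unfolding progressive_def
proof (intro allI impI)
  fix t assume t: "t \<le> T"
  let ?P = "F t \<Otimes>\<^sub>M restrict_space borel {..t}"
  have "(\<lambda>z. z) \<in> measurable ?P (optional_sigma M F T)"
    unfolding optional_sigma_def
  proof (rule measurable_measure_of[OF optional_generator_subset])
    show "(\<lambda>z. z) \<in> space ?P \<rightarrow> space M \<times> {..T}"
      using t by (auto simp: space_pair_measure space_F space_restrict_space)
    fix A assume "A \<in> {{(\<omega>, t) \<in> space M \<times> {..T}. X \<omega> t \<in> B} | X B.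
     adapted F T X \<and> (\<forall>\<omega>\<in>space M. cadlag_path T (X \<omega>)) \<and> B \<in> sets borel}"
    then obtain X and B :: "real set" where X: "A = {(\<omega>, t) \<in> space M \<times> {..T}. X \<omega> t \<in> B}"
      "adapted F T X" "\<forall>\<omega>\<in>space M. cadlag_path T (X \<omega>)" "B \<in> sets borel" by blast
    have "progressive borel X"
      using X by (intro right_continuous_progressive) (auto simp: cadlag_path_def)
    then have "(\<lambda>(\<omega>, s). X \<omega> s) \<in> borel_measurable ?P" using t by (simp add: progressive_def)
    from measurable_sets[OF this X(4)] show "(\<lambda>z. z) -` A \<inter> space ?P \<in> sets ?P"
      by (rule arg_cong[where f="\<lambda>S. S \<in> sets ?P", THEN iffD1, rotated])
         (use t in \<open>auto simp: X(1) space_pair_measure space_F space_restrict_space\<close>)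
  qed
  from measurable_compose[OF this assms] show "(\<lambda>(\<omega>, s). X \<omega> s) \<in> measurable ?P N"
    by simp
qed

lemma optional_iff:
  "optional M F T X \<longleftrightarrow> (\<lambda>z. X (fst z) (snd z)) \<in> borel_measurable (optional_sigma M F T)"
  unfolding optional_def by (simp add: case_prod_beta')

lemma optional_progressive': "optional M F T X \<Longrightarrow> progressive borel X"
  unfolding optional_def by (rule optional_progressive)

text \<open>The building block of the explicit optional processes below: deterministic times,
  samples held from some time on, and contributions made all at once at a stopping time.\<close>

lemma cadlag_jump: "cadlag_path T (\<lambda>t. if s \<le> t then a else (0::real))"
    unfolding cadlag_path_def right_continuous_path_def
proof (intro conjI allI impI)
  fix t assume t: "t < T"
  let ?X = "\<lambda>t. if s \<le> t then a else (0::real)"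
  show "continuous (at_right t) ?X"
  proof (cases "t < s")
    case True
    then have "eventually (\<lambda>v. v < s) (at_right t)"
      by (rule order_tendstoD(2)[OF tendsto_ident_at])
    then show ?thesis
      using True by (auto simp: continuous_within intro!: tendsto_eventually elim!: eventually_mono)
  next
    case False
    have "eventually (\<lambda>s. t < s) (at_right t)" by (simp add: eventually_at_filter)
    then show ?thesis
      using False by (auto simp: continuous_within intro!: tendsto_eventually elim!: eventually_mono)
  qed
next
  fix t assume t: "0 < t \<and> t \<le> T"
  let ?X = "\<lambda>t. if s \<le> t then a else (0::real)"
  show "\<exists>l. (?X \<longlongrightarrow> l) (at_left t)"
  proof (cases "t \<le> s")
    case True
    have "eventually (\<lambda>v. v < t) (at_left t)" by (simp add: eventually_at_filter)
    then have "(?X \<longlongrightarrow> 0) (at_left t)"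
      using True by (auto intro!: tendsto_eventually elim!: eventually_mono)
    then show ?thesis by blast
  next
    case False
    then have "eventually (\<lambda>v. s < v) (at_left t)"
      using t by (auto simp: eventually_at_left[of 0 t] intro!: exI[of _ s])
    then have "(?X \<longlongrightarrow> a) (at_left t)"
      by (auto intro!: tendsto_eventually elim!: eventually_mono)
    then show ?thesis by blast
  qed
qed

lemma measurable_time_optional: "snd \<in> borel_measurable (optional_sigma M F T)"
proof (rule borel_measurableI_less)
  fix y :: ennreal
  have "(\<lambda>(\<omega>, t). if y \<le> t then 1 else (0::real)) \<in> borel_measurable (optional_sigma M F T)"
    by (intro cadlag_optional ballI cadlag_jump) (auto simp: adapted_def)
  from measurable_sets[OF this, of "{0}"]
  show "{z \<in> space (optional_sigma M F T). snd z < y} \<in> sets (optional_sigma M F T)"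
    by (rule arg_cong[where f="\<lambda>S. S \<in> sets (optional_sigma M F T)", THEN iffD1, rotated])
       (auto split: if_splits simp: not_le)
qed

lemma pre_sigma_subset: "stopping_time F \<tau> \<Longrightarrow> A \<in> sets (pre_sigma \<tau>) \<Longrightarrow> A \<in> sets M"
  using sets_pre_sigmaD[of \<tau> A top] sets_F_subset[of top] by auto

lemma subalgebra_pre_sigma: "stopping_time F \<tau> \<Longrightarrow> subalgebra M (pre_sigma \<tau>)"
  using pre_sigma_subset by (auto simp: subalgebra_def space_pre_sigma)

lemma finite_subalgebra_pre_sigma: "stopping_time F \<tau> \<Longrightarrow> sigma_finite_subalgebra M (pre_sigma \<tau>)"
  by (intro finite_measure_subalgebra_is_sigma_finite)
     (simp add: finite_measure_subalgebra_def finite_measure_subalgebra_axioms_def subalgebra_pre_sigma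
        finite_measure_axioms)

lemma finite_subalgebra_F: "sigma_finite_subalgebra M (F t)"
  by (intro finite_measure_subalgebra_is_sigma_finite)
     (simp add: finite_measure_subalgebra_def finite_measure_subalgebra_axioms_def subalgebra_F
        finite_measure_axioms)

lemma stopping_jump_adapted:
  assumes \<tau>: "stopping_time F \<tau>" and A: "A \<in> sets (pre_sigma \<tau>)"
  shows "adapted F T (\<lambda>\<omega> t. if \<tau> \<omega> \<le> t then indicator A \<omega> else (0::real))"
  unfolding adapted_def
proof (intro allI impI)
  fix t
  have [measurable]: "{\<omega>\<in>A. \<tau> \<omega> \<le> t} \<in> sets (F t)" by (rule sets_pre_sigmaD[OF \<tau> A])
  have "(\<lambda>\<omega>. indicator {\<omega>\<in>A. \<tau> \<omega> \<le> t} \<omega>) \<in> borel_measurable (F t)" by measurable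
  also have "(\<lambda>\<omega>. indicator {\<omega>\<in>A. \<tau> \<omega> \<le> t} \<omega>) = (\<lambda>\<omega>. if \<tau> \<omega> \<le> t then indicator A \<omega> else (0::real))"
    by (auto simp: fun_eq_iff indicator_def)
  finally show "(\<lambda>\<omega>. if \<tau> \<omega> \<le> t then indicator A \<omega> else (0::real)) \<in> borel_measurable (F t)" .
qed

lemma stopping_jump_optional:
  assumes \<tau>: "stopping_time F \<tau>" and A: "A \<in> sets (pre_sigma \<tau>)"
  shows "optional M F T (\<lambda>\<omega> t. if \<tau> \<omega> \<le> t then indicator A \<omega> else (0::real))"
  unfolding optional_def
  by (intro cadlag_optional stopping_jump_adapted[OF assms] ballI cadlag_jump)

lemma stopping_time_min_measurable:
  assumes st: "stopping_time F \<tau>"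
  shows "(\<lambda>\<omega>. min (\<tau> \<omega>) s) \<in> borel_measurable (F s)"
proof (rule borel_measurableI_le)
  fix y
  have "Measurable.pred (F s) (\<lambda>\<omega>. \<tau> \<omega> \<le> min y s)" by (rule stopping_time_le_const[OF st]) simp
  then have "{\<omega> \<in> space (F s). \<tau> \<omega> \<le> min y s} \<in> sets (F s)" by simp
  moreover have "{\<omega> \<in> space (F s). min (\<tau> \<omega>) s \<le> y}
      = (if s \<le> y then space (F s) else {\<omega> \<in> space (F s). \<tau> \<omega> \<le> min y s})"
    by (auto simp: min_le_iff_disj)
  ultimately show "{\<omega> \<in> space (F s). min (\<tau> \<omega>) s \<le> y} \<in> sets (F s)"
    by (cases "s \<le> y") (simp_all only: if_True if_False sets.top)
qed

lemma progressive_stopped: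
  fixes X :: "'a \<Rightarrow> ennreal \<Rightarrow> 'b::topological_space"
  assumes X: "progressive borel X" and \<tau>: "\<tau> \<in> stopping_times M F T"
  shows "(\<lambda>\<omega>. X \<omega> (\<tau> \<omega>)) \<in> borel_measurable (pre_sigma \<tau>)"
proof (rule measurableI)
  have st: "stopping_time F \<tau>" and le: "AE \<omega> in M. \<tau> \<omega> \<le> T" using \<tau> by (auto simp: stopping_times_def)
  fix B :: "'b set" assume B: "B \<in> sets borel"
  have *: "{\<omega> \<in> space M. X \<omega> (\<tau> \<omega>) \<in> B \<and> \<tau> \<omega> \<le> s} \<in> sets (F s)" if "s \<le> T" for s
  proof -
    have 1: "(\<lambda>\<omega>. (\<omega>, min (\<tau> \<omega>) s)) \<in> measurable (F s) (F s \<Otimes>\<^sub>M restrict_space borel {..s})"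
    proof (intro measurable_Pair measurable_restrict_space2)
      show "(\<lambda>\<omega>. min (\<tau> \<omega>) s) \<in> borel_measurable (F s)" by (rule stopping_time_min_measurable[OF st])
    qed auto
    have 2: "(\<lambda>(\<omega>, s). X \<omega> s) \<in> borel_measurable (F s \<Otimes>\<^sub>M restrict_space borel {..s})"
      using X that by (simp add: progressive_def)
    have "(\<lambda>\<omega>. X \<omega> (min (\<tau> \<omega>) s)) \<in> borel_measurable (F s)"
      using measurable_compose[OF 1 2] by simp
    from measurable_sets[OF this B]
    have "{\<omega> \<in> space M. X \<omega> (min (\<tau> \<omega>) s) \<in> B} \<in> sets (F s)"
      by (simp add: vimage_def Int_def conj_commute space_F)
    moreover have "{\<omega> \<in> space M. \<tau> \<omega> \<le> s} \<in> sets (F s)"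
      using stopping_timeD[OF st, of s] by (simp add: pred_def space_F)
    ultimately have "{\<omega> \<in> space M. X \<omega> (min (\<tau> \<omega>) s) \<in> B} \<inter> {\<omega> \<in> space M. \<tau> \<omega> \<le> s} \<in> sets (F s)" by auto
    also have "{\<omega> \<in> space M. X \<omega> (min (\<tau> \<omega>) s) \<in> B} \<inter> {\<omega> \<in> space M. \<tau> \<omega> \<le> s}
        = {\<omega> \<in> space M. X \<omega> (\<tau> \<omega>) \<in> B \<and> \<tau> \<omega> \<le> s}" by (auto simp: min_absorb1)
    finally show ?thesis .
  qed
  have "{\<omega> \<in> space M. X \<omega> (\<tau> \<omega>) \<in> B \<and> \<tau> \<omega> \<le> s} \<in> sets (F s)" for s
  proof (cases "s \<le> T")
    \<comment> \<open>Beyond T nothing is known about X. Since \<tau> exceeds T only on a null set,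
      the event for s agrees almost surely with the event for T.\<close>
    case False
    then have a: "{\<omega> \<in> space M. X \<omega> (\<tau> \<omega>) \<in> B \<and> \<tau> \<omega> \<le> T} \<in> sets (F s)"
      using *[OF order_refl] sets_F_mono[of T s] by (meson linear subsetD)
    have b: "AE \<omega> in M. \<omega> \<in> {\<omega> \<in> space M. X \<omega> (\<tau> \<omega>) \<in> B \<and> \<tau> \<omega> \<le> T}
        \<longleftrightarrow> \<omega> \<in> {\<omega> \<in> space M. X \<omega> (\<tau> \<omega>) \<in> B \<and> \<tau> \<omega> \<le> s}"
      using le by eventually_elim (use False in auto)
    show ?thesis by (rule AE_eq_sets_F[OF a _ b]) auto
  qed (rule *)
  moreover have "{\<omega> \<in> (\<lambda>\<omega>. X \<omega> (\<tau> \<omega>)) -` B \<inter> space (pre_sigma \<tau>). \<tau> \<omega> \<le> s}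
      = {\<omega> \<in> space M. X \<omega> (\<tau> \<omega>) \<in> B \<and> \<tau> \<omega> \<le> s}" for s
    by (auto simp: space_pre_sigma)
  ultimately show "(\<lambda>\<omega>. X \<omega> (\<tau> \<omega>)) -` B \<inter> space (pre_sigma \<tau>) \<in> sets (pre_sigma \<tau>)"
    by (intro sets_pre_sigmaI[OF st]) simp
qed auto

text \<open>A right-continuous path has at most countably many discontinuities, so sampling from the left
  on a refining grid recovers it at almost every time.\<close>

lemma right_continuous_optional_AE:
  fixes X :: "'a process"
  assumes ad: "adapted F T X" and rc: "\<forall>\<omega>\<in>space M. right_continuous_path T (X \<omega>)"
  obtains X' :: "'a process" where "optional M F T X'"
    "\<And>\<omega>. \<omega> \<in> space M \<Longrightarrow> AE t in lebesgue_time T. X' \<omega> t = X \<omega> t"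
proof
  define Y where "Y n \<omega> t = X \<omega> (left_grid n t)" for n \<omega> t
  \<comment> \<open>The upper limit is measurable whether or not the samples converge.\<close>
  let ?X' = "\<lambda>\<omega> t. real_of_ereal (limsup (\<lambda>n. ereal (Y n \<omega> t)))"
  have Y[measurable]: "(\<lambda>z. Y n (fst z) (snd z)) \<in> borel_measurable (optional_sigma M F T)" for n
  proof -
    have g: "(\<lambda>z. left_grid n (snd z)) \<in> measurable (optional_sigma M F T) (count_space (insert 0 (range dense_time)))"
      by (rule measurable_compose[OF measurable_time_optional measurable_left_grid_count])
    \<comment> \<open>A sample that is switched on only from time q is an adapted cadlag process.
      The switch changes nothing in the end, as the left grid never exceeds the current
      time.\<close>
    have f: "(\<lambda>z. if q \<le> snd z then X (fst z) q else 0) \<in> borel_measurable (optional_sigma M F T)" for q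
    proof (cases "q \<le> T")
      case True
      have "adapted F T (\<lambda>\<omega> t. if q \<le> t then X \<omega> q else 0)"
        unfolding adapted_def
      proof (intro allI impI)
        fix t assume "t \<le> T"
        have "(\<lambda>\<omega>. X \<omega> q) \<in> borel_measurable (F q)" using ad True by (simp add: adapted_def)
        then have "q \<le> t \<Longrightarrow> (\<lambda>\<omega>. X \<omega> q) \<in> borel_measurable (F t)"
          by (rule measurable_from_subalg[rotated]) (auto simp: subalgebra_def space_F intro: subsetD[OF sets_F_mono])
        then show "(\<lambda>\<omega>. if q \<le> t then X \<omega> q else 0) \<in> borel_measurable (F t)" by (cases "q \<le> t") auto
      qed
      then have "(\<lambda>(\<omega>, t). if q \<le> t then X \<omega> q else 0) \<in> borel_measurable (optional_sigma M F T)"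
        by (intro cadlag_optional ballI cadlag_jump)
      then show ?thesis by (simp add: case_prod_beta')
    next
      case False
      then show ?thesis
        by (subst measurable_cong[where g="\<lambda>_. 0"]) (auto simp: space_optional_sigma)
    qed
    have "(\<lambda>z. (if left_grid n (snd z) \<le> snd z then X (fst z) (left_grid n (snd z)) else 0))
        \<in> borel_measurable (optional_sigma M F T)"
      using measurable_compose_countable'[where f="\<lambda>q z. if q \<le> snd z then X (fst z) q else 0", OF f g] by simp
    then show ?thesis by (simp add: left_grid_le Y_def)
  qed
  show "optional M F T ?X'" unfolding optional_iff by measurable
  fix \<omega> assume \<omega>: "\<omega> \<in> space M"
  have "AE t in lebesgue_time T. t \<notin> {t. t < T \<and> \<not> isCont (X \<omega>) t}"
    using rc \<omega> by (intro AE_lebesgue_time_countable countable_right_continuous_discontinuities) auto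
  moreover have "AE t in lebesgue_time T. t \<notin> {T}"
    by (rule AE_lebesgue_time_countable) simp
  ultimately show "AE t in lebesgue_time T. ?X' \<omega> t = X \<omega> t"
    using AE_space
  proof eventually_elim
    fix t assume "t \<in> space (lebesgue_time T)" "t \<notin> {T}" "t \<notin> {t. t < T \<and> \<not> isCont (X \<omega>) t}"
    then have "isCont (X \<omega>) t" by (auto simp: order_less_le)
    then have "(\<lambda>n. Y n \<omega> t) \<longlonglongrightarrow> X \<omega> t"
      unfolding Y_def using left_grid_tendsto by (rule isCont_tendsto_compose)
    then have "limsup (\<lambda>n. ereal (Y n \<omega> t)) = ereal (X \<omega> t)"
      by (intro lim_imp_Limsup tendsto_ereal) auto
    then show "?X' \<omega> t = X \<omega> t" by simp
  qed
qed

end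

section \<open>Discount factors\<close>

lemma antimono_left_limit:
  fixes f :: "ennreal \<Rightarrow> real"
  assumes t: "0 < t" and anti: "\<And>a b. a \<le> b \<Longrightarrow> b < t \<Longrightarrow> f b \<le> f a" and bd: "\<And>a. a < t \<Longrightarrow> 0 \<le> f a"
  shows "\<exists>l. (f \<longlongrightarrow> l) (at_left t)"
proof
  let ?l = "Inf (f ` {..<t})"
  have bdd: "bdd_below (f ` {..<t})" using bd by (intro bdd_belowI2[of _ 0]) auto
  have left: "eventually (\<lambda>s. s < t) (at_left t)" by (simp add: eventually_at_filter)
  show "(f \<longlongrightarrow> ?l) (at_left t)"
  proof (rule order_tendstoI)
    fix a assume a: "a < ?l"
    show "eventually (\<lambda>s. a < f s) (at_left t)"
      using left
    proof eventually_elim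
      fix s assume "s < t"
      then have "?l \<le> f s" by (intro cINF_lower[OF bdd]) simp
      then show "a < f s" using a by (rule less_le_trans[rotated])
    qed
  next
    fix a assume "?l < a"
    then obtain b where b: "b < t" "f b < a"
      using t cInf_less_iff[OF _ bdd, of a] by auto
    have "eventually (\<lambda>s. b < s) (at_left t)"
      using b t by (auto simp: eventually_at_left[of 0 t] intro!: exI[of _ b])
    with left show "eventually (\<lambda>s. f s < a) (at_left t)"
    proof eventually_elim
      fix s assume "s < t" "b < s"
      then have "f s \<le> f b" by (intro anti) auto
      then show "f s < a" using b by simp
    qed
  qed
qed

lemma discount_pos: "0 < discount r \<omega> t"
  by (simp add: discount_def)

context usual_filtered_space
begin

lemma bounded_positiveD:
  assumes "bounded_positive M T r"
  obtains K where "0 < K" "\<And>\<omega> t. \<omega> \<in> space M \<Longrightarrow> t \<le> T \<Longrightarrow> 0 < r \<omega> t \<and> r \<omega> t \<le> K"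
proof -
  obtain K where "\<forall>\<omega>\<in>space M. \<forall>t\<le>T. 0 < r \<omega> t \<and> r \<omega> t \<le> K"
    using assms by (auto simp: bounded_positive_def)
  then show thesis by (intro that[of "max K 1"]) (auto intro: max.coboundedI1)
qed

lemma discount_le_1:
  assumes "bounded_positive M T r" "\<omega> \<in> space M" "t \<le> T"
  shows "discount r \<omega> t \<le> 1"
proof -
  have "0 \<le> (\<integral>s. r \<omega> s \<partial>lebesgue_time t)"
    using assms by (intro integral_nonneg_AE AE_I2) (auto simp: bounded_positive_def intro: less_imp_le order_trans)
  then show ?thesis by (simp add: discount_def)
qed

text \<open>The exponent grows at rate at most K, which gives right-continuity; its monotonicity
  gives left limits.\<close>

lemma discount_optional:
  assumes r: "optional M F T r" and bd: "bounded_positive M T r"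
  shows "optional M F T (discount r)"
  unfolding optional_def
proof (rule cadlag_optional)
  have prog: "progressive borel r" by (rule optional_progressive'[OF r])
  show "adapted F T (discount r)"
    unfolding adapted_def
  proof (intro allI impI)
    fix t assume "t \<le> T"
    then have "(\<lambda>(\<omega>, s). r \<omega> s) \<in> borel_measurable (F t \<Otimes>\<^sub>M restrict_space borel {..t})"
      using prog by (simp add: progressive_def)
    then have [measurable]: "(\<lambda>(\<omega>, s). r \<omega> s) \<in> borel_measurable (F t \<Otimes>\<^sub>M lebesgue_time t)"
      by (simp add: measurable_cong_sets[OF sets_pair_measure_cong[OF refl sets_lebesgue_time] refl])
    have "(\<lambda>\<omega>. \<integral>s. r \<omega> s \<partial>lebesgue_time t) \<in> borel_measurable (F t)" by measurable
    then show "(\<lambda>\<omega>. discount r \<omega> t) \<in> borel_measurable (F t)" unfolding discount_def by measurable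
  qed
  obtain K where K: "0 < K" "\<And>\<omega> t. \<omega> \<in> space M \<Longrightarrow> t \<le> T \<Longrightarrow> 0 < r \<omega> t \<and> r \<omega> t \<le> K"
    using bounded_positiveD[OF bd] by blast
  show "\<forall>\<omega>\<in>space M. cadlag_path T (discount r \<omega>)"
  proof
    fix \<omega> assume \<omega>: "\<omega> \<in> space M"
    have meas: "(\<lambda>s. r \<omega> s) \<in> borel_measurable (restrict_space borel {..t})" if "t \<le> T" for t
    proof -
      have "\<omega> \<in> space (F t)" using \<omega> by (simp add: space_F)
      then have 1: "(\<lambda>s. (\<omega>, s)) \<in> measurable (restrict_space borel {..t}) (F t \<Otimes>\<^sub>M restrict_space borel {..t})"
        by (rule measurable_Pair1')
      have 2: "(\<lambda>(\<omega>, s). r \<omega> s) \<in> borel_measurable (F t \<Otimes>\<^sub>M restrict_space borel {..t})"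
        using prog that by (simp add: progressive_def)
      show ?thesis using measurable_compose[OF 1 2] by simp
    qed
    define N where "N t = (\<integral>\<^sup>+s. ennreal (r \<omega> s) * indicator {..t} s \<partial>time_measure)" for t
    have m[measurable]: "(\<lambda>s. ennreal (r \<omega> s) * indicator {..t} s) \<in> borel_measurable time_measure" if "t \<le> T" for t
    proof -
      have "(\<lambda>s. r \<omega> s * indicator {..t} s) \<in> borel_measurable borel"
        using meas[OF that] by (subst (asm) borel_measurable_restrict_space_iff) (auto simp: mult.commute)
      then have "(\<lambda>s. ennreal (r \<omega> s * indicator {..t} s)) \<in> borel_measurable borel" by measurable
      also have "(\<lambda>s. ennreal (r \<omega> s * indicator {..t} s)) = (\<lambda>s. ennreal (r \<omega> s) * indicator {..t} s)"
        by (auto simp: fun_eq_iff indicator_def)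
      finally show ?thesis by (simp add: measurable_cong_sets[OF sets_time_measure refl])
    qed
    \<comment> \<open>This also covers an infinite \<open>N t\<close>, possible only at t =
      \<infinity>: the Bochner integral then defaults to 0, and so does \<open>enn2real\<close>. The
      discount factor may thus jump to 1 at \<infinity>, which is a null set for dt.\<close>
    have D: "discount r \<omega> t = exp (- enn2real (N t))" if t: "t \<le> T" for t
    proof -
      have "(\<integral>s. r \<omega> s \<partial>lebesgue_time t) = enn2real (\<integral>\<^sup>+s. ennreal (r \<omega> s) \<partial>lebesgue_time t)"
        using K(2)[OF \<omega>] t meas[OF t]
        by (intro integral_eq_nn_integral AE_I2)
           (auto simp: measurable_cong_sets[OF sets_lebesgue_time refl] intro: less_imp_le order_trans)
      then show ?thesis by (simp add: discount_def N_def nn_integral_lebesgue_time)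
    qed
    have mono: "N s \<le> N t" if "s \<le> t" for s t
      unfolding N_def using that by (intro nn_integral_mono) (auto simp: indicator_def)
    have Lip: "N s \<le> N t + ennreal K * (s - t)" if "t \<le> s" "s \<le> T" "s < \<infinity>" for s t
    proof -
      have tT: "t \<le> T" using that by simp
      have "N s \<le> (\<integral>\<^sup>+v. ennreal (r \<omega> v) * indicator {..t} v + ennreal K * indicator {t<..s} v \<partial>time_measure)"
        unfolding N_def using that K(2)[OF \<omega>]
        by (intro nn_integral_mono) (auto simp: indicator_def intro!: ennreal_leI order_trans[of _ s T])
      also have "\<dots> = N t + ennreal K * emeasure time_measure {t<..s}"
        unfolding N_def using m[OF tT]
        by (subst nn_integral_add) (auto simp: nn_integral_cmult)
      also have "emeasure time_measure {t<..s} \<le> s - t"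
        using emeasure_time_Ioc[of t "enn2real s"] that by (auto simp: less_top[symmetric])
      finally show ?thesis by (simp add: add_left_mono mult_left_mono)
    qed
    have fin: "N t < \<infinity>" if t: "t \<le> T" "t < \<infinity>" for t
    proof -
      have "N t \<le> (\<integral>\<^sup>+v. ennreal K * indicator {..t} v \<partial>time_measure)"
        unfolding N_def using t K(2)[OF \<omega>]
        by (intro nn_integral_mono) (auto simp: indicator_def intro!: ennreal_leI order_trans[of _ t T])
      also have "\<dots> = ennreal K * emeasure time_measure {..t}" by (simp add: nn_integral_cmult)
      also have "emeasure time_measure {..t} \<le> t"
        using emeasure_time_atMost[of "enn2real t"] t by (auto simp: less_top[symmetric])
      finally have "N t \<le> ennreal K * t" by (simp add: mult_left_mono)
      also have "\<dots> < \<infinity>" using t by (auto simp: ennreal_mult_less_top less_top)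
      finally show ?thesis .
    qed
    show "cadlag_path T (discount r \<omega>)"
      unfolding cadlag_path_def right_continuous_path_def
    proof (intro conjI allI impI)
      fix t assume t: "t < T"
      then have tf: "t < \<infinity>" by (metis infinity_ennreal_def less_le_trans top_greatest)
      obtain b where b: "t < b" "b < T" using dense[OF t] by blast
      then have bf: "b < \<infinity>" by (metis infinity_ennreal_def less_le_trans top_greatest)
      have ev: "eventually (\<lambda>s. t < s \<and> s < b) (at_right t)"
        using b by (auto simp: eventually_at_right[OF b(1)])
      have "((\<lambda>s. N t + ennreal K * (s - t)) \<longlongrightarrow> N t + ennreal K * (t - t)) (at_right t)"
        using tf by (intro tendsto_intros ennreal_tendsto_cmult tendsto_diff_ennreal tendsto_ident_at) auto
      then have up: "((\<lambda>s. N t + ennreal K * (s - t)) \<longlongrightarrow> N t) (at_right t)"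
        using tf by (simp add: less_top[symmetric])
      have "(N \<longlongrightarrow> N t) (at_right t)"
      proof (rule tendsto_sandwich[OF _ _ tendsto_const up])
        show "eventually (\<lambda>s. N t \<le> N s) (at_right t)"
          using ev by eventually_elim (auto intro: mono)
        show "eventually (\<lambda>s. N s \<le> N t + ennreal K * (s - t)) (at_right t)"
          using ev by eventually_elim (use b bf in \<open>auto intro!: Lip\<close>)
      qed
      then have "((\<lambda>s. exp (- enn2real (N s))) \<longlongrightarrow> exp (- enn2real (N t))) (at_right t)"
        using fin[of t] t tf by (intro tendsto_intros tendsto_enn2real) auto
      moreover have "eventually (\<lambda>s. exp (- enn2real (N s)) = discount r \<omega> s) (at_right t)"
        using ev by eventually_elim (use b in \<open>auto simp: D\<close>)
      ultimately show "continuous (at_right t) (discount r \<omega>)"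
        using t by (simp add: continuous_within D tendsto_cong)
    next
      fix t assume t: "0 < t \<and> t \<le> T"
      show "\<exists>l. (discount r \<omega> \<longlongrightarrow> l) (at_left t)"
      \<comment> \<open>Monotonicity is needed only strictly before t, so a possible jump at
        \<infinity> does not interfere.\<close>
      proof (rule antimono_left_limit)
        fix a c assume ac: "a \<le> c" "c < t"
        then have "c < \<infinity>" by (metis infinity_ennreal_def less_le_trans top_greatest)
        moreover have "a \<le> T" "c \<le> T" using ac t by auto
        ultimately show "discount r \<omega> c \<le> discount r \<omega> a"
          using mono[of a c] fin[of c] ac by (simp add: D enn2real_mono)
      qed (use t in \<open>auto simp: discount_pos less_imp_le\<close>)
    qed
  qed
qed

section \<open>Contribution processes\<close>

definition contribution :: "'a process \<Rightarrow> bool" where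
  "contribution C \<longleftrightarrow> adapted F T C \<and> (AE \<omega> in M. increasing_path T (C \<omega>))"

abbreviation jointly_measurable :: "('a \<Rightarrow> ennreal \<Rightarrow> 'c::topological_space) \<Rightarrow> bool" where
  "jointly_measurable f \<equiv> (\<lambda>(\<omega>, t). f \<omega> t) \<in> borel_measurable (M \<Otimes>\<^sub>M lebesgue_time T)"

lemma jointly_measurable_path:
  assumes "jointly_measurable f" "\<omega> \<in> space M"
  shows "f \<omega> \<in> borel_measurable (restrict_space borel {..T})"
  using measurable_compose[OF measurable_Pair1'[OF assms(2), of "lebesgue_time T"] assms(1)]
  by (simp add: measurable_cong_sets[OF sets_lebesgue_time refl])

lemma jointly_measurable_stopped:
  assumes f: "jointly_measurable f" and \<tau>: "\<tau> \<in> borel_measurable M" "\<And>\<omega>. \<omega> \<in> space M \<Longrightarrow> \<tau> \<omega> \<le> T"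
  shows "(\<lambda>\<omega>. f \<omega> (\<tau> \<omega>)) \<in> borel_measurable M"
proof -
  have "\<tau> \<in> measurable M (lebesgue_time T)"
    using \<tau> by (auto simp: measurable_cong_sets[OF refl sets_lebesgue_time] intro: measurable_restrict_space2)
  then have 1: "(\<lambda>\<omega>. (\<omega>, \<tau> \<omega>)) \<in> measurable M (M \<Otimes>\<^sub>M lebesgue_time T)"
    by (intro measurable_Pair measurable_ident_sets refl)
  show ?thesis using measurable_compose[OF 1 f] by simp
qed

text \<open>Exceptional paths are replaced by zero; adaptedness survives because the filtration
  contains the null sets. Pathwise facts about Stieltjes measures then apply at every point of the
  space.\<close>

lemma contribution_version:
  assumes "contribution C"
  obtains C' where "adapted F T C'" "\<And>\<omega>. \<omega> \<in> space M \<Longrightarrow> increasing_path T (C' \<omega>)" "AE \<omega> in M. C' \<omega> = C \<omega>"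
proof
  let ?C = "\<lambda>\<omega>. if increasing_path T (C \<omega>) then C \<omega> else (\<lambda>_. 0)"
  show eq: "AE \<omega> in M. ?C \<omega> = C \<omega>"
  proof -
    have "AE \<omega> in M. increasing_path T (C \<omega>)" using assms by (simp add: contribution_def)
    then show ?thesis by eventually_elim simp
  qed
  show "increasing_path T (?C \<omega>)" for \<omega>
    by (auto simp: increasing_path_def right_continuous_path_def mono_on_def)
  show "adapted F T ?C"
    unfolding adapted_def
  proof (intro allI impI)
    fix t assume "t \<le> T"
    then have "(\<lambda>\<omega>. C \<omega> t) \<in> borel_measurable (F t)" using assms by (simp add: contribution_def adapted_def)
    then show "(\<lambda>\<omega>. ?C \<omega> t) \<in> borel_measurable (F t)"
    proof (rule AE_eq_measurable_F)
      show "AE \<omega> in M. C \<omega> t = ?C \<omega> t" using eq by eventually_elim simp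
    qed simp
  qed
qed

lemma stopping_time_hitting:
  assumes C: "adapted F T C" "\<And>\<omega>. \<omega> \<in> space M \<Longrightarrow> increasing_path T (C \<omega>)"
  shows "stopping_time F (\<lambda>\<omega>. hitting T (C \<omega>) y)"
proof
  fix t
  show "Measurable.pred (F t) (\<lambda>\<omega>. hitting T (C \<omega>) y \<le> t)"
  proof (cases "t < T")
    case True
    then have [measurable]: "(\<lambda>\<omega>. C \<omega> t) \<in> borel_measurable (F t)" using C(1) by (simp add: adapted_def)
    have "Measurable.pred (F t) (\<lambda>\<omega>. y \<le> C \<omega> t)" by measurable
    then show ?thesis
      by (rule measurable_cong[THEN iffD1, rotated]) (use hitting_le_iff[OF C(2) True] in \<open>auto simp: space_F\<close>)
  next
    case False
    then have "hitting T (C \<omega>) y \<le> t" for \<omega> using hitting_le[of T "C \<omega>" y] by auto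
    then show ?thesis by simp
  qed
qed

text \<open>The cut at T hides whether the level is reached at all, and this event tells the two
  cases apart. For t < T, hitting by time t means y \<le> C(t), which already implies the
  event.\<close>

lemma hitting_event:
  assumes C: "adapted F T C" "\<And>\<omega>. \<omega> \<in> space M \<Longrightarrow> increasing_path T (C \<omega>)"
  shows "{\<omega> \<in> space M. y \<le> C \<omega> T} \<in> sets (pre_sigma (\<lambda>\<omega>. hitting T (C \<omega>) y))"
proof (rule sets_pre_sigmaI[OF stopping_time_hitting[OF C]])
  fix t
  show "{\<omega> \<in> {\<omega> \<in> space M. y \<le> C \<omega> T}. hitting T (C \<omega>) y \<le> t} \<in> sets (F t)"
  proof (cases "t < T")
    case True
    then have [measurable]: "(\<lambda>\<omega>. C \<omega> t) \<in> borel_measurable (F t)" using C(1) by (simp add: adapted_def)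
    have "{\<omega> \<in> space (F t). y \<le> C \<omega> t} \<in> sets (F t)" by measurable
    also have "{\<omega> \<in> space (F t). y \<le> C \<omega> t} = {\<omega> \<in> {\<omega> \<in> space M. y \<le> C \<omega> T}. hitting T (C \<omega>) y \<le> t}"
    proof -
      have "C \<omega> t \<le> C \<omega> T" if "\<omega> \<in> space M" for \<omega>
        using C(2)[OF that] monotone_onD[of "{..T}" "(\<le>)" "(\<le>)" "C \<omega>" t T] True by (simp add: increasing_path_def)
      then show ?thesis using hitting_le_iff[OF C(2) True] by (force simp: space_F)
    qed
    finally show ?thesis .
  next
    case False
    have [measurable]: "(\<lambda>\<omega>. C \<omega> T) \<in> borel_measurable (F T)" using C(1) by (simp add: adapted_def)
    have "{\<omega> \<in> space (F T). y \<le> C \<omega> T} \<in> sets (F T)" by measurable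
    then have "{\<omega> \<in> space M. y \<le> C \<omega> T} \<in> sets (F t)"
      using sets_F_mono[of T t] False by (metis not_less space_F subsetD)
    moreover have "hitting T (C \<omega>) y \<le> t" for \<omega> using hitting_le[of T "C \<omega>" y] False by auto
    ultimately show ?thesis by simp
  qed
qed

lemma hitting_jointly_measurable:
  assumes C: "adapted F T C" "\<And>\<omega>. \<omega> \<in> space M \<Longrightarrow> increasing_path T (C \<omega>)"
  shows "(\<lambda>(\<omega>, y). hitting T (C \<omega>) y) \<in> measurable (M \<Otimes>\<^sub>M lborel) (lebesgue_time T)"
proof -
  have "(\<lambda>(\<omega>, y). hitting T (C \<omega>) y) \<in> borel_measurable (M \<Otimes>\<^sub>M lborel)"
  proof (rule borel_measurableI_le)
    fix t
    show "{z \<in> space (M \<Otimes>\<^sub>M lborel). (case z of (\<omega>, y) \<Rightarrow> hitting T (C \<omega>) y) \<le> t} \<in> sets (M \<Otimes>\<^sub>M lborel)"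
    proof (cases "t < T")
      case True
      then have "(\<lambda>\<omega>. C \<omega> t) \<in> borel_measurable (F t)" using C(1) by (simp add: adapted_def)
      then have [measurable]: "(\<lambda>\<omega>. C \<omega> t) \<in> borel_measurable M" by (rule measurable_F_M)
      have "{z \<in> space (M \<Otimes>\<^sub>M lborel). snd z \<le> C (fst z) t} \<in> sets (M \<Otimes>\<^sub>M lborel)" by measurable
      also have "{z \<in> space (M \<Otimes>\<^sub>M lborel). snd z \<le> C (fst z) t}
          = {z \<in> space (M \<Otimes>\<^sub>M lborel). (case z of (\<omega>, y) \<Rightarrow> hitting T (C \<omega>) y) \<le> t}"
        using hitting_le_iff[OF C(2) True] by (auto simp: space_pair_measure)
      finally show ?thesis .
    next
      case False
      then have "hitting T (C \<omega>) y \<le> t" for \<omega> y using hitting_le[of T "C \<omega>" y] by auto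
      then have "{z \<in> space (M \<Otimes>\<^sub>M lborel). (case z of (\<omega>, y) \<Rightarrow> hitting T (C \<omega>) y) \<le> t} = space (M \<Otimes>\<^sub>M lborel)"
        by (auto simp: case_prod_beta)
      then show ?thesis by (simp only: sets.top)
    qed
  qed
  then show ?thesis
    unfolding measurable_cong_sets[OF refl sets_lebesgue_time]
    by (intro measurable_restrict_space2) (auto simp: hitting_le)
qed

text \<open>Change of time: the stopping times at which \<open>C\<close> reaches the levels \<open>y\<close> turn the integral
  against \<open>dC\<close> into one against \<open>dy\<close>.\<close>

lemma stieltjes_time_change:
  assumes C: "adapted F T C" "\<And>\<omega>. \<omega> \<in> space M \<Longrightarrow> increasing_path T (C \<omega>)"
    and f: "jointly_measurable f"
  shows "(\<lambda>\<omega>. \<integral>\<^sup>+t. f \<omega> t \<partial>stieltjes_measure T (C \<omega>)) \<in> borel_measurable M"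
    and "(\<integral>\<^sup>+\<omega>. (\<integral>\<^sup>+t. f \<omega> t \<partial>stieltjes_measure T (C \<omega>)) \<partial>M)
      = (\<integral>\<^sup>+y. (\<integral>\<^sup>+\<omega>\<in>{\<omega> \<in> space M. y \<le> C \<omega> T}. f \<omega> (hitting T (C \<omega>) y) \<partial>M) * indicator {0<..} y \<partial>lborel)"
proof -
  interpret lp: pair_sigma_finite M lborel by standard
  let ?g = "\<lambda>\<omega> y. f \<omega> (hitting T (C \<omega>) y) * indicator {0<..C \<omega> T} y"
  have "(\<lambda>\<omega>. C \<omega> T) \<in> borel_measurable (F T)" using C(1) by (simp add: adapted_def)
  then have [measurable]: "(\<lambda>\<omega>. C \<omega> T) \<in> borel_measurable M" by (rule measurable_F_M)
  have h: "(\<lambda>z. (fst z, hitting T (C (fst z)) (snd z))) \<in> measurable (M \<Otimes>\<^sub>M lborel) (M \<Otimes>\<^sub>M lebesgue_time T)"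
    by (rule measurable_Pair[OF measurable_fst]) (use hitting_jointly_measurable[OF C] in \<open>simp add: case_prod_beta'\<close>)
  have [measurable]: "(\<lambda>z. f (fst z) (hitting T (C (fst z)) (snd z))) \<in> borel_measurable (M \<Otimes>\<^sub>M lborel)"
    using measurable_compose[OF h f] by simp
  have [measurable]: "(\<lambda>z. indicator {0<..C (fst z) T} (snd z) :: ennreal) \<in> borel_measurable (M \<Otimes>\<^sub>M lborel)"
  proof -
    have [measurable]: "{z \<in> space (M \<Otimes>\<^sub>M lborel). 0 < snd z \<and> snd z \<le> C (fst z) T} \<in> sets (M \<Otimes>\<^sub>M lborel)" by measurable
    have "indicator {z \<in> space (M \<Otimes>\<^sub>M lborel). 0 < snd z \<and> snd z \<le> C (fst z) T} \<in> borel_measurable (M \<Otimes>\<^sub>M lborel)"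
      by measurable
    then show ?thesis by (rule measurable_cong[THEN iffD1, rotated]) (auto simp: indicator_def)
  qed
  have g: "(\<lambda>(\<omega>, y). ?g \<omega> y) \<in> borel_measurable (M \<Otimes>\<^sub>M lborel)" unfolding case_prod_beta' by measurable
  have eq: "(\<integral>\<^sup>+t. f \<omega> t \<partial>stieltjes_measure T (C \<omega>)) = (\<integral>\<^sup>+y. ?g \<omega> y \<partial>lborel)" if "\<omega> \<in> space M" for \<omega>
    by (rule nn_integral_stieltjes[OF C(2)[OF that] jointly_measurable_path[OF f that]])
  have "(\<lambda>\<omega>. \<integral>\<^sup>+y. ?g \<omega> y \<partial>lborel) \<in> borel_measurable M"
    using lborel.borel_measurable_nn_integral_fst[OF g] by simp
  then show "(\<lambda>\<omega>. \<integral>\<^sup>+t. f \<omega> t \<partial>stieltjes_measure T (C \<omega>)) \<in> borel_measurable M"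
    by (rule measurable_cong[THEN iffD1, rotated]) (simp add: eq)
  have "(\<integral>\<^sup>+\<omega>. (\<integral>\<^sup>+t. f \<omega> t \<partial>stieltjes_measure T (C \<omega>)) \<partial>M) = (\<integral>\<^sup>+\<omega>. (\<integral>\<^sup>+y. ?g \<omega> y \<partial>lborel) \<partial>M)"
    by (intro nn_integral_cong eq)
  also have "\<dots> = (\<integral>\<^sup>+y. (\<integral>\<^sup>+\<omega>. ?g \<omega> y \<partial>M) \<partial>lborel)"
    by (rule lp.Fubini'[OF g, symmetric])
  also have "\<dots> = (\<integral>\<^sup>+y. (\<integral>\<^sup>+\<omega>\<in>{\<omega> \<in> space M. y \<le> C \<omega> T}. f \<omega> (hitting T (C \<omega>) y) \<partial>M) * indicator {0<..} y \<partial>lborel)"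
  proof (rule nn_integral_cong)
    fix y :: real
    show "(\<integral>\<^sup>+\<omega>. ?g \<omega> y \<partial>M)
      = (\<integral>\<^sup>+\<omega>\<in>{\<omega> \<in> space M. y \<le> C \<omega> T}. f \<omega> (hitting T (C \<omega>) y) \<partial>M) * indicator {0<..} y"
      by (cases "0 < y") (auto intro!: nn_integral_cong simp: indicator_def)
  qed
  finally show "(\<integral>\<^sup>+\<omega>. (\<integral>\<^sup>+t. f \<omega> t \<partial>stieltjes_measure T (C \<omega>)) \<partial>M)
      = (\<integral>\<^sup>+y. (\<integral>\<^sup>+\<omega>\<in>{\<omega> \<in> space M. y \<le> C \<omega> T}. f \<omega> (hitting T (C \<omega>) y) \<partial>M) * indicator {0<..} y \<partial>lborel)" .
qed

lemma stieltjes_integral_measurable: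
  assumes C: "contribution C" and f: "jointly_measurable f"
  shows "(\<lambda>\<omega>. \<integral>\<^sup>+t. f \<omega> t \<partial>stieltjes_measure T (C \<omega>)) \<in> borel_measurable M"
proof -
  obtain C' where C': "adapted F T C'" "\<And>\<omega>. \<omega> \<in> space M \<Longrightarrow> increasing_path T (C' \<omega>)" "AE \<omega> in M. C' \<omega> = C \<omega>"
    using contribution_version[OF C] by blast
  have eq: "AE \<omega> in M. (\<integral>\<^sup>+t. f \<omega> t \<partial>stieltjes_measure T (C' \<omega>)) = (\<integral>\<^sup>+t. f \<omega> t \<partial>stieltjes_measure T (C \<omega>))"
    using C'(3) by eventually_elim simp
  show ?thesis
    by (rule AE_eq_measurable_M[OF stieltjes_time_change(1)[OF C'(1,2) f] _ eq]) simp_all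
qed

text \<open>The bridge from stopping times to dC. After the change of time only hitting times on the
  events {y \<le> C(T)} occur, so the hypothesis applies for every level y and is integrated over
  y.\<close>

lemma stieltjes_integral_mono:
  assumes C: "contribution C" and f: "jointly_measurable f" and g: "jointly_measurable g"
    and le: "\<And>\<tau> A. stopping_time F \<tau> \<Longrightarrow> (\<And>\<omega>. \<tau> \<omega> \<le> T) \<Longrightarrow> A \<in> sets (pre_sigma \<tau>)
      \<Longrightarrow> (\<integral>\<^sup>+\<omega>\<in>A. f \<omega> (\<tau> \<omega>) \<partial>M) \<le> (\<integral>\<^sup>+\<omega>\<in>A. g \<omega> (\<tau> \<omega>) \<partial>M)"
  shows "(\<integral>\<^sup>+\<omega>. (\<integral>\<^sup>+t. f \<omega> t \<partial>stieltjes_measure T (C \<omega>)) \<partial>M)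
    \<le> (\<integral>\<^sup>+\<omega>. (\<integral>\<^sup>+t. g \<omega> t \<partial>stieltjes_measure T (C \<omega>)) \<partial>M)"
proof -
  obtain C' where C': "adapted F T C'" "\<And>\<omega>. \<omega> \<in> space M \<Longrightarrow> increasing_path T (C' \<omega>)" "AE \<omega> in M. C' \<omega> = C \<omega>"
    using contribution_version[OF C] by blast
  have eq: "(\<integral>\<^sup>+\<omega>. (\<integral>\<^sup>+t. h \<omega> t \<partial>stieltjes_measure T (C \<omega>)) \<partial>M)
      = (\<integral>\<^sup>+\<omega>. (\<integral>\<^sup>+t. h \<omega> t \<partial>stieltjes_measure T (C' \<omega>)) \<partial>M)" for h
  proof (rule nn_integral_cong_AE)
    show "AE \<omega> in M. (\<integral>\<^sup>+t. h \<omega> t \<partial>stieltjes_measure T (C \<omega>)) = (\<integral>\<^sup>+t. h \<omega> t \<partial>stieltjes_measure T (C' \<omega>))"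
      using C'(3) by eventually_elim simp
  qed
  have "(\<integral>\<^sup>+\<omega>\<in>{\<omega> \<in> space M. y \<le> C' \<omega> T}. f \<omega> (hitting T (C' \<omega>) y) \<partial>M)
      \<le> (\<integral>\<^sup>+\<omega>\<in>{\<omega> \<in> space M. y \<le> C' \<omega> T}. g \<omega> (hitting T (C' \<omega>) y) \<partial>M)" for y
    by (rule le[OF stopping_time_hitting[OF C'(1,2)] hitting_le hitting_event[OF C'(1,2)]])
  then have "(\<integral>\<^sup>+\<omega>. (\<integral>\<^sup>+t. f \<omega> t \<partial>stieltjes_measure T (C' \<omega>)) \<partial>M)
    \<le> (\<integral>\<^sup>+\<omega>. (\<integral>\<^sup>+t. g \<omega> t \<partial>stieltjes_measure T (C' \<omega>)) \<partial>M)"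
    using stieltjes_time_change(2)[OF C'(1,2) f] stieltjes_time_change(2)[OF C'(1,2) g]
    by (simp add: nn_integral_mono mult_right_mono)
  then show ?thesis using eq[of f] eq[of g] by simp
qed

text \<open>C(t) is the mass that dC gives to [0,t]. Exchanging the order of integration turns a
  density weighted with C into the remaining integral of that density against dC.\<close>

lemma nn_integral_contribution:
  assumes C: "increasing_path T C" and b: "b \<in> borel_measurable (lebesgue_time T)"
  shows "(\<integral>\<^sup>+t. b t * ennreal (C t) \<partial>lebesgue_time T)
    = (\<integral>\<^sup>+s. (\<integral>\<^sup>+t. b t * indicator {s..} t \<partial>lebesgue_time T) \<partial>stieltjes_measure T C)"
proof -
  interpret S: finite_measure "stieltjes_measure T C" by (rule finite_stieltjes_measure[OF C])
  interpret pair_sigma_finite "lebesgue_time T" "stieltjes_measure T C" by standard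
  have 1: "fst \<in> borel_measurable (lebesgue_time T \<Otimes>\<^sub>M stieltjes_measure T C)"
    by (rule measurable_compose[OF measurable_fst])
       (simp add: measurable_cong_sets[OF sets_lebesgue_time refl] measurable_restrict_space1)
  have 2: "snd \<in> borel_measurable (lebesgue_time T \<Otimes>\<^sub>M stieltjes_measure T C)"
    by (rule measurable_compose[OF measurable_snd])
       (simp add: measurable_cong_sets[OF sets_stieltjes_measure refl] measurable_restrict_space1)
  have "(\<lambda>z. indicator {snd z..} (fst z) :: ennreal) \<in> borel_measurable (lebesgue_time T \<Otimes>\<^sub>M stieltjes_measure T C)"
  proof -
    have [measurable]: "{z \<in> space (lebesgue_time T \<Otimes>\<^sub>M stieltjes_measure T C). snd z \<le> fst z}
        \<in> sets (lebesgue_time T \<Otimes>\<^sub>M stieltjes_measure T C)" using 1 2 by measurable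
    have "indicator {z \<in> space (lebesgue_time T \<Otimes>\<^sub>M stieltjes_measure T C). snd z \<le> fst z}
        \<in> borel_measurable (lebesgue_time T \<Otimes>\<^sub>M stieltjes_measure T C)" by measurable
    then show ?thesis by (rule measurable_cong[THEN iffD1, rotated]) (auto simp: indicator_def)
  qed
  then have m: "(\<lambda>(t, s). b t * indicator {s..} t) \<in> borel_measurable (lebesgue_time T \<Otimes>\<^sub>M stieltjes_measure T C)"
    unfolding case_prod_beta' by (intro borel_measurable_times_ennreal measurable_compose[OF measurable_fst b])
  have "(\<integral>\<^sup>+t. b t * ennreal (C t) \<partial>lebesgue_time T)
      = (\<integral>\<^sup>+t. (\<integral>\<^sup>+s. b t * indicator {s..} t \<partial>stieltjes_measure T C) \<partial>lebesgue_time T)"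
  proof (rule nn_integral_cong)
    fix t assume "t \<in> space (lebesgue_time T)"
    then have t: "t \<le> T" by simp
    have ts: "{..t} \<in> sets (stieltjes_measure T C)"
      using t by (auto simp: sets_stieltjes_measure sets_restrict_space_iff)
    have "(\<integral>\<^sup>+s. b t * indicator {s..} t \<partial>stieltjes_measure T C) = (\<integral>\<^sup>+s. b t * indicator {..t} s \<partial>stieltjes_measure T C)"
      by (intro nn_integral_cong) (auto simp: indicator_def)
    also have "\<dots> = b t * ennreal (C t)"
      using emeasure_stieltjes_atMost[OF C t] ts by (simp add: nn_integral_cmult_indicator)
    finally show "b t * ennreal (C t) = (\<integral>\<^sup>+s. b t * indicator {s..} t \<partial>stieltjes_measure T C)" by simp
  qed
  also have "\<dots> = (\<integral>\<^sup>+s. (\<integral>\<^sup>+t. b t * indicator {s..} t \<partial>lebesgue_time T) \<partial>stieltjes_measure T C)"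
    by (rule Fubini'[OF m, symmetric])
  finally show ?thesis .
qed

lemma jointly_measurable_remaining:
  assumes "jointly_measurable b"
  shows "jointly_measurable (\<lambda>\<omega> s. \<integral>\<^sup>+t. b \<omega> t * indicator {s..} t \<partial>lebesgue_time T)"
proof -
  let ?N = "(M \<Otimes>\<^sub>M lebesgue_time T) \<Otimes>\<^sub>M lebesgue_time T"
  have id: "(\<lambda>t. t) \<in> borel_measurable (lebesgue_time T)"
    by (simp add: measurable_cong_sets[OF sets_lebesgue_time refl] measurable_restrict_space1)
  have 1[measurable]: "(\<lambda>z. snd (fst z)) \<in> borel_measurable ?N"
    by (rule measurable_compose[OF measurable_compose[OF measurable_fst measurable_snd] id])
  have 2[measurable]: "(\<lambda>z. snd z) \<in> borel_measurable ?N"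
    by (rule measurable_compose[OF measurable_snd id])
  have "(\<lambda>z. indicator {snd (fst z)..} (snd z) :: ennreal) \<in> borel_measurable ?N"
  proof -
    have [measurable]: "{z \<in> space ?N. snd (fst z) \<le> snd z} \<in> sets ?N" by measurable
    have "indicator {z \<in> space ?N. snd (fst z) \<le> snd z} \<in> borel_measurable ?N" by measurable
    then show ?thesis by (rule measurable_cong[THEN iffD1, rotated]) (auto simp: indicator_def)
  qed
  moreover have "(\<lambda>z. b (fst (fst z)) (snd z)) \<in> borel_measurable ?N"
  proof -
    have "(\<lambda>z. (fst (fst z), snd z)) \<in> measurable ?N (M \<Otimes>\<^sub>M lebesgue_time T)"
      by (intro measurable_Pair measurable_compose[OF measurable_fst measurable_fst] measurable_snd)
    from measurable_compose[OF this assms] show ?thesis by simp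
  qed
  ultimately have "(\<lambda>(p, t). b (fst p) t * indicator {snd p..} t) \<in> borel_measurable ?N"
    by (simp add: case_prod_beta')
  from lebesgue_time.borel_measurable_nn_integral_fst[OF this]
  show ?thesis by (simp add: case_prod_beta')
qed

end

section \<open>Upcrossings\<close>

text \<open>\<open>hold\<close> is the strategy that buys below \<open>a\<close> and sells above \<open>b\<close>: \<open>hold a b x n\<close> tells whether a
  unit is held before \<open>x n\<close> is observed; \<open>ups\<close> counts the sales.\<close>

primrec hold :: "real \<Rightarrow> real \<Rightarrow> (nat \<Rightarrow> real) \<Rightarrow> nat \<Rightarrow> bool" where
  "hold a b x 0 = False"
| "hold a b x (Suc j) = (if hold a b x j then \<not> b < x j else x j < a)"

primrec ups :: "real \<Rightarrow> real \<Rightarrow> (nat \<Rightarrow> real) \<Rightarrow> nat \<Rightarrow> nat" where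
  "ups a b x 0 = 0"
| "ups a b x (Suc j) = ups a b x j + (if hold a b x j \<and> b < x j then 1 else 0)"

text \<open>The discrete stochastic integral of the strategy. The index \<open>Suc j\<close> appears
  because the position over the step from j to j + 1 is fixed once x j has been seen.\<close>

definition gain :: "real \<Rightarrow> real \<Rightarrow> (nat \<Rightarrow> real) \<Rightarrow> nat \<Rightarrow> real" where
  "gain a b x n = (\<Sum>j<n. (if hold a b x (Suc j) then 1 else 0) * (x (Suc j) - x j))"

text \<open>A completed round trip buys below a and sells above b, so it earns more than b - a. An
  open position was also bought below a, which bounds its profit from below by the current value
  minus a.\<close>

lemma ups_le_gain:
  assumes "a < b"
  shows "(b - a) * real (ups a b x n) + (if hold a b x n then x n - a else 0) \<le> gain a b x n"
  by (induction n) (use assms in \<open>auto simp: gain_def algebra_simps split: if_splits\<close>)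

lemma ups_mono: "m \<le> n \<Longrightarrow> ups a b x m \<le> ups a b x n"
  by (induction n) (auto simp: le_Suc_eq)

lemma hold_ups:
  assumes "hold a b x i" "i \<le> l" "b < x l"
  shows "Suc (ups a b x i) \<le> ups a b x (Suc l)"
  using assms
proof (induction "l - i" arbitrary: i)
  case 0
  then show ?case by simp
next
  case (Suc d)
  show ?case
  proof (cases "b < x i")
    case True
    then have "Suc (ups a b x i) \<le> ups a b x (Suc i)" using Suc.prems by simp
    also have "\<dots> \<le> ups a b x (Suc l)" by (rule ups_mono) (use Suc.prems in simp)
    finally show ?thesis .
  next
    case False
    then have "hold a b x (Suc i)" using Suc.prems by simp
    then have "Suc (ups a b x (Suc i)) \<le> ups a b x (Suc l)"
      using Suc.hyps Suc.prems by (intro Suc.hyps(1)) auto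
    then show ?thesis using ups_mono[of i "Suc i" a b x] by simp
  qed
qed

text \<open>Counts k alternations from below a to above b inside S. The recursion quantifies over
  single points of S, so for countable S measurability follows by induction, and alternations in an
  increasing union are found at a finite stage.\<close>

primrec crossings :: "ennreal set \<Rightarrow> (ennreal \<Rightarrow> real) \<Rightarrow> real \<Rightarrow> real \<Rightarrow> nat \<Rightarrow> ennreal \<Rightarrow> ennreal \<Rightarrow> bool" where
  "crossings S f a b 0 l r = True"
| "crossings S f a b (Suc k) l r =
     (\<exists>p\<in>S. \<exists>q\<in>S. l < p \<and> p < q \<and> q < r \<and> f p < a \<and> b < f q \<and> crossings S f a b k q r)"

lemma crossings_mono:
  "crossings S f a b k l r \<Longrightarrow> S \<subseteq> S' \<Longrightarrow> l' \<le> l \<Longrightarrow> r \<le> r' \<Longrightarrow> crossings S' f a b k l' r'"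
proof (induction k arbitrary: l l')
  case (Suc k)
  then obtain p q where "p \<in> S" "q \<in> S" "l < p" "p < q" "q < r" "f p < a" "b < f q" "crossings S f a b k q r"
    by auto
  moreover from this have "crossings S' f a b k q r'" using Suc.IH[of q q] Suc.prems by simp
  moreover have "l' < p" "q < r'" "p \<in> S'" "q \<in> S'"
    using calculation Suc.prems by (auto intro: le_less_trans less_le_trans)
  ultimately show ?case unfolding crossings.simps by blast
qed simp

lemma crossings_Union:
  assumes inc: "\<And>m n. m \<le> n \<Longrightarrow> S m \<subseteq> S n"
  shows "crossings (\<Union>n. S n) f a b k l r \<Longrightarrow> \<exists>n::nat. crossings (S n) f a b k l r"
proof (induction k arbitrary: l)
  case (Suc k)
  then obtain p q i j where pq: "p \<in> S i" "q \<in> S j" "l < p" "p < q" "q < r" "f p < a" "b < f q"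
    "crossings (\<Union>n. S n) f a b k q r"
    by auto
  obtain n where n: "crossings (S n) f a b k q r" using Suc.IH[OF pq(8)] by blast
  let ?N = "max n (max i j)"
  have "crossings (S ?N) f a b k q r" by (rule crossings_mono[OF n inc]) auto
  moreover have "S i \<subseteq> S ?N" "S j \<subseteq> S ?N" by (rule inc, simp add: le_max_iff_disj)+
  then have "p \<in> S ?N" "q \<in> S ?N" using pq by auto
  ultimately show ?case using pq by (intro exI[of _ ?N]) auto
qed simp

text \<open>The greedy strategy misses no alternation: after a value below a it holds a unit, bought
  just now or earlier, and a later value above b forces a sale. The index i separates the part of
  the enumeration that is already spent.\<close>

lemma crossings_ups:
  assumes ab: "a < b" and t: "strict_mono_on {..<N} t" and S: "S \<subseteq> t ` {..<N}"
  shows "crossings S f a b k l r \<Longrightarrow> i \<le> N \<Longrightarrow> (\<And>j. j < N \<Longrightarrow> l < t j \<Longrightarrow> i \<le> j)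
    \<Longrightarrow> ups a b (\<lambda>j. f (t j)) i + k \<le> ups a b (\<lambda>j. f (t j)) N"
proof (induction k arbitrary: l i)
  case 0
  then show ?case by (simp add: ups_mono)
next
  case (Suc k)
  let ?u = "ups a b (\<lambda>j. f (t j))"
  obtain p q where pq: "p \<in> S" "q \<in> S" "l < p" "p < q" "q < r" "f p < a" "b < f q" "crossings S f a b k q r"
    using Suc.prems(1) by auto
  obtain jp jq where j: "jp < N" "p = t jp" "jq < N" "q = t jq" using pq S by blast
  have mono: "t x < t y \<longleftrightarrow> x < y" if "x < N" "y < N" for x y
    using t that by (simp add: strict_mono_on_less)
  have "jp < jq" using pq(4) j mono by auto
  have "i \<le> jp" using Suc.prems(3) j pq by auto
  have "hold a b (\<lambda>j. f (t j)) (Suc jp)" using pq(6) j ab by auto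
  then have "Suc (?u (Suc jp)) \<le> ?u (Suc jq)"
    using \<open>jp < jq\<close> pq(7) j by (intro hold_ups) auto
  moreover have "?u i \<le> ?u (Suc jp)" using \<open>i \<le> jp\<close> by (intro ups_mono) simp
  moreover have "?u (Suc jq) + k \<le> ?u N"
    by (rule Suc.IH[OF pq(8)]) (use j mono in auto)
  ultimately show ?case by simp
qed

context prob_space
begin

text \<open>Doob's upcrossing inequality. The position is decided one step ahead, so the expected
  gain vanishes; an open position loses at most a since the values are nonnegative. The martingale
  property is stated in integrated form, ready to be tested with the event that a unit is
  held.\<close>

lemma expectation_ups_le:
  fixes m :: "nat \<Rightarrow> 'a \<Rightarrow> real"
  assumes G: "\<And>j. subalgebra M (G j)" "\<And>j. sets (G j) \<subseteq> sets (G (Suc j))"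
    and m: "\<And>j. m j \<in> borel_measurable (G j)" "\<And>j \<omega>. 0 \<le> m j \<omega>" "\<And>j \<omega>. m j \<omega> \<le> 1"
    and mart: "\<And>j A. A \<in> sets (G j) \<Longrightarrow> (\<integral>\<omega>. indicator A \<omega> * m (Suc j) \<omega> \<partial>M) = (\<integral>\<omega>. indicator A \<omega> * m j \<omega> \<partial>M)"
    and ab: "0 \<le> a" "a < b"
  shows "(b - a) * (\<integral>\<omega>. real (ups a b (\<lambda>j. m j \<omega>) n) \<partial>M) \<le> a"
    and "(\<lambda>\<omega>. real (ups a b (\<lambda>j. m j \<omega>) n)) \<in> borel_measurable M"
    and "integrable M (\<lambda>\<omega>. real (ups a b (\<lambda>j. m j \<omega>) n))"
proof -
  have space_G: "space (G j) = space M" for j using G(1)[of j] by (simp add: subalgebra_def)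
  have GM: "f \<in> borel_measurable (G j) \<Longrightarrow> f \<in> borel_measurable M" for f :: "'a \<Rightarrow> real" and j
    by (rule measurable_from_subalg[OF G(1)])
  have G': "subalgebra (G (Suc j)) (G j)" for j using G(2)[of j] space_G by (simp add: subalgebra_def)
  have hold: "{\<omega> \<in> space M. hold a b (\<lambda>j. m j \<omega>) (Suc j)} \<in> sets (G j)" for j
  proof (induction j)
    case 0
    have "{\<omega> \<in> space (G 0). m 0 \<omega> < a} \<in> sets (G 0)" using m(1)[of 0] by measurable
    then show ?case by (simp add: space_G)
  next
    case (Suc j)
    have 1: "{\<omega> \<in> space M. hold a b (\<lambda>j. m j \<omega>) (Suc j)} \<in> sets (G (Suc j))"
      using Suc G(2)[of j] by blast
    have 2: "{\<omega> \<in> space (G (Suc j)). b < m (Suc j) \<omega>} \<in> sets (G (Suc j))"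
      "{\<omega> \<in> space (G (Suc j)). m (Suc j) \<omega> < a} \<in> sets (G (Suc j))"
      using m(1)[of "Suc j"] by measurable
    let ?H = "{\<omega> \<in> space M. hold a b (\<lambda>j. m j \<omega>) (Suc j)}"
    have "(?H - {\<omega> \<in> space (G (Suc j)). b < m (Suc j) \<omega>})
      \<union> ({\<omega> \<in> space (G (Suc j)). m (Suc j) \<omega> < a} - ?H) \<in> sets (G (Suc j))"
      using 1 2 by (intro sets.Un sets.Diff)
    also have "(?H - {\<omega> \<in> space (G (Suc j)). b < m (Suc j) \<omega>})
      \<union> ({\<omega> \<in> space (G (Suc j)). m (Suc j) \<omega> < a} - ?H) = {\<omega> \<in> space M. hold a b (\<lambda>j. m j \<omega>) (Suc (Suc j))}"
      unfolding hold.simps(2)[of a b _ "Suc j"] by (auto simp: space_G simp del: hold.simps)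
    finally show ?case .
  qed
  have mM[measurable]: "m j \<in> borel_measurable M" for j by (rule GM[OF m(1)])
  have holdM[measurable]: "{\<omega> \<in> space M. hold a b (\<lambda>j. m j \<omega>) j} \<in> sets M" for j
    using hold G(1) by (cases j) (auto simp: subalgebra_def simp del: hold.simps(2))
  have upsM: "(\<lambda>\<omega>. real (ups a b (\<lambda>j. m j \<omega>) n)) \<in> borel_measurable M" for n
  proof (induction n)
    case (Suc n)
    have [measurable]: "{\<omega> \<in> space M. hold a b (\<lambda>j. m j \<omega>) n} \<in> sets M" by (rule holdM)
    have "(\<lambda>\<omega>. real (ups a b (\<lambda>j. m j \<omega>) n)
        + indicator ({\<omega> \<in> space M. hold a b (\<lambda>j. m j \<omega>) n} \<inter> {\<omega> \<in> space M. b < m n \<omega>}) \<omega>) \<in> borel_measurable M"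
      using Suc by measurable
    then show ?case
      by (rule measurable_cong[THEN iffD1, rotated]) (auto simp: indicator_def)
  qed simp
  then show "(\<lambda>\<omega>. real (ups a b (\<lambda>j. m j \<omega>) n)) \<in> borel_measurable M" .
  have ups_le: "ups a b x n \<le> n" for x by (induction n) auto
  show int: "integrable M (\<lambda>\<omega>. real (ups a b (\<lambda>j. m j \<omega>) n))"
    using upsM ups_le by (intro integrable_const_bound[of _ "real n"]) auto
  have intm: "integrable M (\<lambda>\<omega>. indicator A \<omega> * m j \<omega>)" if "A \<in> sets M" for A j
    using that m(2,3)[of j] by (intro integrable_const_bound[of _ 1]) (auto simp: indicator_def)
  define H where "H j = {\<omega> \<in> space M. hold a b (\<lambda>j. m j \<omega>) (Suc j)}" for j
  have HM: "H j \<in> sets M" for j unfolding H_def by (rule holdM)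
  have gain: "gain a b (\<lambda>j. m j \<omega>) n = (\<Sum>j<n. indicator (H j) \<omega> * m (Suc j) \<omega> - indicator (H j) \<omega> * m j \<omega>)"
    if "\<omega> \<in> space M" for \<omega>
    unfolding gain_def using that by (intro sum.cong) (auto simp: H_def algebra_simps indicator_def simp del: hold.simps)
  have int_gain: "integrable M (\<lambda>\<omega>. gain a b (\<lambda>j. m j \<omega>) n)"
    by (subst Bochner_Integration.integrable_cong[OF refl gain]) (auto intro!: intm HM)
  have "(\<integral>\<omega>. gain a b (\<lambda>j. m j \<omega>) n \<partial>M)
      = (\<Sum>j<n. (\<integral>\<omega>. indicator (H j) \<omega> * m (Suc j) \<omega> \<partial>M) - (\<integral>\<omega>. indicator (H j) \<omega> * m j \<omega> \<partial>M))"
    by (subst Bochner_Integration.integral_cong[OF refl gain])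
       (auto simp: intm HM)
  also have "\<dots> = 0" using mart[OF hold] by (simp add: H_def)
  finally have g0: "(\<integral>\<omega>. gain a b (\<lambda>j. m j \<omega>) n \<partial>M) = 0" .
  have "(\<integral>\<omega>. (b - a) * real (ups a b (\<lambda>j. m j \<omega>) n) \<partial>M) \<le> (\<integral>\<omega>. gain a b (\<lambda>j. m j \<omega>) n + a \<partial>M)"
  proof (rule integral_mono)
    fix \<omega>
    show "(b - a) * real (ups a b (\<lambda>j. m j \<omega>) n) \<le> gain a b (\<lambda>j. m j \<omega>) n + a"
      using ups_le_gain[OF ab(2), of "\<lambda>j. m j \<omega>" n] m(2)[of n \<omega>] ab by (auto split: if_splits)
  qed (use int int_gain in auto)
  also have "\<dots> = a" using int_gain g0 by (simp add: prob_space)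
  finally show "(b - a) * (\<integral>\<omega>. real (ups a b (\<lambda>j. m j \<omega>) n) \<partial>M) \<le> a" by simp
qed

end

section \<open>Regularization\<close>

definition grid_times :: "ennreal \<Rightarrow> ennreal set" where
  "grid_times T = (\<Union>n. grid_points T n)"

lemma countable_grid_times: "countable (grid_times T)"
  unfolding grid_times_def by (rule countable_UN) (simp_all add: countable_finite)

lemma grid_times_le: "q \<in> grid_times T \<Longrightarrow> q \<le> T"
  by (auto simp: grid_times_def grid_points_le)

lemma grid_in_times: "grid T n t \<in> grid_times T"
  using grid_in_points by (auto simp: grid_times_def)

lemma grid_times_between:
  assumes "a < b" "b \<le> T" obtains p where "p \<in> grid_times T" "a < p" "p < b"
proof -
  obtain k where "a < dense_time k" "dense_time k < b" using dense_time_between[OF assms(1)] .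
  then show thesis using assms
    by (intro that[of "dense_time k"]) (auto simp: grid_times_def grid_points_def intro!: exI[of _ "Suc k"])
qed

text \<open>Positive rational levels are enough for paths with values in [0,1]: two of them fit
  above the lower limit and below the upper limit of an oscillating path.\<close>

definition regular :: "ennreal \<Rightarrow> (ennreal \<Rightarrow> real) \<Rightarrow> bool" where
  "regular T f \<longleftrightarrow> (\<forall>a\<in>\<rat>. \<forall>b\<in>\<rat>. 0 < a \<longrightarrow> a < b \<longrightarrow> (\<exists>k. \<not> crossings (grid_times T) f a b k 0 T))"

text \<open>If the lower and the upper limit differed, two rational levels strictly between them
  would violate the dichotomy.\<close>

lemma oscillation_or_limit:
  fixes f :: "'b \<Rightarrow> real"
  assumes bd: "\<And>p. 0 \<le> f p" "\<And>p. f p \<le> 1" and nt: "G \<noteq> bot"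
    and no: "\<And>a b. a \<in> \<rat> \<Longrightarrow> b \<in> \<rat> \<Longrightarrow> 0 < a \<Longrightarrow> a < b
      \<Longrightarrow> eventually (\<lambda>p. a \<le> f p) G \<or> eventually (\<lambda>p. f p \<le> b) G"
  shows "\<exists>l. (f \<longlongrightarrow> l) G"
proof -
  let ?i = "Liminf G (\<lambda>p. ereal (f p))" and ?s = "Limsup G (\<lambda>p. ereal (f p))"
  have i0: "0 \<le> ?i" by (rule Liminf_bounded) (simp add: bd)
  have s1: "?s \<le> 1" by (rule Limsup_bounded) (simp add: bd)
  have le: "?i \<le> ?s" by (rule Liminf_le_Limsup[OF nt])
  have "?i = ?s"
  proof (rule ccontr)
    assume "?i \<noteq> ?s"
    then have less: "?i < ?s" using le by simp
    obtain i s where i_s: "?i = ereal i" "?s = ereal s"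
      using i0 s1 le by (cases ?i; cases ?s) auto
    then have "i < s" using less i_s by simp
    then obtain b where b: "b \<in> \<rat>" "i < b" "b < s" using Rats_dense_in_real by blast
    obtain a where a: "a \<in> \<rat>" "i < a" "a < b" using Rats_dense_in_real[OF b(2)] by blast
    have "0 < a" using i0 i_s a by simp
    from no[OF a(1) b(1) this a(3)] show False
    proof
      assume "eventually (\<lambda>p. a \<le> f p) G"
      then have "ereal a \<le> ?i" by (intro Liminf_bounded) simp
      then show False using i_s a by simp
    next
      assume "eventually (\<lambda>p. f p \<le> b) G"
      then have "?s \<le> ereal b" by (intro Limsup_bounded) simp
      then show False using i_s b by simp
    qed
  qed
  moreover obtain i where "?i = ereal i" using i0 s1 le by (cases ?i; cases ?s) auto
  ultimately have "((\<lambda>p. ereal (f p)) \<longlongrightarrow> ereal i) G"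
    by (intro Liminf_eq_Limsup[OF nt]) auto
  then show ?thesis by auto
qed

lemma grid_times_right_nontrivial:
  assumes t: "t < T" shows "at t within (grid_times T \<inter> {t<..}) \<noteq> bot"
  unfolding trivial_limit_def eventually_at_topological
proof safe
  fix S assume S: "open S" "t \<in> S" "\<forall>x\<in>S. x \<noteq> t \<longrightarrow> x \<in> grid_times T \<inter> {t<..} \<longrightarrow> False"
  obtain b where b: "t < b" "{t..<b} \<subseteq> S" using open_right[OF S(1,2) t] by blast
  obtain p where "p \<in> grid_times T" "t < p" "p < min b T"
    using grid_times_between[of t "min b T" T] b t by auto
  moreover from this have "p \<in> S" using b by auto
  ultimately show False using S(3) by auto
qed

text \<open>Oscillation to the right of t yields arbitrarily many alternations. They are built
  backwards: each new pair is placed between t and the pairs already found.\<close>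

lemma regular_right_limit:
  assumes f: "regular T f" "\<And>p. 0 \<le> f p" "\<And>p. f p \<le> 1" and t: "t < T"
  shows "\<exists>l. (f \<longlongrightarrow> l) (at t within (grid_times T \<inter> {t<..}))"
proof (rule oscillation_or_limit[OF f(2,3)])
  show "at t within (grid_times T \<inter> {t<..}) \<noteq> bot"
    by (rule grid_times_right_nontrivial[OF t])
  fix a b :: real assume ab: "a \<in> \<rat>" "b \<in> \<rat>" "0 < a" "a < b"
  show "eventually (\<lambda>p. a \<le> f p) (at t within (grid_times T \<inter> {t<..}))
      \<or> eventually (\<lambda>p. f p \<le> b) (at t within (grid_times T \<inter> {t<..}))"
  proof (rule ccontr)
    assume neg: "\<not> ?thesis"
    have ev: "eventually P (at t within (grid_times T \<inter> {t<..}))"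
      if "t < s" "\<And>p. p \<in> grid_times T \<Longrightarrow> t < p \<Longrightarrow> p < s \<Longrightarrow> P p" for P s
      unfolding eventually_at_topological using that by (intro exI[of _ "{..<s}"]) auto
    have lo: "\<exists>p\<in>grid_times T. t < p \<and> p < s \<and> f p < a" if "t < s" for s
      using ev[OF that, of "\<lambda>p. a \<le> f p"] neg by force
    have hi: "\<exists>p\<in>grid_times T. t < p \<and> p < s \<and> b < f p" if "t < s" for s
      using ev[OF that, of "\<lambda>p. f p \<le> b"] neg by force
    have "\<exists>l>t. crossings (grid_times T) f a b k l T" for k
    proof (induction k)
      case 0
      show ?case using t by auto
    next
      case (Suc k)
      then obtain l where l: "l > t" "crossings (grid_times T) f a b k l T" by blast
      obtain q where q: "q \<in> grid_times T" "t < q" "q < min l T" "b < f q" using hi[of "min l T"] l t by auto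
      obtain p where p: "p \<in> grid_times T" "t < p" "p < q" "f p < a" using lo[of q] q by auto
      obtain l' where l': "t < l'" "l' < p" using dense[OF p(2)] by blast
      have "crossings (grid_times T) f a b k q T"
        by (rule crossings_mono[OF l(2)]) (use q in auto)
      then show ?case using p q l' by (intro exI[of _ l']) auto
    qed
    then have "crossings (grid_times T) f a b k 0 T" for k by (metis crossings_mono order_refl zero_le)
    then show False using f(1) ab unfolding regular_def by blast
  qed
qed

text \<open>Here the alternations run towards t: the induction generalises their left end and keeps
  the right end at t.\<close>

lemma regular_left_limit:
  assumes f: "regular T f" "\<And>p. 0 \<le> f p" "\<And>p. f p \<le> 1" and t: "0 < t" "t \<le> T"
  shows "\<exists>l. (f \<longlongrightarrow> l) (at t within (grid_times T \<inter> {..<t}))"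
proof (rule oscillation_or_limit[OF f(2,3)])
  show "at t within (grid_times T \<inter> {..<t}) \<noteq> bot"
    unfolding trivial_limit_def eventually_at_topological
  proof safe
    fix S assume S: "open S" "t \<in> S" "\<forall>x\<in>S. x \<noteq> t \<longrightarrow> x \<in> grid_times T \<inter> {..<t} \<longrightarrow> False"
    obtain b where b: "b < t" "{b<..t} \<subseteq> S" using open_left[OF S(1,2) t(1)] by blast
    obtain p where "p \<in> grid_times T" "b < p" "p < t"
      using grid_times_between[OF b(1) t(2)] by blast
    moreover from this have "p \<in> S" using b by auto
    ultimately show False using S(3) by auto
  qed
  fix a b :: real assume ab: "a \<in> \<rat>" "b \<in> \<rat>" "0 < a" "a < b"
  show "eventually (\<lambda>p. a \<le> f p) (at t within (grid_times T \<inter> {..<t}))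
      \<or> eventually (\<lambda>p. f p \<le> b) (at t within (grid_times T \<inter> {..<t}))"
  proof (rule ccontr)
    assume neg: "\<not> ?thesis"
    have ev: "eventually P (at t within (grid_times T \<inter> {..<t}))"
      if "s < t" "\<And>p. p \<in> grid_times T \<Longrightarrow> s < p \<Longrightarrow> p < t \<Longrightarrow> P p" for P s
      unfolding eventually_at_topological using that by (intro exI[of _ "{s<..}"]) auto
    have lo: "\<exists>p\<in>grid_times T. s < p \<and> p < t \<and> f p < a" if "s < t" for s
      using ev[OF that, of "\<lambda>p. a \<le> f p"] neg by force
    have hi: "\<exists>p\<in>grid_times T. s < p \<and> p < t \<and> b < f p" if "s < t" for s
      using ev[OF that, of "\<lambda>p. f p \<le> b"] neg by force
    have "l < t \<Longrightarrow> crossings (grid_times T) f a b k l t" for k l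
    proof (induction k arbitrary: l)
      case (Suc k)
      obtain p where p: "p \<in> grid_times T" "l < p" "p < t" "f p < a" using lo[OF Suc.prems] by auto
      obtain q where q: "q \<in> grid_times T" "p < q" "q < t" "b < f q" using hi[OF p(3)] by auto
      then show ?case using p Suc.IH[OF q(3)] by auto
    qed simp
    then have "crossings (grid_times T) f a b k 0 T" for k
      by (rule crossings_mono) (use t in auto)
    then show False using f(1) ab unfolding regular_def by blast
  qed
qed

text \<open>No relevant time lies to the right of T, so the value at T is kept; T belongs to every
  grid.\<close>

definition right_limits :: "ennreal \<Rightarrow> (ennreal \<Rightarrow> real) \<Rightarrow> ennreal \<Rightarrow> real" where
  "right_limits T f t = (if t < T then Lim (at t within (grid_times T \<inter> {t<..})) f else f T)"

lemma right_limits_tendsto: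
  assumes f: "regular T f" "\<And>p. 0 \<le> f p" "\<And>p. f p \<le> 1" and t: "t < T"
  shows "(f \<longlongrightarrow> right_limits T f t) (at t within (grid_times T \<inter> {t<..}))"
    and "at t within (grid_times T \<inter> {t<..}) \<noteq> bot"
proof -
  show nt: "at t within (grid_times T \<inter> {t<..}) \<noteq> bot"
    by (rule grid_times_right_nontrivial[OF t])
  obtain l where "(f \<longlongrightarrow> l) (at t within (grid_times T \<inter> {t<..}))"
    using regular_right_limit[OF assms] by blast
  then show "(f \<longlongrightarrow> right_limits T f t) (at t within (grid_times T \<inter> {t<..}))"
    using tendsto_Lim[OF nt] t by (auto simp: right_limits_def)
qed

lemma right_limits_grid:
  assumes f: "regular T f" "\<And>p. 0 \<le> f p" "\<And>p. f p \<le> 1" and t: "t \<le> T"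
  shows "(\<lambda>n. f (grid T n t)) \<longlonglongrightarrow> right_limits T f t"
proof (cases "t < T")
  case True
  have "filterlim (\<lambda>n. grid T n t) (at t within (grid_times T \<inter> {t<..})) sequentially"
    unfolding filterlim_at using grid_tendsto[OF t] grid_gt[OF True] grid_in_times
    by (auto intro!: always_eventually) (metis less_irrefl)
  from filterlim_compose[OF right_limits_tendsto(1)[OF f True] this] show ?thesis .
next
  case False
  then have "t = T" using t by simp
  then show ?thesis by (simp add: right_limits_def)
qed

text \<open>Only weak inequalities pass to the limit. The continuity arguments below therefore start
  from e / 2 and end strictly below e.\<close>

lemma right_limits_close:
  assumes f: "regular T f" "\<And>p. 0 \<le> f p" "\<And>p. f p \<le> 1"
    and c: "\<And>p. p \<in> grid_times T \<Longrightarrow> u < p \<Longrightarrow> p < w \<Longrightarrow> \<bar>f p - c\<bar> \<le> e"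
    and v: "u \<le> v" "v < w" "v < T"
  shows "\<bar>right_limits T f v - c\<bar> \<le> e"
proof (rule tendsto_upperbound)
  show "((\<lambda>p. \<bar>f p - c\<bar>) \<longlongrightarrow> \<bar>right_limits T f v - c\<bar>) (at v within (grid_times T \<inter> {v<..}))"
    by (intro tendsto_intros right_limits_tendsto(1)[OF f v(3)])
  show "eventually (\<lambda>p. \<bar>f p - c\<bar> \<le> e) (at v within (grid_times T \<inter> {v<..}))"
    unfolding eventually_at_topological using v c by (intro exI[of _ "{..<w}"]) auto
qed (rule right_limits_tendsto(2)[OF f v(3)])

lemma cadlag_right_limits:
  assumes f: "regular T f" "\<And>p. 0 \<le> f p" "\<And>p. f p \<le> 1"
  shows "cadlag_path T (right_limits T f)"
  unfolding cadlag_path_def right_continuous_path_def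
proof (intro conjI allI impI)
  fix t assume t: "t < T"
  show "continuous (at_right t) (right_limits T f)"
    unfolding continuous_within
  proof (rule tendstoI)
    fix e :: real assume e: "0 < e"
    have "eventually (\<lambda>p. dist (f p) (right_limits T f t) < e / 2) (at t within (grid_times T \<inter> {t<..}))"
      using e by (intro tendstoD[OF right_limits_tendsto(1)[OF f t]]) auto
    then obtain S where S: "open S" "t \<in> S" "\<And>p. p \<in> S \<Longrightarrow> p \<noteq> t \<Longrightarrow> p \<in> grid_times T \<inter> {t<..} \<Longrightarrow> dist (f p) (right_limits T f t) < e / 2"
      unfolding eventually_at_topological by blast
    obtain b where b: "t < b" "{t..<b} \<subseteq> S" using open_right[OF S(1,2) t] by blast
    have c: "\<bar>f p - right_limits T f t\<bar> \<le> e / 2" if "p \<in> grid_times T" "t < p" "p < b" for p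
    proof -
      have "p \<noteq> t" "p \<in> S" using that subsetD[OF b(2), of p] by auto
      then show ?thesis using S(3)[of p] that by (auto simp: dist_real_def)
    qed
    have "\<bar>right_limits T f v - right_limits T f t\<bar> < e" if "t < v" "v < min b T" for v
      using right_limits_close[of T f t b "right_limits T f t" "e / 2" v, OF f c] that e by (simp add: less_imp_le)
    then show "eventually (\<lambda>v. dist (right_limits T f v) (right_limits T f t) < e) (at_right t)"
      using b t e by (auto simp: eventually_at_right[OF t] dist_real_def intro!: exI[of _ "min b T"])
  qed
next
  fix t assume t: "0 < t \<and> t \<le> T"
  then obtain l where l: "(f \<longlongrightarrow> l) (at t within (grid_times T \<inter> {..<t}))"
    using regular_left_limit[OF f] by blast
  have "(right_limits T f \<longlongrightarrow> l) (at_left t)"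
  proof (rule tendstoI)
    fix e :: real assume e: "0 < e"
    have "eventually (\<lambda>p. dist (f p) l < e / 2) (at t within (grid_times T \<inter> {..<t}))"
      using e by (intro tendstoD[OF l]) auto
    then obtain S where S: "open S" "t \<in> S" "\<And>p. p \<in> S \<Longrightarrow> p \<noteq> t \<Longrightarrow> p \<in> grid_times T \<inter> {..<t} \<Longrightarrow> dist (f p) l < e / 2"
      unfolding eventually_at_topological by blast
    obtain b where b: "b < t" "{b<..t} \<subseteq> S" using open_left[OF S(1,2)] t by blast
    have c: "\<bar>f p - l\<bar> \<le> e / 2" if "p \<in> grid_times T" "b < p" "p < t" for p
    proof -
      have "p \<noteq> t" "p \<in> S" using that subsetD[OF b(2), of p] by auto
      then show ?thesis using S(3)[of p] that by (auto simp: dist_real_def)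
    qed
    have "\<bar>right_limits T f v - l\<bar> < e" if "b < v" "v < t" for v
      using right_limits_close[of T f b t l "e / 2" v, OF f c] that t e less_le_trans[of v t T] by (simp add: less_imp_le)
    then show "eventually (\<lambda>v. dist (right_limits T f v) l < e) (at_left t)"
      using b t e by (auto simp: eventually_at_left[OF b(1)] dist_real_def intro!: exI[of _ b])
  qed
  then show "\<exists>l. (right_limits T f \<longlongrightarrow> l) (at_left t)" by blast
qed

section \<open>Cadlag versions of the martingales P(A | F_t)\<close>

context usual_filtered_space
begin

text \<open>The truncation at 1 makes the bounds hold at every point instead of almost everywhere,
  so the pathwise regularisation applies without exceptional sets; almost surely it changes
  nothing.\<close>

definition cprob :: "'a set \<Rightarrow> ennreal \<Rightarrow> 'a \<Rightarrow> real" where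
  "cprob A q \<omega> = enn2real (min 1 (nn_cond_exp M (F q) (indicator A) \<omega>))"

lemma cprob_bounds: "0 \<le> cprob A q \<omega>" "cprob A q \<omega> \<le> 1"
  by (auto simp: cprob_def intro: enn2real_leI)

lemma cprob_measurable [measurable]: "cprob A q \<in> borel_measurable (F q)"
  unfolding cprob_def by measurable

lemma cprob_eq:
  assumes [measurable]: "A \<in> sets M"
  shows "AE \<omega> in M. ennreal (cprob A q \<omega>) = nn_cond_exp M (F q) (indicator A) \<omega>"
proof -
  interpret sigma_finite_subalgebra M "F q" by (rule finite_subalgebra_F)
  have "AE \<omega> in M. nn_cond_exp M (F q) (indicator A) \<omega> \<le> nn_cond_exp M (F q) (\<lambda>_. 1) \<omega>"
    by (rule nn_cond_exp_mono) (auto simp: indicator_def)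
  moreover have "AE \<omega> in M. 1 = nn_cond_exp M (F q) (\<lambda>_. 1) \<omega>"
    by (rule nn_cond_exp_F_meas) simp
  ultimately show ?thesis
  proof eventually_elim
    case (elim \<omega>)
    then have "nn_cond_exp M (F q) (indicator A) \<omega> \<le> 1" by simp
    moreover from this have "nn_cond_exp M (F q) (indicator A) \<omega> \<noteq> top"
      by (metis ennreal_one_neq_top neq_top_trans)
    ultimately show ?case by (simp add: cprob_def min_absorb2 ennreal_enn2real_if)
  qed
qed

lemma cprob_integral:
  assumes A[measurable]: "A \<in> sets M" and B: "B \<in> sets (F q)"
  shows "(\<integral>\<^sup>+\<omega>\<in>B. ennreal (cprob A q \<omega>) \<partial>M) = emeasure M (A \<inter> B)"
proof -
  interpret sigma_finite_subalgebra M "F q" by (rule finite_subalgebra_F)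
  have [measurable]: "B \<in> sets (F q)" "B \<in> sets M" using B sets_F_subset by auto
  have "(\<integral>\<^sup>+\<omega>\<in>B. ennreal (cprob A q \<omega>) \<partial>M)
      = (\<integral>\<^sup>+\<omega>. indicator B \<omega> * nn_cond_exp M (F q) (indicator A) \<omega> \<partial>M)"
    using cprob_eq[OF A, of q] by (intro nn_integral_cong_AE) (auto simp: mult.commute elim!: eventually_mono)
  also have "\<dots> = (\<integral>\<^sup>+\<omega>. indicator B \<omega> * indicator A \<omega> \<partial>M)"
    by (rule nn_cond_exp_intg) auto
  also have "\<dots> = (\<integral>\<^sup>+\<omega>. indicator (A \<inter> B) \<omega> \<partial>M)"
    by (intro nn_integral_cong) (auto simp: indicator_def)
  finally show ?thesis by simp
qed

lemma cprob_integral_real: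
  assumes A: "A \<in> sets M" and B: "B \<in> sets (F q)"
  shows "(\<integral>\<omega>. indicator B \<omega> * cprob A q \<omega> \<partial>M) = measure M (A \<inter> B)"
proof -
  have [measurable]: "B \<in> sets M" using B sets_F_subset by auto
  have [measurable]: "cprob A q \<in> borel_measurable M" by (rule measurable_F_M[OF cprob_measurable])
  have "(\<integral>\<omega>. indicator B \<omega> * cprob A q \<omega> \<partial>M) = enn2real (\<integral>\<^sup>+\<omega>. ennreal (indicator B \<omega> * cprob A q \<omega>) \<partial>M)"
    by (intro integral_eq_nn_integral) (auto simp: cprob_bounds)
  also have "(\<integral>\<^sup>+\<omega>. ennreal (indicator B \<omega> * cprob A q \<omega>) \<partial>M) = (\<integral>\<^sup>+\<omega>\<in>B. ennreal (cprob A q \<omega>) \<partial>M)"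
    by (intro nn_integral_cong) (auto simp: indicator_def)
  finally show ?thesis using cprob_integral[OF A B] by (simp add: measure_def)
qed

lemma cprob_crossings_measurable:
  assumes "countable S" "S \<subseteq> {..T}"
  shows "Measurable.pred M (\<lambda>\<omega>. crossings S (\<lambda>q. cprob A q \<omega>) a b k l r)"
proof (induction k arbitrary: l)
  case (Suc k)
  have [measurable]: "cprob A q \<in> borel_measurable M" for q by (rule measurable_F_M[OF cprob_measurable])
  have [measurable]: "Measurable.pred M (\<lambda>\<omega>. crossings S (\<lambda>q. cprob A q \<omega>) a b k q r)" for q by (rule Suc)
  show ?case
    unfolding crossings.simps by (intro measurable_pred_countable(2) assms(1)) measurable
qed simp

lemma cprob_crossings_bound:
  assumes A: "A \<in> sets M" and ab: "0 \<le> a" "a < b" and k: "0 < k"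
  shows "prob {\<omega> \<in> space M. crossings (grid_points T n) (\<lambda>q. cprob A q \<omega>) a b k 0 T} \<le> a / ((b - a) * real k)"
proof -
  define N where "N = card (grid_points T n)"
  \<comment> \<open>The grid points in increasing order, continued by T so that the discrete
    filtration is defined and increasing for all indices.\<close>
  define t where "t j = (if j < N then sorted_list_of_set (grid_points T n) ! j else T)" for j
  have len: "length (sorted_list_of_set (grid_points T n)) = N" by (simp add: N_def)
  have strict: "strict_mono_on {..<N} t"
    using strict_sorted_list_of_set[of "grid_points T n"] len
    by (auto simp: strict_mono_on_def t_def sorted_wrt_iff_nth_less)
  have img: "t ` {..<N} = grid_points T n"
  proof -
    have "t ` {..<N} = set (sorted_list_of_set (grid_points T n))"
      unfolding set_conv_nth using len by (auto simp: t_def)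
    then show ?thesis by simp
  qed
  have t_le: "t j \<le> T" for j using img grid_points_le[of "t j" T n] by (cases "j < N") (auto simp: t_def)
  have t_mono: "t j \<le> t (Suc j)" for j
  proof (cases "Suc j < N")
    case True
    then show ?thesis using strict by (simp add: strict_mono_on_def less_imp_le)
  next
    case False
    then show ?thesis using t_le[of j] by (simp add: t_def[of "Suc j"])
  qed
  define G where "G j = F (t j)" for j
  define m where "m j = cprob A (t j)" for j
  have sub: "sets (G j) \<subseteq> sets (G (Suc j))" for j unfolding G_def by (rule sets_F_mono[OF t_mono])
  have mart: "(\<integral>\<omega>. indicator B \<omega> * m (Suc j) \<omega> \<partial>M) = (\<integral>\<omega>. indicator B \<omega> * m j \<omega> \<partial>M)"
    if "B \<in> sets (G j)" for j B
    using that sub[of j] cprob_integral_real[OF A, of B] unfolding m_def G_def by (metis subsetD)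
  let ?u = "\<lambda>\<omega>. real (ups a b (\<lambda>j. m j \<omega>) N)"
  have 1: "subalgebra M (G j)" "m j \<in> borel_measurable (G j)" "0 \<le> m j \<omega>" "m j \<omega> \<le> 1" for j \<omega>
    by (simp_all add: G_def m_def subalgebra_F cprob_bounds)
  note ups = expectation_ups_le[where G=G and m=m and n=N, OF 1(1) sub 1(2-4) mart ab]
  have cross: "real k \<le> ?u \<omega>" if "crossings (grid_points T n) (\<lambda>q. cprob A q \<omega>) a b k 0 T" for \<omega>
    using crossings_ups[OF ab(2) strict equalityD2[OF img] that, of 0] by (auto simp: m_def)
  have "real k * prob {\<omega> \<in> space M. crossings (grid_points T n) (\<lambda>q. cprob A q \<omega>) a b k 0 T} \<le> expectation ?u"
  proof -
    have [measurable]: "{\<omega> \<in> space M. crossings (grid_points T n) (\<lambda>q. cprob A q \<omega>) a b k 0 T} \<in> sets M"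
      using cprob_crossings_measurable[OF countable_finite[OF finite_grid_points], of T n]
      by (simp add: pred_def grid_points_le subset_eq)
    have "(\<integral>\<omega>. real k * indicator {\<omega> \<in> space M. crossings (grid_points T n) (\<lambda>q. cprob A q \<omega>) a b k 0 T} \<omega> \<partial>M)
        \<le> expectation ?u"
    proof (rule integral_mono)
      show "integrable M (\<lambda>\<omega>. real k * indicator {\<omega> \<in> space M. crossings (grid_points T n) (\<lambda>q. cprob A q \<omega>) a b k 0 T} \<omega>)"
        by (intro integrable_mult_right integrable_real_indicator) (auto simp: emeasure_eq_measure)
    qed (use cross ups(3) in \<open>auto simp: indicator_def\<close>)
    then show ?thesis by simp
  qed
  also have "(b - a) * expectation ?u \<le> a" by (rule ups(1))
  then have "expectation ?u \<le> a / (b - a)" using ab by (simp add: field_simps)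
  finally show ?thesis using k ab by (simp add: field_simps)
qed

text \<open>The upcrossing bound is the same for all n, so it extends to the union of the grids, and
  it tends to 0 as k grows. The pairs of rational levels are countable, so one null set serves them
  all.\<close>

lemma cprob_regular:
  assumes A: "A \<in> sets M"
  shows "AE \<omega> in M. regular T (\<lambda>q. cprob A q \<omega>)"
proof -
  have "AE \<omega> in M. \<exists>k. \<not> crossings (grid_times T) (\<lambda>q. cprob A q \<omega>) a b k 0 T" if ab: "0 < a" "a < b" for a b
  proof -
    let ?E = "\<lambda>k n. {\<omega> \<in> space M. crossings (grid_points T n) (\<lambda>q. cprob A q \<omega>) a b k 0 T}"
    let ?X = "\<lambda>k. {\<omega> \<in> space M. crossings (grid_times T) (\<lambda>q. cprob A q \<omega>) a b k 0 T}"
    have E[measurable]: "?E k n \<in> sets M" for k n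
      using cprob_crossings_measurable[OF countable_finite[OF finite_grid_points], of T n]
      by (simp add: pred_def grid_points_le subset_eq)
    have X[measurable]: "?X k \<in> sets M" for k
      using cprob_crossings_measurable[OF countable_grid_times, of T]
      by (simp add: pred_def grid_times_le subset_eq)
    have XE: "?X k = (\<Union>n. ?E k n)" for k
    proof -
      have "crossings (grid_times T) f a b k 0 T \<longleftrightarrow> (\<exists>n. crossings (grid_points T n) f a b k 0 T)" for f
      proof
        assume "\<exists>n. crossings (grid_points T n) f a b k 0 T"
        then obtain n where n: "crossings (grid_points T n) f a b k 0 T" by blast
        show "crossings (grid_times T) f a b k 0 T"
          by (rule crossings_mono[OF n]) (auto simp: grid_times_def)
      next
        assume "crossings (grid_times T) f a b k 0 T"
        then show "\<exists>n. crossings (grid_points T n) f a b k 0 T"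
          unfolding grid_times_def using crossings_Union[of "grid_points T", OF grid_points_mono] by blast
      qed
      then show ?thesis by auto
    qed
    have "prob (?X k) \<le> a / ((b - a) * real k)" if "0 < k" for k
    proof -
      have "incseq (?E k)"
        by (auto simp: incseq_def intro: crossings_mono[OF _ grid_points_mono])
      then have "(\<lambda>n. prob (?E k n)) \<longlonglongrightarrow> prob (\<Union>n. ?E k n)"
        by (intro finite_Lim_measure_incseq) auto
      then have "prob (\<Union>n. ?E k n) \<le> a / ((b - a) * real k)"
        using cprob_crossings_bound[OF A _ ab(2) that] ab by (intro LIMSEQ_le_const2) auto
      then show ?thesis by (simp add: XE)
    qed
    then have le: "prob (\<Inter>k. ?X k) \<le> a / ((b - a) * real (Suc k))" for k
      using finite_measure_mono[OF INT_lower[OF UNIV_I, of ?X "Suc k"] X] by (rule order_trans[rotated]) simp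
    have "(\<lambda>k. a / ((b - a) * real (Suc k))) \<longlonglongrightarrow> 0"
    proof -
      have "(\<lambda>k. (a / (b - a)) * inverse (real (Suc k))) \<longlonglongrightarrow> (a / (b - a)) * 0"
        by (intro tendsto_intros LIMSEQ_inverse_real_of_nat)
      then show ?thesis by (simp add: field_simps)
    qed
    then have "prob (\<Inter>k. ?X k) \<le> 0" by (rule LIMSEQ_le_const) (use le in auto)
    then have "prob (\<Inter>k. ?X k) = 0" by (simp add: measure_le_0_iff)
    then have "(\<Inter>k. ?X k) \<in> null_sets M" by (auto simp: null_sets_def emeasure_eq_measure)
    then show ?thesis by (rule AE_I') auto
  qed
  then have "AE \<omega> in M. 0 < a \<longrightarrow> a < b \<longrightarrow> (\<exists>k. \<not> crossings (grid_times T) (\<lambda>q. cprob A q \<omega>) a b k 0 T)" for a b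
    by (cases "0 < a \<and> a < b") auto
  then show ?thesis
    unfolding regular_def AE_ball_countable[OF countable_rat] by simp
qed

definition cadlag_version :: "'a set \<Rightarrow> 'a process" where
  "cadlag_version A \<omega> t =
     (if regular T (\<lambda>q. cprob A q \<omega>) then right_limits T (\<lambda>q. cprob A q \<omega>) t else 0)"

lemma cadlag_version_cadlag: "cadlag_path T (cadlag_version A \<omega>)"
proof (cases "regular T (\<lambda>q. cprob A q \<omega>)")
  case True
  then have "cadlag_version A \<omega> = right_limits T (\<lambda>q. cprob A q \<omega>)"
    by (simp add: fun_eq_iff cadlag_version_def)
  then show ?thesis using cadlag_right_limits[OF True cprob_bounds] by simp
next
  case False
  then have "cadlag_version A \<omega> = (\<lambda>_. 0)" by (simp add: fun_eq_iff cadlag_version_def)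
  then show ?thesis by (auto simp: cadlag_path_def right_continuous_path_def)
qed

lemma cadlag_version_grid:
  assumes "t \<le> T"
  shows "(\<lambda>n. if regular T (\<lambda>q. cprob A q \<omega>) then cprob A (grid T n t) \<omega> else 0) \<longlonglongrightarrow> cadlag_version A \<omega> t"
  using right_limits_grid[OF _ cprob_bounds assms] by (auto simp: cadlag_version_def)

text \<open>A right limit is a priori known only immediately after t: its samples are eventually
  earlier than any given s > t. Right-continuity of the filtration brings this down to
  \<open>F t\<close>, and completeness takes care of the irregular paths.\<close>

lemma cadlag_version_adapted:
  assumes A: "A \<in> sets M"
  shows "adapted F T (cadlag_version A)"
  unfolding adapted_def
proof (intro allI impI)
  fix t assume t: "t \<le> T"
  have reg: "{\<omega> \<in> space M. regular T (\<lambda>q. cprob A q \<omega>)} \<in> sets (F s)" for s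
  proof (rule AE_eq_sets_F)
    show "space M \<in> sets (F s)" using sets.top[of "F s"] by (simp add: space_F)
    show "AE \<omega> in M. (\<omega> \<in> space M) = (\<omega> \<in> {\<omega> \<in> space M. regular T (\<lambda>q. cprob A q \<omega>)})"
      using cprob_regular[OF A] by eventually_elim simp
  qed auto
  have *: "(\<lambda>\<omega>. if regular T (\<lambda>q. cprob A q \<omega>) then cprob A q \<omega> else 0) \<in> borel_measurable (F s)"
    if "q \<le> s" for q s
  proof -
    have "cprob A q \<in> borel_measurable (F s)"
      by (rule measurable_from_subalg[OF _ cprob_measurable])
         (use sets_F_mono[OF that] in \<open>simp add: subalgebra_def space_F\<close>)
    moreover have "Measurable.pred (F s) (\<lambda>\<omega>. regular T (\<lambda>q. cprob A q \<omega>))"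
      using reg by (simp add: pred_def space_F)
    ultimately show ?thesis by measurable
  qed
  show "(\<lambda>\<omega>. cadlag_version A \<omega> t) \<in> borel_measurable (F t)"
  proof (cases "t < T")
    case False
    then have "t = T" using t by simp
    have "cadlag_version A \<omega> T = (if regular T (\<lambda>q. cprob A q \<omega>) then cprob A T \<omega> else 0)" for \<omega>
      by (simp add: cadlag_version_def right_limits_def)
    then show ?thesis using *[of T T] \<open>t = T\<close> by simp
  next
    case True
    have s: "(\<lambda>\<omega>. cadlag_version A \<omega> t) \<in> borel_measurable (F s)" if "t < s" for s
    proof -
      have "eventually (\<lambda>n. grid T n t < s) sequentially"
        by (rule order_tendstoD(2)[OF grid_tendsto[OF t] that])
      then obtain n0 where n0: "\<And>n. n \<ge> n0 \<Longrightarrow> grid T n t < s" by (auto simp: eventually_sequentially)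
      show ?thesis
      proof (rule borel_measurable_LIMSEQ_metric)
        show "(\<lambda>\<omega>. if regular T (\<lambda>q. cprob A q \<omega>) then cprob A (grid T (n + n0) t) \<omega> else 0)
            \<in> borel_measurable (F s)" for n
          using n0[of "n + n0"] by (intro *) simp
        show "(\<lambda>n. if regular T (\<lambda>q. cprob A q \<omega>) then cprob A (grid T (n + n0) t) \<omega> else 0)
            \<longlonglongrightarrow> cadlag_version A \<omega> t" for \<omega>
          using LIMSEQ_ignore_initial_segment[OF cadlag_version_grid[OF t, of A \<omega>], of n0] .
      qed
    qed
    show ?thesis
    proof (rule measurableI)
      fix B :: "real set" assume B: "B \<in> sets borel"
      have "(\<lambda>\<omega>. cadlag_version A \<omega> t) -` B \<inter> space M \<in> (\<Inter>s\<in>{t<..T}. sets (F s))"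
        using measurable_sets[OF s B] by (auto simp: space_F)
      then show "(\<lambda>\<omega>. cadlag_version A \<omega> t) -` B \<inter> space (F t) \<in> sets (F t)"
        using right_continuous_F[OF True] by (auto simp: space_F)
    qed auto
  qed
qed

lemma cadlag_version_optional:
  assumes "A \<in> sets M" shows "optional M F T (cadlag_version A)"
  unfolding optional_def
  by (intro cadlag_optional cadlag_version_adapted[OF assms] ballI cadlag_version_cadlag)

text \<open>Optional stopping for a bounded martingale. When \<tau> is rounded up to the n-th grid
  it takes finitely many values, and the integral over B is the probability of A \<inter> B for
  every n; dominated convergence along the grids concludes.\<close>

lemma cadlag_version_stopped:
  assumes A: "A \<in> sets M" and \<tau>: "\<tau> \<in> stopping_times M F T" and B: "B \<in> sets (pre_sigma \<tau>)"
  shows "(\<integral>\<^sup>+\<omega>\<in>B. ennreal (cadlag_version A \<omega> (\<tau> \<omega>)) \<partial>M) = emeasure M (A \<inter> B)"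
proof -
  have st: "stopping_time F \<tau>" and le: "AE \<omega> in M. \<tau> \<omega> \<le> T" using \<tau> by (auto simp: stopping_times_def)
  have BM[measurable]: "B \<in> sets M" by (rule pre_sigma_subset[OF st B])
  have AM[measurable]: "A \<in> sets M" by (rule A)
  have [measurable]: "cprob A q \<in> borel_measurable M" for q by (rule measurable_F_M[OF cprob_measurable])
  \<comment> \<open>The part of B on which \<tau> is rounded up to q. There the minimum with q
    changes nothing, but it makes the event visibly measurable for \<open>F q\<close>.\<close>
  define Bq where "Bq n q = {\<omega> \<in> B. \<tau> \<omega> \<le> q \<and> grid T n (min (\<tau> \<omega>) q) = q}" for n q
  have Bq: "Bq n q \<in> sets (F q)" for n q
  proof -
    have "(\<lambda>\<omega>. grid T n (min (\<tau> \<omega>) q)) \<in> borel_measurable (F q)"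
      by (rule measurable_compose[OF stopping_time_min_measurable[OF st] measurable_grid])
    then have "{\<omega> \<in> space (F q). grid T n (min (\<tau> \<omega>) q) = q} \<in> sets (F q)" by measurable
    with sets_pre_sigmaD[OF st B, of q]
    have "{\<omega> \<in> B. \<tau> \<omega> \<le> q} \<inter> {\<omega> \<in> space (F q). grid T n (min (\<tau> \<omega>) q) = q} \<in> sets (F q)" by (rule sets.Int)
    also have "{\<omega> \<in> B. \<tau> \<omega> \<le> q} \<inter> {\<omega> \<in> space (F q). grid T n (min (\<tau> \<omega>) q) = q} = Bq n q"
      using sets.sets_into_space[OF BM] by (auto simp: Bq_def space_F)
    finally show ?thesis .
  qed
  have BqM[measurable]: "Bq n q \<in> sets M" for n q using Bq sets_F_subset by blast
  have split: "indicator B \<omega> * h (grid T n (\<tau> \<omega>)) = (\<Sum>q\<in>grid_points T n. indicator (Bq n q) \<omega> * h q)"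
    if "\<tau> \<omega> \<le> T" for n \<omega> and h :: "ennreal \<Rightarrow> ennreal"
  proof -
    have "indicator (Bq n q) \<omega> = (if q = grid T n (\<tau> \<omega>) then indicator B \<omega> else (0::ennreal))" for q
      using grid_ge[OF that, of n] by (auto simp: Bq_def indicator_def min_absorb1)
    then have "(\<Sum>q\<in>grid_points T n. indicator (Bq n q) \<omega> * h q)
        = (\<Sum>q\<in>grid_points T n. if q = grid T n (\<tau> \<omega>) then indicator B \<omega> * h q else 0)"
      by (intro sum.cong) auto
    then show ?thesis by (simp add: grid_in_points)
  qed
  have int: "(\<integral>\<^sup>+\<omega>. indicator B \<omega> * ennreal (cprob A (grid T n (\<tau> \<omega>)) \<omega>) \<partial>M) = emeasure M (A \<inter> B)" for n
  proof -
    have "(\<integral>\<^sup>+\<omega>. indicator B \<omega> * ennreal (cprob A (grid T n (\<tau> \<omega>)) \<omega>) \<partial>M)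
        = (\<integral>\<^sup>+\<omega>. (\<Sum>q\<in>grid_points T n. indicator (Bq n q) \<omega> * ennreal (cprob A q \<omega>)) \<partial>M)"
      by (rule nn_integral_cong_AE) (use le in eventually_elim, rule split)
    also have "\<dots> = (\<Sum>q\<in>grid_points T n. (\<integral>\<^sup>+\<omega>. indicator (Bq n q) \<omega> * ennreal (cprob A q \<omega>) \<partial>M))"
      by (rule nn_integral_sum) measurable
    also have "\<dots> = (\<Sum>q\<in>grid_points T n. (\<integral>\<^sup>+\<omega>. indicator (Bq n q) \<omega> * indicator A \<omega> \<partial>M))"
    proof (rule sum.cong[OF refl])
      fix q
      have "(\<integral>\<^sup>+\<omega>. indicator (Bq n q) \<omega> * indicator A \<omega> \<partial>M) = (\<integral>\<^sup>+\<omega>. indicator (A \<inter> Bq n q) \<omega> \<partial>M)"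
        by (intro nn_integral_cong) (auto simp: indicator_def)
      then show "(\<integral>\<^sup>+\<omega>. indicator (Bq n q) \<omega> * ennreal (cprob A q \<omega>) \<partial>M) = (\<integral>\<^sup>+\<omega>. indicator (Bq n q) \<omega> * indicator A \<omega> \<partial>M)"
        using cprob_integral[OF A Bq[of n q]] by (simp add: mult.commute)
    qed
    also have "\<dots> = (\<integral>\<^sup>+\<omega>. (\<Sum>q\<in>grid_points T n. indicator (Bq n q) \<omega> * indicator A \<omega>) \<partial>M)"
      by (rule nn_integral_sum[symmetric]) measurable
    also have "\<dots> = (\<integral>\<^sup>+\<omega>. indicator B \<omega> * indicator A \<omega> \<partial>M)"
      by (rule nn_integral_cong_AE) (use le in eventually_elim, rule split[symmetric])
    also have "\<dots> = (\<integral>\<^sup>+\<omega>. indicator (A \<inter> B) \<omega> \<partial>M)"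
      by (intro nn_integral_cong) (auto simp: indicator_def)
    finally show ?thesis by simp
  qed
  have "(\<lambda>n. \<integral>\<^sup>+\<omega>. indicator B \<omega> * ennreal (cprob A (grid T n (\<tau> \<omega>)) \<omega>) \<partial>M)
      \<longlonglongrightarrow> (\<integral>\<^sup>+\<omega>. indicator B \<omega> * ennreal (cadlag_version A \<omega> (\<tau> \<omega>)) \<partial>M)"
  proof (rule nn_integral_dominated_convergence[where w="\<lambda>_. 1"])
    fix n
    have "(\<lambda>\<omega>. \<Sum>q\<in>grid_points T n. indicator (Bq n q) \<omega> * ennreal (cprob A q \<omega>)) \<in> borel_measurable M"
      by measurable
    then show "(\<lambda>\<omega>. indicator B \<omega> * ennreal (cprob A (grid T n (\<tau> \<omega>)) \<omega>)) \<in> borel_measurable M"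
      by (rule AE_eq_measurable_M) (simp, use le in eventually_elim, rule split[symmetric])
    show "AE \<omega> in M. indicator B \<omega> * ennreal (cprob A (grid T n (\<tau> \<omega>)) \<omega>) \<le> 1"
      by (auto simp: indicator_def cprob_bounds)
  next
    have "(\<lambda>\<omega>. cadlag_version A \<omega> (\<tau> \<omega>)) \<in> borel_measurable (pre_sigma \<tau>)"
      by (rule progressive_stopped[OF optional_progressive'[OF cadlag_version_optional[OF A]] \<tau>])
    then have [measurable]: "(\<lambda>\<omega>. cadlag_version A \<omega> (\<tau> \<omega>)) \<in> borel_measurable M"
      by (rule measurable_from_subalg[OF subalgebra_pre_sigma[OF st]])
    show "(\<lambda>\<omega>. indicator B \<omega> * ennreal (cadlag_version A \<omega> (\<tau> \<omega>))) \<in> borel_measurable M" by measurable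
    show "AE \<omega> in M. (\<lambda>n. indicator B \<omega> * ennreal (cprob A (grid T n (\<tau> \<omega>)) \<omega>))
        \<longlonglongrightarrow> indicator B \<omega> * ennreal (cadlag_version A \<omega> (\<tau> \<omega>))"
      using le cprob_regular[OF A]
    proof eventually_elim
      case (elim \<omega>)
      then have "(\<lambda>n. cprob A (grid T n (\<tau> \<omega>)) \<omega>) \<longlonglongrightarrow> cadlag_version A \<omega> (\<tau> \<omega>)"
        using cadlag_version_grid[of "\<tau> \<omega>" A \<omega>] by simp
      then have "(\<lambda>n. ennreal (cprob A (grid T n (\<tau> \<omega>)) \<omega>)) \<longlonglongrightarrow> ennreal (cadlag_version A \<omega> (\<tau> \<omega>))"
        by (rule tendsto_ennrealI)
      then show ?case by (auto simp: indicator_def)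
    qed
  qed (auto simp: emeasure_space_1)
  then have "(\<integral>\<^sup>+\<omega>. indicator B \<omega> * ennreal (cadlag_version A \<omega> (\<tau> \<omega>)) \<partial>M) = emeasure M (A \<inter> B)"
    unfolding int by (simp add: LIMSEQ_const_iff)
  then show ?thesis by (simp add: mult.commute)
qed

section \<open>Optional projections\<close>

lemma jointly_measurable_stopping:
  assumes Z: "jointly_measurable Z" and \<tau>: "\<tau> \<in> stopping_times M F T"
  shows "(\<lambda>\<omega>. Z \<omega> (\<tau> \<omega>)) \<in> borel_measurable M"
proof -
  have st: "stopping_time F \<tau>" and le: "AE \<omega> in M. \<tau> \<omega> \<le> T" using \<tau> by (auto simp: stopping_times_def)
  have [measurable]: "\<tau> \<in> borel_measurable M"
    using measurable_stopping_time[OF st sets_F_subset space_F] .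
  have 1: "(\<lambda>\<omega>. Z \<omega> (min (\<tau> \<omega>) T)) \<in> borel_measurable M"
    by (rule jointly_measurable_stopped[OF Z]) auto
  have 2: "AE \<omega> in M. Z \<omega> (min (\<tau> \<omega>) T) = Z \<omega> (\<tau> \<omega>)"
    using le by eventually_elim (simp add: min_absorb1)
  show ?thesis by (rule AE_eq_measurable_M[OF 1 _ 2]) simp
qed

text \<open>Integrated form of the conditional expectation of Z at \<tau> given the past of \<tau>.
  No versions have to be chosen, and sums and limits in Z are handled by the integral.\<close>

definition optional_projection :: "('a \<Rightarrow> ennreal \<Rightarrow> ennreal) \<Rightarrow> ('a \<Rightarrow> ennreal \<Rightarrow> ennreal) \<Rightarrow> bool" where
  "optional_projection Z Y \<longleftrightarrow> optional M F T Y \<and>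
     (\<forall>\<tau>\<in>stopping_times M F T. \<forall>B\<in>sets (pre_sigma \<tau>).
        (\<integral>\<^sup>+\<omega>\<in>B. Y \<omega> (\<tau> \<omega>) \<partial>M) = (\<integral>\<^sup>+\<omega>\<in>B. Z \<omega> (\<tau> \<omega>) \<partial>M))"

lemma optional_projectionD:
  assumes Z: "jointly_measurable Z" and Y: "optional_projection Z Y" and \<tau>: "\<tau> \<in> stopping_times M F T"
  shows "AE \<omega> in M. Y \<omega> (\<tau> \<omega>) = nn_cond_exp M (pre_sigma \<tau>) (\<lambda>\<omega>. Z \<omega> (\<tau> \<omega>)) \<omega>"
proof -
  have st: "stopping_time F \<tau>" using \<tau> by (auto simp: stopping_times_def)
  interpret sigma_finite_subalgebra M "pre_sigma \<tau>" by (rule finite_subalgebra_pre_sigma[OF st])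
  show ?thesis
    by (rule nn_cond_exp_charact)
       (use Y \<tau> in \<open>auto simp: optional_projection_def jointly_measurable_stopping[OF Z \<tau>]
          progressive_stopped[OF optional_progressive' \<tau>]\<close>)
qed

lemma optional_stopped_measurable:
  fixes Y :: "'a \<Rightarrow> ennreal \<Rightarrow> ennreal"
  assumes Y: "optional M F T Y" and \<tau>: "\<tau> \<in> stopping_times M F T"
  shows "(\<lambda>\<omega>. Y \<omega> (\<tau> \<omega>)) \<in> borel_measurable M"
  using progressive_stopped[OF optional_progressive'[OF Y] \<tau>] \<tau>
  by (intro measurable_from_subalg[OF subalgebra_pre_sigma]) (auto simp: stopping_times_def)

text \<open>Order is preserved at each single stopping time, up to a null set depending on it. This
  justifies subtraction from 1 and passage to suprema in the monotone class argument.\<close>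

lemma optional_projection_mono:
  assumes Z: "jointly_measurable Z" "jointly_measurable Z'" and Y: "optional_projection Z Y" "optional_projection Z' Y'"
    and le: "\<And>\<omega> t. \<omega> \<in> space M \<Longrightarrow> t \<le> T \<Longrightarrow> Z \<omega> t \<le> Z' \<omega> t" and \<tau>: "\<tau> \<in> stopping_times M F T"
  shows "AE \<omega> in M. Y \<omega> (\<tau> \<omega>) \<le> Y' \<omega> (\<tau> \<omega>)"
proof -
  have st: "stopping_time F \<tau>" and \<tau>le: "AE \<omega> in M. \<tau> \<omega> \<le> T" using \<tau> by (auto simp: stopping_times_def)
  interpret sigma_finite_subalgebra M "pre_sigma \<tau>" by (rule finite_subalgebra_pre_sigma[OF st])
  have "AE \<omega> in M. Z \<omega> (\<tau> \<omega>) \<le> Z' \<omega> (\<tau> \<omega>)"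
    using \<tau>le AE_space by eventually_elim (rule le)
  then have "AE \<omega> in M. nn_cond_exp M (pre_sigma \<tau>) (\<lambda>\<omega>. Z \<omega> (\<tau> \<omega>)) \<omega> \<le> nn_cond_exp M (pre_sigma \<tau>) (\<lambda>\<omega>. Z' \<omega> (\<tau> \<omega>)) \<omega>"
    by (rule nn_cond_exp_mono) (rule jointly_measurable_stopping[OF Z(1) \<tau>] jointly_measurable_stopping[OF Z(2) \<tau>])+
  then show ?thesis
    using optional_projectionD[OF Z(1) Y(1) \<tau>] optional_projectionD[OF Z(2) Y(2) \<tau>]
    by eventually_elim simp
qed

text \<open>A deterministic factor in time commutes with projection, because the event that \<tau>
  lies in \<open>B'\<close> belongs to the past of \<tau>. Only the martingale of A has to be
  stopped.\<close>

lemma optional_projection_rectangle: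
  assumes A: "A \<in> sets M" and B: "B \<in> sets (lebesgue_time T)"
  shows "\<exists>Y. optional_projection (\<lambda>\<omega> t. indicator (A \<times> B) (\<omega>, t)) Y"
proof -
  obtain B' where B': "B' \<in> sets borel" "B = B' \<inter> {..T}"
    using B by (auto simp: sets_lebesgue_time sets_restrict_space)
  let ?Y = "\<lambda>\<omega> t. ennreal (cadlag_version A \<omega> t) * indicator B' t"
  have "optional_projection (\<lambda>\<omega> t. indicator (A \<times> B) (\<omega>, t)) ?Y"
    unfolding optional_projection_def
  proof (intro conjI ballI)
    have [measurable]: "(\<lambda>z. cadlag_version A (fst z) (snd z)) \<in> borel_measurable (optional_sigma M F T)"
      using cadlag_version_optional[OF A] by (simp add: optional_iff)
    have [measurable]: "(\<lambda>z. indicator B' (snd z) :: ennreal) \<in> borel_measurable (optional_sigma M F T)"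
      using B'(1) by (intro measurable_compose[OF measurable_time_optional]) auto
    show "optional M F T ?Y" unfolding optional_iff by measurable
    fix \<tau> C assume \<tau>: "\<tau> \<in> stopping_times M F T" and C: "C \<in> sets (pre_sigma \<tau>)"
    have st: "stopping_time F \<tau>" and le: "AE \<omega> in M. \<tau> \<omega> \<le> T" using \<tau> by (auto simp: stopping_times_def)
    have "\<tau> -` B' \<inter> space (pre_sigma \<tau>) \<in> sets (pre_sigma \<tau>)"
      by (rule measurable_sets[OF measurable_stopping_time_pre_sigma[OF st] B'(1)])
    then have C': "C \<inter> (\<tau> -` B' \<inter> space (pre_sigma \<tau>)) \<in> sets (pre_sigma \<tau>)" using C by blast
    let ?C = "C \<inter> (\<tau> -` B' \<inter> space (pre_sigma \<tau>))"
    have sub: "C \<subseteq> space M" using sets.sets_into_space[OF C] by (simp add: space_pre_sigma)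
    have "(\<integral>\<^sup>+\<omega>\<in>C. ?Y \<omega> (\<tau> \<omega>) \<partial>M) = (\<integral>\<^sup>+\<omega>\<in>?C. ennreal (cadlag_version A \<omega> (\<tau> \<omega>)) \<partial>M)"
      using sub by (intro nn_integral_cong) (auto simp: indicator_def space_pre_sigma)
    also have "\<dots> = emeasure M (A \<inter> ?C)" by (rule cadlag_version_stopped[OF A \<tau> C'])
    also have "\<dots> = (\<integral>\<^sup>+\<omega>. indicator (A \<inter> ?C) \<omega> \<partial>M)"
      using A pre_sigma_subset[OF st C'] by simp
    also have "\<dots> = (\<integral>\<^sup>+\<omega>\<in>C. indicator (A \<times> B) (\<omega>, \<tau> \<omega>) \<partial>M)"
    proof (rule nn_integral_cong_AE)
      show "AE \<omega> in M. indicator (A \<inter> ?C) \<omega> = indicator (A \<times> B) (\<omega>, \<tau> \<omega>) * (indicator C \<omega> :: ennreal)"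
        using le AE_space by eventually_elim (auto simp: indicator_def space_pre_sigma B'(2))
    qed
    finally show "(\<integral>\<^sup>+\<omega>\<in>C. ?Y \<omega> (\<tau> \<omega>) \<partial>M) = (\<integral>\<^sup>+\<omega>\<in>C. indicator (A \<times> B) (\<omega>, \<tau> \<omega>) \<partial>M)" .
  qed
  then show ?thesis by blast
qed

lemma jointly_measurable_indicator:
  "S \<in> sets (M \<Otimes>\<^sub>M lebesgue_time T) \<Longrightarrow> jointly_measurable (\<lambda>\<omega> t. indicator S (\<omega>, t) :: ennreal)"
  by (simp add: case_prod_beta')

lemma optional_projection_suminf:
  assumes Z: "\<And>n::nat. jointly_measurable (Z n)" and Y: "\<And>n. optional_projection (Z n) (Y n)"
  shows "optional_projection (\<lambda>\<omega> t. \<Sum>n. Z n \<omega> t) (\<lambda>\<omega> t. \<Sum>n. Y n \<omega> t)"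
  unfolding optional_projection_def
proof (intro conjI ballI)
  have opt: "optional M F T (Y n)" for n using Y by (simp add: optional_projection_def)
  then have [measurable]: "(\<lambda>z. Y n (fst z) (snd z)) \<in> borel_measurable (optional_sigma M F T)" for n
    by (simp add: optional_iff)
  show "optional M F T (\<lambda>\<omega> t. \<Sum>n. Y n \<omega> t)" unfolding optional_iff by measurable
  fix \<tau> C assume \<tau>: "\<tau> \<in> stopping_times M F T" and C: "C \<in> sets (pre_sigma \<tau>)"
  have st: "stopping_time F \<tau>" using \<tau> by (auto simp: stopping_times_def)
  have [measurable]: "C \<in> sets M" by (rule pre_sigma_subset[OF st C])
  have [measurable]: "(\<lambda>\<omega>. Y n \<omega> (\<tau> \<omega>)) \<in> borel_measurable M" "(\<lambda>\<omega>. Z n \<omega> (\<tau> \<omega>)) \<in> borel_measurable M" for n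
    by (rule optional_stopped_measurable[OF opt \<tau>] jointly_measurable_stopping[OF Z \<tau>])+
  have "(\<integral>\<^sup>+\<omega>\<in>C. (\<Sum>n. Y n \<omega> (\<tau> \<omega>)) \<partial>M) = (\<Sum>n. \<integral>\<^sup>+\<omega>\<in>C. Y n \<omega> (\<tau> \<omega>) \<partial>M)"
    by (subst nn_integral_suminf[symmetric]) auto
  also have "\<dots> = (\<Sum>n. \<integral>\<^sup>+\<omega>\<in>C. Z n \<omega> (\<tau> \<omega>) \<partial>M)"
    using Y \<tau> C by (simp add: optional_projection_def)
  also have "\<dots> = (\<integral>\<^sup>+\<omega>\<in>C. (\<Sum>n. Z n \<omega> (\<tau> \<omega>)) \<partial>M)"
    by (subst nn_integral_suminf[symmetric]) auto
  finally show "(\<integral>\<^sup>+\<omega>\<in>C. (\<Sum>n. Y n \<omega> (\<tau> \<omega>)) \<partial>M) = (\<integral>\<^sup>+\<omega>\<in>C. (\<Sum>n. Z n \<omega> (\<tau> \<omega>)) \<partial>M)" .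
qed

lemma optional_projection_set:
  assumes S: "S \<in> sets (M \<Otimes>\<^sub>M lebesgue_time T)"
  shows "\<exists>Y. optional_projection (\<lambda>\<omega> t. indicator S (\<omega>, t)) Y"
proof -
  let ?\<Omega> = "space M \<times> space (lebesgue_time T)"
  let ?E = "{a \<times> b |a b. a \<in> sets M \<and> b \<in> sets (lebesgue_time T)}"
  have E: "?E \<subseteq> Pow ?\<Omega>"
    using sets.sets_into_space[of _ M] sets.sets_into_space[of _ "lebesgue_time T"] by auto
  show ?thesis
    using Int_stable_pair_measure_generator[of M "lebesgue_time T"] E S[unfolded sets_pair_measure]
  proof (induction rule: sigma_sets_induct_disjoint)
    case (basic A)
    then show ?case using optional_projection_rectangle by auto
  next
    case empty
    have "optional_projection (\<lambda>\<omega> t. indicator {} (\<omega>, t)) (\<lambda>\<omega> t. 0)"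
      by (simp add: optional_projection_def optional_def)
    then show ?case by blast
  next
    case (compl A)
    then obtain Y where Y: "optional_projection (\<lambda>\<omega> t. indicator A (\<omega>, t)) Y" by blast
    have A: "A \<in> sets (M \<Otimes>\<^sub>M lebesgue_time T)" using compl(1) by (simp add: sets_pair_measure)
    have jA: "jointly_measurable (\<lambda>\<omega> t. indicator A (\<omega>, t) :: ennreal)" by (rule jointly_measurable_indicator[OF A])
    have opt: "optional M F T Y" using Y by (simp add: optional_projection_def)
    have one: "optional_projection (\<lambda>\<omega> t. 1) (\<lambda>\<omega> t. 1)" "jointly_measurable (\<lambda>\<omega> t. 1 :: ennreal)"
      by (simp_all add: optional_projection_def optional_def)
    \<comment> \<open>Subtraction in [0,\<infinity>] is truncated, but it acts as genuine
      subtraction here because Y is almost surely at most 1 at every stopping time.\<close>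
    have "optional_projection (\<lambda>\<omega> t. indicator (?\<Omega> - A) (\<omega>, t)) (\<lambda>\<omega> t. 1 - Y \<omega> t)"
      unfolding optional_projection_def
    proof (intro conjI ballI)
      have [measurable]: "(\<lambda>z. Y (fst z) (snd z)) \<in> borel_measurable (optional_sigma M F T)"
        using opt by (simp add: optional_iff)
      show "optional M F T (\<lambda>\<omega> t. 1 - Y \<omega> t)" unfolding optional_iff by measurable
      fix \<tau> C assume \<tau>: "\<tau> \<in> stopping_times M F T" and C: "C \<in> sets (pre_sigma \<tau>)"
      have st: "stopping_time F \<tau>" and le: "AE \<omega> in M. \<tau> \<omega> \<le> T" using \<tau> by (auto simp: stopping_times_def)
      have [measurable]: "C \<in> sets M" by (rule pre_sigma_subset[OF st C])
      have [measurable]: "(\<lambda>\<omega>. Y \<omega> (\<tau> \<omega>)) \<in> borel_measurable M" by (rule optional_stopped_measurable[OF opt \<tau>])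
      have [measurable]: "(\<lambda>\<omega>. indicator A (\<omega>, \<tau> \<omega>) :: ennreal) \<in> borel_measurable M"
        using jointly_measurable_stopping[OF jA \<tau>] by simp
      have Y1: "AE \<omega> in M. Y \<omega> (\<tau> \<omega>) \<le> 1"
        by (rule optional_projection_mono[OF jA one(2) Y one(1) _ \<tau>]) (auto simp: indicator_def)
      have YA: "(\<integral>\<^sup>+\<omega>\<in>C. Y \<omega> (\<tau> \<omega>) \<partial>M) = (\<integral>\<^sup>+\<omega>\<in>C. indicator A (\<omega>, \<tau> \<omega>) \<partial>M)"
        using Y \<tau> C by (simp add: optional_projection_def)
      have fin: "(\<integral>\<^sup>+\<omega>\<in>C. indicator A (\<omega>, \<tau> \<omega>) \<partial>M) \<noteq> \<infinity>"
      proof -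
        have "(\<integral>\<^sup>+\<omega>\<in>C. indicator A (\<omega>, \<tau> \<omega>) \<partial>M) \<le> (\<integral>\<^sup>+\<omega>. 1 \<partial>M)"
          by (intro nn_integral_mono) (auto simp: indicator_def)
        then show ?thesis by (auto simp: emeasure_space_1 top_unique)
      qed
      have mC: "(\<lambda>\<omega>. indicator C \<omega> :: ennreal) \<in> borel_measurable M" by measurable
      have mY: "(\<lambda>\<omega>. Y \<omega> (\<tau> \<omega>) * indicator C \<omega>) \<in> borel_measurable M" by measurable
      have mA: "(\<lambda>\<omega>. indicator A (\<omega>, \<tau> \<omega>) * indicator C \<omega> :: ennreal) \<in> borel_measurable M" by measurable
      have "(\<integral>\<^sup>+\<omega>\<in>C. (1 - Y \<omega> (\<tau> \<omega>)) \<partial>M) = (\<integral>\<^sup>+\<omega>. indicator C \<omega> - Y \<omega> (\<tau> \<omega>) * indicator C \<omega> \<partial>M)"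
      proof (rule nn_integral_cong)
        fix \<omega> show "(1 - Y \<omega> (\<tau> \<omega>)) * indicator C \<omega> = indicator C \<omega> - Y \<omega> (\<tau> \<omega>) * indicator C \<omega>"
          by (cases "\<omega> \<in> C") simp_all
      qed
      also have "\<dots> = (\<integral>\<^sup>+\<omega>. indicator C \<omega> \<partial>M) - (\<integral>\<^sup>+\<omega>\<in>C. Y \<omega> (\<tau> \<omega>) \<partial>M)"
      proof (rule nn_integral_diff[OF mC mY])
        show "(\<integral>\<^sup>+\<omega>\<in>C. Y \<omega> (\<tau> \<omega>) \<partial>M) \<noteq> \<infinity>" using fin YA by simp
        show "AE \<omega> in M. Y \<omega> (\<tau> \<omega>) * indicator C \<omega> \<le> indicator C \<omega>"
          using Y1
        proof eventually_elim
          case (elim \<omega>)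
          then show ?case by (cases "\<omega> \<in> C") simp_all
        qed
      qed
      also have "\<dots> = (\<integral>\<^sup>+\<omega>. indicator C \<omega> \<partial>M) - (\<integral>\<^sup>+\<omega>\<in>C. indicator A (\<omega>, \<tau> \<omega>) \<partial>M)" by (simp only: YA)
      also have "\<dots> = (\<integral>\<^sup>+\<omega>. indicator C \<omega> - indicator A (\<omega>, \<tau> \<omega>) * indicator C \<omega> \<partial>M)"
      proof (rule nn_integral_diff[OF mC mA fin, symmetric])
        show "AE \<omega> in M. indicator A (\<omega>, \<tau> \<omega>) * indicator C \<omega> \<le> (indicator C \<omega> :: ennreal)"
          by (auto simp: indicator_def)
      qed
      also have "\<dots> = (\<integral>\<^sup>+\<omega>\<in>C. indicator (?\<Omega> - A) (\<omega>, \<tau> \<omega>) \<partial>M)"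
      proof (rule nn_integral_cong_AE)
        show "AE \<omega> in M. indicator C \<omega> - indicator A (\<omega>, \<tau> \<omega>) * indicator C \<omega>
            = indicator (?\<Omega> - A) (\<omega>, \<tau> \<omega>) * (indicator C \<omega> :: ennreal)"
          using le AE_space by eventually_elim (auto simp: indicator_def)
      qed
      finally show "(\<integral>\<^sup>+\<omega>\<in>C. (1 - Y \<omega> (\<tau> \<omega>)) \<partial>M) = (\<integral>\<^sup>+\<omega>\<in>C. indicator (?\<Omega> - A) (\<omega>, \<tau> \<omega>) \<partial>M)" .
    qed
    then show ?case by blast
  next
    case (union A)
    then obtain Y where Y: "\<And>i::nat. optional_projection (\<lambda>\<omega> t. indicator (A i) (\<omega>, t)) (Y i)" by metis
    have A: "A i \<in> sets (M \<Otimes>\<^sub>M lebesgue_time T)" for i using union(2) by (auto simp: sets_pair_measure)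
    have "optional_projection (\<lambda>\<omega> t. \<Sum>i. indicator (A i) (\<omega>, t)) (\<lambda>\<omega> t. \<Sum>i. Y i \<omega> t)"
      by (rule optional_projection_suminf[OF jointly_measurable_indicator[OF A] Y])
    then show ?case using suminf_indicator[OF union(1)] by auto
  qed
qed

lemma optional_projection_exists:
  assumes Z: "jointly_measurable (Z :: 'a \<Rightarrow> ennreal \<Rightarrow> ennreal)"
  obtains Y where "optional_projection Z Y"
proof -
  have "\<exists>Y. optional_projection (\<lambda>\<omega> t. (\<lambda>(\<omega>, t). Z \<omega> t) (\<omega>, t)) Y"
    using Z
  proof (induction rule: borel_measurable_induct)
    case (cong f g)
    then obtain Y where Y: "optional_projection (\<lambda>\<omega> t. g (\<omega>, t)) Y" by blast
    have "optional_projection (\<lambda>\<omega> t. f (\<omega>, t)) Y"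
      unfolding optional_projection_def
    proof (intro conjI ballI)
      show "optional M F T Y" using Y by (simp add: optional_projection_def)
      fix \<tau> C assume \<tau>: "\<tau> \<in> stopping_times M F T" and C: "C \<in> sets (pre_sigma \<tau>)"
      have le: "AE \<omega> in M. \<tau> \<omega> \<le> T" using \<tau> by (auto simp: stopping_times_def)
      have "(\<integral>\<^sup>+\<omega>\<in>C. Y \<omega> (\<tau> \<omega>) \<partial>M) = (\<integral>\<^sup>+\<omega>\<in>C. g (\<omega>, \<tau> \<omega>) \<partial>M)"
        using Y \<tau> C by (simp add: optional_projection_def)
      also have "\<dots> = (\<integral>\<^sup>+\<omega>\<in>C. f (\<omega>, \<tau> \<omega>) \<partial>M)"
      proof (rule nn_integral_cong_AE)
        show "AE \<omega> in M. g (\<omega>, \<tau> \<omega>) * indicator C \<omega> = f (\<omega>, \<tau> \<omega>) * indicator C \<omega>"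
          using le AE_space by eventually_elim (use cong(3) in \<open>simp add: space_pair_measure\<close>)
      qed
      finally show "(\<integral>\<^sup>+\<omega>\<in>C. Y \<omega> (\<tau> \<omega>) \<partial>M) = (\<integral>\<^sup>+\<omega>\<in>C. f (\<omega>, \<tau> \<omega>) \<partial>M)" .
    qed
    then show ?case by blast
  next
    case (set A)
    then show ?case by (rule optional_projection_set)
  next
    case (mult u c)
    then obtain Y where Y: "optional_projection (\<lambda>\<omega> t. u (\<omega>, t)) Y" by blast
    have j: "jointly_measurable (\<lambda>\<omega> t. u (\<omega>, t))" using mult by simp
    have opt: "optional M F T Y" using Y by (simp add: optional_projection_def)
    have "optional_projection (\<lambda>\<omega> t. c * u (\<omega>, t)) (\<lambda>\<omega> t. c * Y \<omega> t)"
      unfolding optional_projection_def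
    proof (intro conjI ballI)
      have [measurable]: "(\<lambda>z. Y (fst z) (snd z)) \<in> borel_measurable (optional_sigma M F T)"
        using opt by (simp add: optional_iff)
      show "optional M F T (\<lambda>\<omega> t. c * Y \<omega> t)" unfolding optional_iff by measurable
      fix \<tau> C assume \<tau>: "\<tau> \<in> stopping_times M F T" and C: "C \<in> sets (pre_sigma \<tau>)"
      have st: "stopping_time F \<tau>" using \<tau> by (auto simp: stopping_times_def)
      have [measurable]: "C \<in> sets M" by (rule pre_sigma_subset[OF st C])
      have [measurable]: "(\<lambda>\<omega>. Y \<omega> (\<tau> \<omega>)) \<in> borel_measurable M" "(\<lambda>\<omega>. u (\<omega>, \<tau> \<omega>)) \<in> borel_measurable M"
        by (rule optional_stopped_measurable[OF opt \<tau>] jointly_measurable_stopping[OF j \<tau>])+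
      show "(\<integral>\<^sup>+\<omega>\<in>C. c * Y \<omega> (\<tau> \<omega>) \<partial>M) = (\<integral>\<^sup>+\<omega>\<in>C. c * u (\<omega>, \<tau> \<omega>) \<partial>M)"
        using Y \<tau> C by (simp add: mult.assoc nn_integral_cmult optional_projection_def)
    qed
    then show ?case by blast
  next
    case (add u v)
    then obtain Y Y' where Y: "optional_projection (\<lambda>\<omega> t. u (\<omega>, t)) Y" "optional_projection (\<lambda>\<omega> t. v (\<omega>, t)) Y'" by blast
    have j: "jointly_measurable (\<lambda>\<omega> t. u (\<omega>, t))" "jointly_measurable (\<lambda>\<omega> t. v (\<omega>, t))" using add by simp_all
    have opt: "optional M F T Y" "optional M F T Y'" using Y by (simp_all add: optional_projection_def)
    have "optional_projection (\<lambda>\<omega> t. v (\<omega>, t) + u (\<omega>, t)) (\<lambda>\<omega> t. Y' \<omega> t + Y \<omega> t)"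
      unfolding optional_projection_def
    proof (intro conjI ballI)
      have [measurable]: "(\<lambda>z. Y (fst z) (snd z)) \<in> borel_measurable (optional_sigma M F T)"
        "(\<lambda>z. Y' (fst z) (snd z)) \<in> borel_measurable (optional_sigma M F T)"
        using opt by (simp_all add: optional_iff)
      show "optional M F T (\<lambda>\<omega> t. Y' \<omega> t + Y \<omega> t)" unfolding optional_iff by measurable
      fix \<tau> C assume \<tau>: "\<tau> \<in> stopping_times M F T" and C: "C \<in> sets (pre_sigma \<tau>)"
      have st: "stopping_time F \<tau>" using \<tau> by (auto simp: stopping_times_def)
      have [measurable]: "C \<in> sets M" by (rule pre_sigma_subset[OF st C])
      have [measurable]: "(\<lambda>\<omega>. Y \<omega> (\<tau> \<omega>)) \<in> borel_measurable M" "(\<lambda>\<omega>. Y' \<omega> (\<tau> \<omega>)) \<in> borel_measurable M"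
        "(\<lambda>\<omega>. u (\<omega>, \<tau> \<omega>)) \<in> borel_measurable M" "(\<lambda>\<omega>. v (\<omega>, \<tau> \<omega>)) \<in> borel_measurable M"
        by (rule optional_stopped_measurable[OF opt(1) \<tau>] optional_stopped_measurable[OF opt(2) \<tau>]
            jointly_measurable_stopping[OF j(1) \<tau>] jointly_measurable_stopping[OF j(2) \<tau>])+
      show "(\<integral>\<^sup>+\<omega>\<in>C. Y' \<omega> (\<tau> \<omega>) + Y \<omega> (\<tau> \<omega>) \<partial>M) = (\<integral>\<^sup>+\<omega>\<in>C. v (\<omega>, \<tau> \<omega>) + u (\<omega>, \<tau> \<omega>) \<partial>M)"
        using Y \<tau> C by (simp add: distrib_right nn_integral_add optional_projection_def)
    qed
    then show ?case by blast
  next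
    case (seq U)
    then obtain Y where Y: "\<And>i. optional_projection (\<lambda>\<omega> t. U i (\<omega>, t)) (Y i)" by metis
    have j: "jointly_measurable (\<lambda>\<omega> t. U i (\<omega>, t))" for i using seq(1) by simp
    have opt: "optional M F T (Y i)" for i using Y by (simp add: optional_projection_def)
    have U: "incseq U" using seq by simp
    have "optional_projection (\<lambda>\<omega> t. SUP i. U i (\<omega>, t)) (\<lambda>\<omega> t. SUP i. Y i \<omega> t)"
      unfolding optional_projection_def
    proof (intro conjI ballI)
      have [measurable]: "(\<lambda>z. Y i (fst z) (snd z)) \<in> borel_measurable (optional_sigma M F T)" for i
        using opt by (simp add: optional_iff)
      show "optional M F T (\<lambda>\<omega> t. SUP i. Y i \<omega> t)" unfolding optional_iff by measurable
      fix \<tau> C assume \<tau>: "\<tau> \<in> stopping_times M F T" and C: "C \<in> sets (pre_sigma \<tau>)"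
      have st: "stopping_time F \<tau>" using \<tau> by (auto simp: stopping_times_def)
      have [measurable]: "C \<in> sets M" by (rule pre_sigma_subset[OF st C])
      have [measurable]: "(\<lambda>\<omega>. Y i \<omega> (\<tau> \<omega>)) \<in> borel_measurable M" "(\<lambda>\<omega>. U i (\<omega>, \<tau> \<omega>)) \<in> borel_measurable M" for i
        by (rule optional_stopped_measurable[OF opt \<tau>] jointly_measurable_stopping[OF j \<tau>])+
      \<comment> \<open>The sequence increases only almost surely, with a null set that depends on
        \<tau>; hence monotone convergence in its almost-everywhere form.\<close>
      have mono: "AE \<omega> in M. Y i \<omega> (\<tau> \<omega>) \<le> Y (Suc i) \<omega> (\<tau> \<omega>)" for i
        by (rule optional_projection_mono[OF j j Y Y _ \<tau>]) (use U in \<open>auto simp: incseq_Suc_iff le_fun_def\<close>)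
      have "(\<integral>\<^sup>+\<omega>\<in>C. (SUP i. Y i \<omega> (\<tau> \<omega>)) \<partial>M) = (\<integral>\<^sup>+\<omega>. (SUP i. Y i \<omega> (\<tau> \<omega>) * indicator C \<omega>) \<partial>M)"
        by (simp add: SUP_mult_right_ennreal)
      also have "\<dots> = (SUP i. \<integral>\<^sup>+\<omega>\<in>C. Y i \<omega> (\<tau> \<omega>) \<partial>M)"
      proof (rule nn_integral_monotone_convergence_SUP_AE)
        show "AE \<omega> in M. Y i \<omega> (\<tau> \<omega>) * indicator C \<omega> \<le> Y (Suc i) \<omega> (\<tau> \<omega>) * indicator C \<omega>" for i
          using mono[of i] by eventually_elim (rule mult_right_mono, auto)
      qed measurable
      also have "\<dots> = (SUP i. \<integral>\<^sup>+\<omega>\<in>C. U i (\<omega>, \<tau> \<omega>) \<partial>M)"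
        using Y \<tau> C by (simp add: optional_projection_def)
      also have "\<dots> = (\<integral>\<^sup>+\<omega>. (SUP i. U i (\<omega>, \<tau> \<omega>) * indicator C \<omega>) \<partial>M)"
        by (rule nn_integral_monotone_convergence_SUP_AE[symmetric])
           (use U in \<open>auto simp: incseq_Suc_iff le_fun_def intro!: mult_right_mono\<close>)
      also have "\<dots> = (\<integral>\<^sup>+\<omega>\<in>C. (SUP i. U i (\<omega>, \<tau> \<omega>)) \<partial>M)"
        by (simp add: SUP_mult_right_ennreal)
      finally show "(\<integral>\<^sup>+\<omega>\<in>C. (SUP i. Y i \<omega> (\<tau> \<omega>)) \<partial>M) = (\<integral>\<^sup>+\<omega>\<in>C. (SUP i. U i (\<omega>, \<tau> \<omega>)) \<partial>M)" .
    qed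
    moreover have "(\<lambda>(\<omega>, t). Z \<omega> t) = (SUP i. U i)" using seq by simp
    ultimately show ?case by (auto simp: SUP_apply image_comp)
  qed
  then show thesis using that by auto
qed

end

section \<open>Directional derivatives of utility functions\<close>

locale utility =
  fixes u :: "real \<Rightarrow> real \<Rightarrow> real"
  assumes utility: "utility_function u"
begin

lemma u_nonneg: "0 \<le> x \<Longrightarrow> 0 \<le> c \<Longrightarrow> 0 \<le> u x c"
  using utility by (simp add: utility_function_def)

lemma u_mono: "0 \<le> x \<Longrightarrow> x \<le> x' \<Longrightarrow> 0 \<le> c \<Longrightarrow> c \<le> c' \<Longrightarrow> u x c \<le> u x' c'"
  using utility unfolding utility_function_def by blast

lemma u_concave:
  assumes "0 \<le> x" "0 \<le> c" "0 \<le> x + h" "0 \<le> c + k" "0 \<le> \<epsilon>" "\<epsilon> \<le> 1"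
  shows "u x c + \<epsilon> * (u (x + h) (c + k) - u x c) \<le> u (x + \<epsilon> * h) (c + \<epsilon> * k)"
proof (cases "\<epsilon> = 0 \<or> \<epsilon> = 1 \<or> (h = 0 \<and> k = 0)")
  case False
  then have "(x + h, c + k) \<noteq> (x, c)" "0 < \<epsilon>" "\<epsilon> < 1" using assms by auto
  moreover have "\<forall>x c x' c' \<theta>. 0 \<le> x \<and> 0 \<le> c \<and> 0 \<le> x' \<and> 0 \<le> c' \<and> (x, c) \<noteq> (x', c') \<and> 0 < \<theta> \<and> \<theta> < 1 \<longrightarrow>
        \<theta> * u x c + (1 - \<theta>) * u x' c' < u (\<theta> * x + (1 - \<theta>) * x') (\<theta> * c + (1 - \<theta>) * c')"
    using utility by (simp add: utility_function_def strictly_concave_on_quadrant_def)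
  ultimately have "\<epsilon> * u (x + h) (c + k) + (1 - \<epsilon>) * u x c
      < u (\<epsilon> * (x + h) + (1 - \<epsilon>) * x) (\<epsilon> * (c + k) + (1 - \<epsilon>) * c)"
    using assms by blast
  moreover have "\<epsilon> * (x + h) + (1 - \<epsilon>) * x = x + \<epsilon> * h" "\<epsilon> * (c + k) + (1 - \<epsilon>) * c = c + \<epsilon> * k"
    by (simp_all add: algebra_simps)
  ultimately show ?thesis by (simp add: algebra_simps)
qed auto

text \<open>The point x + 1 is the midpoint of x and x + 2. By strict concavity its value exceeds
  the mean of the two end values, and by monotonicity the right end is at least as large as the
  midpoint.\<close>

lemma u_strict_mono:
  assumes "0 \<le> x" "0 \<le> c" shows "u x c < u (x + 1) c"
proof -
  have "\<forall>x c x' c' \<theta>. 0 \<le> x \<and> 0 \<le> c \<and> 0 \<le> x' \<and> 0 \<le> c' \<and> (x, c) \<noteq> (x', c') \<and> 0 < \<theta> \<and> \<theta> < 1 \<longrightarrow>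
        \<theta> * u x c + (1 - \<theta>) * u x' c' < u (\<theta> * x + (1 - \<theta>) * x') (\<theta> * c + (1 - \<theta>) * c')"
    using utility by (simp add: utility_function_def strictly_concave_on_quadrant_def)
  from this[rule_format, of x c "x + 2" c "1/2"] assms
  have "1/2 * u x c + 1/2 * u (x + 2) c < u (1/2 * x + 1/2 * (x + 2)) (1/2 * c + 1/2 * c)" by simp
  moreover have "1/2 * x + 1/2 * (x + 2) = x + 1" "1/2 * c + 1/2 * c = c" by (simp_all add: field_simps)
  moreover have "u (x + 1) c \<le> u (x + 2) c" using assms by (intro u_mono) auto
  ultimately show ?thesis by simp
qed

text \<open>Both partial derivatives exist and u_c is continuous, which gives a joint derivative.
  \<open>blinfun_mult_right\<close> merely presents the number u_c as the bounded linear map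
  expected by \<open>has_derivative_partialsI\<close>.\<close>

lemma total_derivative:
  assumes "0 < x" "0 < c"
  shows "((\<lambda>(x, c). u x c) has_derivative (\<lambda>(h, k). deriv_x u x c * h + deriv_c u x c * k)) (at (x, c))"
proof -
  have C1: "C1_on_open_quadrant u" using utility by (simp add: utility_function_def C2_on_open_quadrant_def)
  have open': "open ({0<..} \<times> {0<..} :: (real \<times> real) set)" by (intro open_Times) auto
  have dx: "((\<lambda>x. u x c) has_derivative (\<lambda>h. deriv_x u x c * h)) (at x within {0<..})"
  proof -
    have "((\<lambda>y. u y c) has_field_derivative deriv_x u x c) (at x)"
      using C1 assms by (simp add: C1_on_open_quadrant_def deriv_x_def DERIV_deriv_iff_field_differentiable)
    then show ?thesis unfolding has_field_derivative_def by (rule has_derivative_at_withinI)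
  qed
  have dc: "((\<lambda>c. u x c) has_derivative blinfun_apply (blinfun_mult_right (deriv_c u x c))) (at c within {0<..})"
    if "x \<in> {0<..}" "c \<in> {0<..}" for x c
  proof -
    have "((\<lambda>d. u x d) has_field_derivative deriv_c u x c) (at c)"
      using C1 that by (simp add: C1_on_open_quadrant_def deriv_c_def DERIV_deriv_iff_field_differentiable)
    then show ?thesis
      unfolding has_field_derivative_def blinfun_mult_right.rep_eq by (rule has_derivative_at_withinI)
  qed
  have "continuous_on ({0<..} \<times> {0<..}) (\<lambda>(x, c). deriv_c u x c)"
    using C1 by (simp add: C1_on_open_quadrant_def)
  then have "continuous_on ({0<..} \<times> {0<..}) (\<lambda>z. blinfun_mult_right (case z of (x, c) \<Rightarrow> deriv_c u x c))"
    by (rule bounded_linear.continuous_on[OF bounded_linear_blinfun_mult_right])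
  moreover have "(\<lambda>z. blinfun_mult_right (case z of (x, c) \<Rightarrow> deriv_c u x c)) = (\<lambda>(x, c). blinfun_mult_right (deriv_c u x c))"
    by (rule ext) (simp add: case_prod_beta)
  ultimately have "continuous_on ({0<..} \<times> {0<..}) (\<lambda>(x, c). blinfun_mult_right (deriv_c u x c))" by (rule subst[rotated])
  moreover have xc: "(x, c) \<in> {0<..} \<times> {0<..}" using assms by simp
  ultimately have cont: "continuous (at (x, c) within {0<..} \<times> {0<..}) (\<lambda>(x, c). blinfun_mult_right (deriv_c u x c))"
    unfolding continuous_on_eq_continuous_within by (rule bspec)
  have "((\<lambda>(x, c). u x c) has_derivative (\<lambda>(h, k). deriv_x u x c * h + blinfun_apply (blinfun_mult_right (deriv_c u x c)) k))
      (at (x, c) within {0<..} \<times> {0<..})"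
    by (rule has_derivative_partialsI[OF dx dc cont]) (use assms in auto)
  then show ?thesis
    unfolding at_within_open[OF xc open'] blinfun_mult_right.rep_eq .
qed

lemma deriv_x_nonneg:
  assumes "0 < x" "0 < c" shows "0 \<le> deriv_x u x c"
proof -
  have C1: "C1_on_open_quadrant u" using utility by (simp add: utility_function_def C2_on_open_quadrant_def)
  have "((\<lambda>y. u y c) has_field_derivative deriv_x u x c) (at x)"
    using C1 assms by (simp add: C1_on_open_quadrant_def deriv_x_def DERIV_deriv_iff_field_differentiable)
  then have "((\<lambda>y. (u y c - u x c) / (y - x)) \<longlongrightarrow> deriv_x u x c) (at x)" by (simp add: has_field_derivative_iff)
  then have "((\<lambda>y. (u y c - u x c) / (y - x)) \<longlongrightarrow> deriv_x u x c) (at_right x)" by (rule tendsto_within_subset[OF _ subset_UNIV])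
  then show ?thesis
  proof (rule tendsto_lowerbound)
    show "eventually (\<lambda>y. 0 \<le> (u y c - u x c) / (y - x)) (at_right x)"
      unfolding eventually_at_filter using assms u_mono[of x _ c c] by (intro always_eventually) auto
  qed simp
qed

lemma deriv_c_nonneg:
  assumes "0 < x" "0 < c" shows "0 \<le> deriv_c u x c"
proof -
  have C1: "C1_on_open_quadrant u" using utility by (simp add: utility_function_def C2_on_open_quadrant_def)
  have "((\<lambda>y. u x y) has_field_derivative deriv_c u x c) (at c)"
    using C1 assms by (simp add: C1_on_open_quadrant_def deriv_c_def DERIV_deriv_iff_field_differentiable)
  then have "((\<lambda>y. (u x y - u x c) / (y - c)) \<longlongrightarrow> deriv_c u x c) (at c)" by (simp add: has_field_derivative_iff)
  then have "((\<lambda>y. (u x y - u x c) / (y - c)) \<longlongrightarrow> deriv_c u x c) (at_right c)" by (rule tendsto_within_subset[OF _ subset_UNIV])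
  then show ?thesis
  proof (rule tendsto_lowerbound)
    show "eventually (\<lambda>y. 0 \<le> (u x y - u x c) / (y - c)) (at_right c)"
      unfolding eventually_at_filter using assms u_mono[of x x c] by (intro always_eventually) auto
  qed simp
qed

lemma partial_interior:
  assumes "0 < x" "0 < c"
  shows "partial_x u x c = ennreal (deriv_x u x c)" "partial_c u x c = ennreal (deriv_c u x c)"
proof -
  have C1: "C1_on_open_quadrant u" using utility by (simp add: utility_function_def C2_on_open_quadrant_def)
  then show "partial_x u x c = ennreal (deriv_x u x c)" "partial_c u x c = ennreal (deriv_c u x c)"
    using assms by (auto simp: C1_on_open_quadrant_def intro!: partial_x_eq_deriv_x partial_c_eq_deriv_c)
qed

lemma gradient_interior:
  assumes x: "0 < x" and c: "0 < c"
  shows "gradient_exists u x c"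
  unfolding gradient_exists_def
proof (intro allI impI)
  fix h k :: real
  let ?g = "\<lambda>\<epsilon>. u (x + \<epsilon> * h) (c + \<epsilon> * k)"
  let ?D = "deriv_x u x c * h + deriv_c u x c * k"
  have "((\<lambda>\<epsilon>. (x + \<epsilon> * h, c + \<epsilon> * k)) has_derivative (\<lambda>\<epsilon>. (\<epsilon> * h, \<epsilon> * k))) (at 0)"
    by (auto intro!: derivative_eq_intros)
  moreover have "((\<lambda>(x, c). u x c) has_derivative (\<lambda>(h, k). deriv_x u x c * h + deriv_c u x c * k)) (at (x + 0 * h, c + 0 * k))"
    using total_derivative[OF x c] by simp
  ultimately have "((\<lambda>z. (\<lambda>(x, c). u x c) (x + z * h, c + z * k)) has_derivative
      (\<lambda>z. (\<lambda>(h, k). deriv_x u x c * h + deriv_c u x c * k) (z * h, z * k))) (at 0)"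
    by (rule has_derivative_compose)
  then have "(?g has_derivative (\<lambda>z. deriv_x u x c * (z * h) + deriv_c u x c * (z * k))) (at 0)" by simp
  moreover have "(\<lambda>z. deriv_x u x c * (z * h) + deriv_c u x c * (z * k)) = (*) ?D"
    by (auto simp: algebra_simps)
  ultimately have "(?g has_field_derivative ?D) (at 0)" by (simp add: has_field_derivative_def)
  then have "((\<lambda>\<epsilon>. (?g \<epsilon> - u x c) / \<epsilon>) \<longlongrightarrow> ?D) (at 0)" by (simp add: has_field_derivative_iff)
  then have "((\<lambda>\<epsilon>. (?g \<epsilon> - u x c) / \<epsilon>) \<longlongrightarrow> ?D) (at_right 0)" by (rule tendsto_within_subset[OF _ subset_UNIV])
  then have "((\<lambda>\<epsilon>. ereal ((?g \<epsilon> - u x c) / \<epsilon>)) \<longlongrightarrow> ereal ?D) (at_right 0)" by (rule tendsto_ereal)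
  moreover have "enn2ereal (partial_x u x c) * ereal h + enn2ereal (partial_c u x c) * ereal k = ereal ?D"
    using deriv_x_nonneg[OF x c] deriv_c_nonneg[OF x c] by (simp add: partial_interior[OF x c])
  ultimately show "((\<lambda>\<epsilon>. ereal ((?g \<epsilon> - u x c) / \<epsilon>))
     \<longlongrightarrow> enn2ereal (partial_x u x c) * ereal h + enn2ereal (partial_c u x c) * ereal k) (at_right 0)" by simp
qed

text \<open>For a concave function the quotients grow as \<epsilon> decreases to 0, so their limit
  dominates the quotient at \<epsilon> = 1.\<close>

lemma slope_ge:
  assumes g: "gradient_exists u x c" and xc: "0 \<le> x" "0 \<le> c" "0 \<le> x + h" "0 \<le> c + k"
  shows "ereal (u (x + h) (c + k) - u x c)
    \<le> enn2ereal (partial_x u x c) * ereal h + enn2ereal (partial_c u x c) * ereal k"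
proof (rule tendsto_lowerbound)
  show "((\<lambda>\<epsilon>. ereal ((u (x + \<epsilon> * h) (c + \<epsilon> * k) - u x c) / \<epsilon>))
     \<longlongrightarrow> enn2ereal (partial_x u x c) * ereal h + enn2ereal (partial_c u x c) * ereal k) (at_right 0)"
    using g xc by (simp add: gradient_exists_def)
  have "eventually (\<lambda>\<epsilon>. 0 < \<epsilon> \<and> \<epsilon> < 1) (at_right (0::real))"
    by (auto simp: eventually_at_right[of 0 1] intro!: exI[of _ 1])
  then show "eventually (\<lambda>\<epsilon>. ereal (u (x + h) (c + k) - u x c) \<le> ereal ((u (x + \<epsilon> * h) (c + \<epsilon> * k) - u x c) / \<epsilon>)) (at_right 0)"
  proof eventually_elim
    case (elim \<epsilon>)
    then show ?case using u_concave[OF xc, of \<epsilon>] by (simp add: field_simps)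
  qed
qed simp

text \<open>Moving from x down to 0 loses only a finite amount of utility, whereas an infinite slope
  would make the loss infinite.\<close>

lemma partial_x_finite:
  assumes g: "gradient_exists u x c" and "0 < x" "0 \<le> c"
  shows "partial_x u x c \<noteq> top"
  using slope_ge[OF g, of "- x" 0] assms by (auto simp: zero_ereal_def[symmetric])

lemma partial_c_finite:
  assumes g: "gradient_exists u x c" and "0 \<le> x" "0 < c"
  shows "partial_c u x c \<noteq> top"
  using slope_ge[OF g, of 0 "- c"] assms by (auto simp: zero_ereal_def[symmetric])

lemma partial_x_pos:
  assumes g: "gradient_exists u x c" and "0 \<le> x" "0 \<le> c"
  shows "0 < partial_x u x c"
proof (rule ccontr)
  assume "\<not> ?thesis"
  then have "partial_x u x c = 0" by (simp add: not_gr_zero)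
  then show False using slope_ge[OF g, of 1 0] assms u_strict_mono[of x c] by (simp add: zero_ennreal.rep_eq zero_ereal_def[symmetric])
qed

text \<open>Infinite partial derivatives occur only on the edges, where the corresponding increments
  are nonnegative; if such an increment is positive, both sides below are infinite.\<close>

lemma gradient_split:
  assumes g: "gradient_exists u x (k1 + d)" and nn: "0 \<le> x" "0 \<le> x'" "0 \<le> k1" "0 \<le> k2" "0 \<le> d"
  obtains
    (infinite) "partial_x u x (k1 + d) * ennreal x' + partial_c u x (k1 + d) * ennreal k2 = top"
      "enn2ereal (partial_x u x (k1 + d)) * ereal (x' - x) + enn2ereal (partial_c u x (k1 + d)) * ereal (k2 - k1) = \<infinity>"
      "partial_x u x (k1 + d) * ennreal x + partial_c u x (k1 + d) * ennreal k1 \<noteq> top"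
  | (finite) a b where "0 \<le> a" "0 \<le> b"
      "partial_x u x (k1 + d) * ennreal x' = ennreal (a * x')" "partial_c u x (k1 + d) * ennreal k2 = ennreal (b * k2)"
      "partial_x u x (k1 + d) * ennreal x = ennreal (a * x)" "partial_c u x (k1 + d) * ennreal k1 = ennreal (b * k1)"
      "enn2ereal (partial_x u x (k1 + d)) * ereal (x' - x) + enn2ereal (partial_c u x (k1 + d)) * ereal (k2 - k1)
        = ereal (a * (x' - x) + b * (k2 - k1))"
proof -
  let ?a = "partial_x u x (k1 + d)" and ?b = "partial_c u x (k1 + d)"
  have a: "(\<exists>a\<ge>0. ?a = ennreal a) \<or> (?a = top \<and> x = 0)"
    using partial_x_finite[OF g] nn by (cases ?a) (auto simp: less_le)
  have b: "(\<exists>b\<ge>0. ?b = ennreal b) \<or> (?b = top \<and> k1 = 0)"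
  proof (cases ?b)
    case top
    then have "\<not> 0 < k1 + d" using partial_c_finite[OF g nn(1)] by blast
    then show ?thesis using top nn by simp
  qed auto
  have ax: "?a * ennreal x \<noteq> top" using a by (auto simp: ennreal_mult_eq_top_iff)
  have bk: "?b * ennreal k1 \<noteq> top" using b by (auto simp: ennreal_mult_eq_top_iff)
  show thesis
  proof (cases "(?a = top \<and> 0 < x') \<or> (?b = top \<and> 0 < k2)")
    case True
    show thesis
    proof (rule infinite)
      show "?a * ennreal x' + ?b * ennreal k2 = top"
        using True by (auto simp: ennreal_top_mult)
      show "enn2ereal ?a * ereal (x' - x) + enn2ereal ?b * ereal (k2 - k1) = \<infinity>"
        using True a b nn by (auto simp: top_ereal_def[symmetric] simp flip: top_ereal_def) (auto simp: top_ereal_def)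
      show "?a * ennreal x + ?b * ennreal k1 \<noteq> top" using ax bk by simp
    qed
  next
    case False
    obtain a0 where a0: "0 \<le> a0" "?a = ennreal a0 \<or> (?a = top \<and> x = 0 \<and> x' = 0)"
      using a False nn by (metis less_le order_refl)
    obtain b0 where b0: "0 \<le> b0" "?b = ennreal b0 \<or> (?b = top \<and> k1 = 0 \<and> k2 = 0)"
      using b False nn by (metis less_le order_refl)
    show thesis
      by (rule finite[OF a0(1) b0(1)])
         (use a0 b0 nn in \<open>auto simp: ennreal_mult enn2ereal_ennreal\<close>)
  qed
qed

text \<open>The gradient inequality with every term moved to the side where it is nonnegative, so
  that it makes sense with infinite partial derivatives. The amount d of the opponents is kept apart
  since only the agent's own k1 is varied.\<close>

lemma concave_gradient:
  assumes g: "gradient_exists u x (k1 + d)" and nn: "0 \<le> x" "0 \<le> x'" "0 \<le> k1" "0 \<le> k2" "0 \<le> d"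
  shows "ennreal (u x' (k2 + d)) + (partial_x u x (k1 + d) * ennreal x + partial_c u x (k1 + d) * ennreal k1)
    \<le> ennreal (u x (k1 + d)) + (partial_x u x (k1 + d) * ennreal x' + partial_c u x (k1 + d) * ennreal k2)"
  using g nn
proof (cases rule: gradient_split)
  case infinite
  show ?thesis unfolding infinite(1) by simp
next
  case (finite a b)
  have "ereal (u (x + (x' - x)) (k1 + d + (k2 - k1)) - u x (k1 + d)) \<le> ereal (a * (x' - x) + b * (k2 - k1))"
    unfolding finite(7)[symmetric] by (rule slope_ge[OF g]) (use nn in auto)
  then have "u x' (k2 + d) + (a * x + b * k1) \<le> u x (k1 + d) + (a * x' + b * k2)"
    by (simp add: algebra_simps)
  then show ?thesis
    unfolding finite(3-6) using nn finite(1,2) u_nonneg[of x "k1 + d"] u_nonneg[of x' "k2 + d"]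
    by (simp add: ennreal_plus[symmetric] ennreal_leI del: ennreal_plus)
qed

lemma inverse_Suc_right: "filterlim (\<lambda>n. 1 / real (Suc n)) (at_right 0) sequentially"
  unfolding filterlim_at
  using LIMSEQ_inverse_real_of_nat by (auto simp: inverse_eq_divide intro!: always_eventually)

text \<open>The lower limit is u plus the directional derivative. The shift by u keeps this
  nonnegative: by concavity it is at least the utility at the end point, so the conversion to
  [0,\<infinity>] loses nothing.\<close>

lemma gradient_liminf:
  assumes g: "gradient_exists u x (k1 + d)" and nn: "0 \<le> x" "0 \<le> x'" "0 \<le> k1" "0 \<le> k2" "0 \<le> d"
  shows "ennreal (u x (k1 + d)) + (partial_x u x (k1 + d) * ennreal x' + partial_c u x (k1 + d) * ennreal k2)
    \<le> liminf (\<lambda>n. ennreal (u x (k1 + d)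
        + (u (x + 1 / real (Suc n) * (x' - x)) (k1 + d + 1 / real (Suc n) * (k2 - k1)) - u x (k1 + d)) / (1 / real (Suc n))))
      + (partial_x u x (k1 + d) * ennreal x + partial_c u x (k1 + d) * ennreal k1)"
proof -
  let ?l = "enn2ereal (partial_x u x (k1 + d)) * ereal (x' - x) + enn2ereal (partial_c u x (k1 + d)) * ereal (k2 - k1)"
  let ?q = "\<lambda>\<epsilon>. (u (x + \<epsilon> * (x' - x)) (k1 + d + \<epsilon> * (k2 - k1)) - u x (k1 + d)) / \<epsilon>"
  have "((\<lambda>\<epsilon>. ereal (?q \<epsilon>)) \<longlongrightarrow> ?l) (at_right 0)"
    using g nn by (simp add: gradient_exists_def)
  then have "(\<lambda>n. ereal (?q (1 / real (Suc n)))) \<longlonglongrightarrow> ?l"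
    by (rule filterlim_compose[OF _ inverse_Suc_right])
  then have "(\<lambda>n. ereal (?q (1 / real (Suc n))) + ereal (u x (k1 + d))) \<longlonglongrightarrow> ?l + ereal (u x (k1 + d))"
    by (rule tendsto_add_left_ereal[rotated]) simp
  then have "(\<lambda>n. ereal (u x (k1 + d)) + ereal (?q (1 / real (Suc n)))) \<longlonglongrightarrow> ereal (u x (k1 + d)) + ?l"
    by (simp only: add.commute)
  then have "(\<lambda>n. e2ennreal (ereal (u x (k1 + d) + ?q (1 / real (Suc n))))) \<longlonglongrightarrow> e2ennreal (ereal (u x (k1 + d)) + ?l)"
    unfolding plus_ereal.simps(1)[symmetric] by (rule tendsto_e2ennrealI)
  then have lim: "liminf (\<lambda>n. ennreal (u x (k1 + d) + ?q (1 / real (Suc n)))) = e2ennreal (ereal (u x (k1 + d)) + ?l)"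
    by (intro lim_imp_Liminf) (auto simp del: of_nat_Suc)
  show ?thesis
    using g nn
  proof (cases rule: gradient_split)
    case infinite
    show ?thesis unfolding lim infinite(2) by simp
  next
    case (finite a b)
    have "ereal (u (x + (x' - x)) (k1 + d + (k2 - k1)) - u x (k1 + d)) \<le> ereal (a * (x' - x) + b * (k2 - k1))"
      unfolding finite(7)[symmetric] by (rule slope_ge[OF g]) (use nn in auto)
    then have "0 \<le> u x (k1 + d) + (a * (x' - x) + b * (k2 - k1))"
      using u_nonneg[of x' "k2 + d"] nn by (simp add: algebra_simps)
    then show ?thesis
      unfolding lim finite(3-7) using nn finite(1,2) u_nonneg[of x "k1 + d"]
      by (simp add: ennreal_plus[symmetric] ennreal_leI algebra_simps del: ennreal_plus)
  qed
qed

text \<open>The Inada condition concerns u_x alone, but the direction may also lower c. Consumption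
  gains at least \<epsilon> h u_x(\<epsilon> h, c), which is of larger order than \<epsilon>; the
  change of c costs at most \<epsilon> u(h, c) by concavity.\<close>

lemma inada_quotient:
  assumes h: "0 < h" and c: "0 < c" "0 \<le> c + k"
  shows "filterlim (\<lambda>\<epsilon>. (u (\<epsilon> * h) (c + \<epsilon> * k) - u 0 c) / \<epsilon>) at_top (at_right 0)"
proof -
  have inada: "filterlim (\<lambda>x. deriv_x u x c) at_top (at_right 0)"
    using utility c by (simp add: utility_function_def)
  have "filterlim (\<lambda>\<epsilon>. \<epsilon> * h) (at_right 0) (at_right 0)"
    unfolding filterlim_at
  proof
    show "eventually (\<lambda>\<epsilon>. \<epsilon> * h \<in> {0<..} \<and> \<epsilon> * h \<noteq> 0) (at_right 0)"
      unfolding eventually_at_filter using h by (intro always_eventually) auto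
    have "((\<lambda>\<epsilon>. \<epsilon> * h) \<longlongrightarrow> 0 * h) (at_right 0)" by (intro tendsto_intros)
    then show "((\<lambda>\<epsilon>. \<epsilon> * h) \<longlongrightarrow> 0) (at_right 0)" by simp
  qed
  from filterlim_compose[OF inada this]
  have lim: "filterlim (\<lambda>\<epsilon>. deriv_x u (\<epsilon> * h) c) at_top (at_right 0)" .
  have "filterlim (\<lambda>\<epsilon>. - u h c + h * deriv_x u (\<epsilon> * h) c) at_top (at_right 0)"
    by (intro filterlim_tendsto_add_at_top[OF tendsto_const] filterlim_tendsto_pos_mult_at_top[OF tendsto_const h lim])
  then show ?thesis
  proof (rule filterlim_at_top_mono)
    have "eventually (\<lambda>\<epsilon>. 0 < \<epsilon> \<and> \<epsilon> < 1) (at_right (0::real))"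
      by (auto simp: eventually_at_right[of 0 1] intro!: exI[of _ 1])
    then show "eventually (\<lambda>\<epsilon>. - u h c + h * deriv_x u (\<epsilon> * h) c \<le> (u (\<epsilon> * h) (c + \<epsilon> * k) - u 0 c) / \<epsilon>) (at_right 0)"
    proof eventually_elim
      case (elim \<epsilon>)
      then have eh: "0 < \<epsilon> * h" "\<epsilon> * h \<le> h" using h by (auto simp: mult_le_cancel_right1)
      have "ereal (u 0 c - u (\<epsilon> * h) c) \<le> ereal (deriv_x u (\<epsilon> * h) c * (- (\<epsilon> * h)))"
        using slope_ge[OF gradient_interior[OF eh(1) c(1)], of "- (\<epsilon> * h)" 0] eh c deriv_x_nonneg[OF eh(1) c(1)]
        by (simp add: partial_interior[OF eh(1) c(1)] zero_ereal_def[symmetric])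
      then have 1: "\<epsilon> * (h * deriv_x u (\<epsilon> * h) c) \<le> u (\<epsilon> * h) c - u 0 c" by (simp add: algebra_simps)
      have "u (\<epsilon> * h) c + \<epsilon> * (u (\<epsilon> * h + 0) (c + k) - u (\<epsilon> * h) c) \<le> u (\<epsilon> * h + \<epsilon> * 0) (c + \<epsilon> * k)"
        using elim eh c by (intro u_concave) auto
      moreover have "u (\<epsilon> * h) c \<le> u h c" "0 \<le> u (\<epsilon> * h) (c + k)" using eh c h by (auto intro!: u_mono u_nonneg)
      then have "\<epsilon> * (- u h c) \<le> \<epsilon> * (u (\<epsilon> * h) (c + k) - u (\<epsilon> * h) c)" using elim by (intro mult_left_mono) auto
      ultimately have 2: "\<epsilon> * (- u h c) \<le> u (\<epsilon> * h) (c + \<epsilon> * k) - u (\<epsilon> * h) c" by simp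
      have "\<epsilon> * (- u h c + h * deriv_x u (\<epsilon> * h) c) \<le> u (\<epsilon> * h) (c + \<epsilon> * k) - u 0 c"
        using 1 2 by (simp add: algebra_simps)
      then show ?case using elim by (simp add: field_simps)
    qed
  qed
qed

lemma partial_x_inada:
  assumes "0 < c" shows "partial_x u 0 c = top"
proof -
  have eq: "at 0 within {0..} = at_right (0::real)"
    by (rule filter_eqI) (auto simp: eventually_at_filter less_le elim: eventually_mono)
  have "filterlim (\<lambda>\<epsilon>. (u (\<epsilon> * 1) (c + \<epsilon> * 0) - u 0 c) / \<epsilon>) at_top (at_right 0)"
    by (rule inada_quotient) (use assms in auto)
  then have "((\<lambda>y. ennreal ((u y c - u 0 c) / (y - 0))) \<longlongrightarrow> top) (at_right 0)"
    by (simp add: ennreal_tendsto_top_eq_at_top)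
  then show ?thesis
    unfolding partial_x_def eq by (intro tendsto_Lim) auto
qed

lemma inada_liminf:
  assumes "0 < x'" "0 < k1 + d" "0 \<le> k1" "0 \<le> k2" "0 \<le> d"
  shows "liminf (\<lambda>n. ennreal (u 0 (k1 + d)
      + (u (0 + 1 / real (Suc n) * (x' - 0)) (k1 + d + 1 / real (Suc n) * (k2 - k1)) - u 0 (k1 + d)) / (1 / real (Suc n)))) = top"
proof -
  have "filterlim (\<lambda>\<epsilon>. (u (\<epsilon> * x') (k1 + d + \<epsilon> * (k2 - k1)) - u 0 (k1 + d)) / \<epsilon>) at_top (at_right 0)"
    by (rule inada_quotient) (use assms in auto)
  then have "filterlim (\<lambda>\<epsilon>. u 0 (k1 + d) + (u (\<epsilon> * x') (k1 + d + \<epsilon> * (k2 - k1)) - u 0 (k1 + d)) / \<epsilon>) at_top (at_right 0)"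
    by (intro filterlim_tendsto_add_at_top[OF tendsto_const])
  then have "filterlim (\<lambda>n. u 0 (k1 + d) + (u (1 / real (Suc n) * x') (k1 + d + 1 / real (Suc n) * (k2 - k1)) - u 0 (k1 + d)) / (1 / real (Suc n)))
      at_top sequentially"
    by (rule filterlim_compose[OF _ inverse_Suc_right])
  then show ?thesis
    by (intro lim_imp_Liminf) (simp_all add: ennreal_tendsto_top_eq_at_top)
qed

section \<open>Measurability of marginal utilities\<close>

text \<open>Smoothness is available only in the open quadrant. On each edge u is monotone in the
  remaining variable and hence Borel; \<open>max 0\<close> extends that monotone function to the
  whole line.\<close>

lemma measurable_u:
  assumes [measurable]: "X \<in> borel_measurable N" "Q \<in> borel_measurable N"
    and nn: "\<And>z. z \<in> space N \<Longrightarrow> 0 \<le> X z" "\<And>z. z \<in> space N \<Longrightarrow> 0 \<le> Q z"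
  shows "(\<lambda>z. u (X z) (Q z)) \<in> borel_measurable N"
proof -
  have "continuous_on ({0<..} \<times> {0<..}) (\<lambda>(x, c). u x c)"
    by (intro continuous_at_imp_continuous_on ballI) (auto intro: has_derivative_continuous[OF total_derivative])
  moreover have "{0<..} \<times> {0<..} \<in> sets (borel :: (real \<times> real) measure)"
    by (intro borel_open open_Times) auto
  ultimately have [measurable]: "(\<lambda>p. indicator ({0<..} \<times> {0<..}) p *\<^sub>R (case p of (x, c) \<Rightarrow> u x c)) \<in> borel_measurable borel"
    by (intro borel_measurable_continuous_on_indicator)
  have [measurable]: "(\<lambda>x. u (max 0 x) 0) \<in> borel_measurable borel" "(\<lambda>c. u 0 (max 0 c)) \<in> borel_measurable borel"
    by (intro borel_measurable_mono monoI u_mono; simp)+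
  have "(\<lambda>z. if 0 < X z \<and> 0 < Q z then indicator ({0<..} \<times> {0<..}) (X z, Q z) *\<^sub>R (case (X z, Q z) of (x, c) \<Rightarrow> u x c)
      else if Q z = 0 then u (max 0 (X z)) 0 else u 0 (max 0 (Q z))) \<in> borel_measurable N"
    by measurable
  then show ?thesis
    by (rule measurable_cong[THEN iffD1, rotated]) (use nn in \<open>fastforce simp: less_le\<close>)
qed

text \<open>\<open>partial_x\<close> is a limit that may fail to exist. A lower limit along 1 / (n +
  1) always exists, depends measurably on its arguments, and equals the partial derivative wherever
  the gradient exists.\<close>

definition slope_x :: "real \<Rightarrow> real \<Rightarrow> ennreal" where
  "slope_x x c = liminf (\<lambda>n. ennreal ((u (x + 1 / real (Suc n)) c - u x c) / (1 / real (Suc n))))"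

definition slope_c :: "real \<Rightarrow> real \<Rightarrow> ennreal" where
  "slope_c x c = liminf (\<lambda>n. ennreal ((u x (c + 1 / real (Suc n)) - u x c) / (1 / real (Suc n))))"

lemma slope_eq_partial:
  assumes g: "gradient_exists u x c" and "0 \<le> x" "0 \<le> c"
  shows "slope_x x c = partial_x u x c" "slope_c x c = partial_c u x c"
proof -
  have "((\<lambda>\<epsilon>. ereal ((u (x + \<epsilon> * 1) (c + \<epsilon> * 0) - u x c) / \<epsilon>))
     \<longlongrightarrow> enn2ereal (partial_x u x c) * ereal 1 + enn2ereal (partial_c u x c) * ereal 0) (at_right 0)"
    using g[unfolded gradient_exists_def, rule_format, of 1 0] assms by simp
  then have "((\<lambda>\<epsilon>. ereal ((u (x + \<epsilon>) c - u x c) / \<epsilon>)) \<longlongrightarrow> enn2ereal (partial_x u x c)) (at_right 0)"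
    by (simp add: zero_ereal_def[symmetric] one_ereal_def[symmetric])
  then have "(\<lambda>n. ereal ((u (x + 1 / real (Suc n)) c - u x c) / (1 / real (Suc n)))) \<longlonglongrightarrow> enn2ereal (partial_x u x c)"
    by (rule filterlim_compose[OF _ inverse_Suc_right])
  then have "(\<lambda>n. ennreal ((u (x + 1 / real (Suc n)) c - u x c) / (1 / real (Suc n)))) \<longlonglongrightarrow> partial_x u x c"
    using tendsto_e2ennrealI by fastforce
  then show "slope_x x c = partial_x u x c" unfolding slope_x_def by (intro lim_imp_Liminf) auto
  have "((\<lambda>\<epsilon>. ereal ((u (x + \<epsilon> * 0) (c + \<epsilon> * 1) - u x c) / \<epsilon>))
     \<longlongrightarrow> enn2ereal (partial_x u x c) * ereal 0 + enn2ereal (partial_c u x c) * ereal 1) (at_right 0)"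
    using g[unfolded gradient_exists_def, rule_format, of 0 1] assms by simp
  then have "((\<lambda>\<epsilon>. ereal ((u x (c + \<epsilon>) - u x c) / \<epsilon>)) \<longlongrightarrow> enn2ereal (partial_c u x c)) (at_right 0)"
    by (simp add: zero_ereal_def[symmetric] one_ereal_def[symmetric])
  then have "(\<lambda>n. ereal ((u x (c + 1 / real (Suc n)) - u x c) / (1 / real (Suc n)))) \<longlonglongrightarrow> enn2ereal (partial_c u x c)"
    by (rule filterlim_compose[OF _ inverse_Suc_right])
  then have "(\<lambda>n. ennreal ((u x (c + 1 / real (Suc n)) - u x c) / (1 / real (Suc n)))) \<longlonglongrightarrow> partial_c u x c"
    using tendsto_e2ennrealI by fastforce
  then show "slope_c x c = partial_c u x c" unfolding slope_c_def by (intro lim_imp_Liminf) auto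
qed

lemma measurable_slope:
  assumes X[measurable]: "X \<in> borel_measurable N" and Q[measurable]: "Q \<in> borel_measurable N"
    and nn: "\<And>z. z \<in> space N \<Longrightarrow> 0 \<le> X z" "\<And>z. z \<in> space N \<Longrightarrow> 0 \<le> Q z"
  shows "(\<lambda>z. slope_x (X z) (Q z)) \<in> borel_measurable N" "(\<lambda>z. slope_c (X z) (Q z)) \<in> borel_measurable N"
proof -
  have [measurable]: "(\<lambda>z. u (X z) (Q z)) \<in> borel_measurable N" by (rule measurable_u[OF X Q nn])
  have [measurable]: "(\<lambda>z. u (X z + 1 / real (Suc n)) (Q z)) \<in> borel_measurable N"
    "(\<lambda>z. u (X z) (Q z + 1 / real (Suc n))) \<in> borel_measurable N" for n
    by (rule measurable_u; use nn in \<open>auto simp del: of_nat_Suc intro!: add_nonneg_nonneg\<close>)+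
  show "(\<lambda>z. slope_x (X z) (Q z)) \<in> borel_measurable N" "(\<lambda>z. slope_c (X z) (Q z)) \<in> borel_measurable N"
    unfolding slope_x_def slope_c_def by measurable
qed

end

section \<open>The consumer's problem\<close>

lemma emeasure_lebesgue_time_pos:
  assumes "0 < T" shows "0 < emeasure (lebesgue_time T) {..T}"
proof -
  obtain b where b: "0 < b" "b \<le> T" "b < \<infinity>"
    using assms dense[OF assms] by (metis infinity_ennreal_def less_imp_le less_le_trans top_greatest)
  then obtain y where y: "b = ennreal y" "0 < y" by (cases b) (auto simp: ennreal_less_zero_iff)
  have "0 < emeasure lborel {0..y}" using y by simp
  also have "\<dots> \<le> emeasure lborel {x. 0 \<le> x \<and> ennreal x \<in> {..T}}"
    using b y by (intro emeasure_mono) (auto intro: order_trans[OF ennreal_leI])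
  also have "\<dots> = emeasure time_measure {..T}" by (rule emeasure_time_measure[symmetric]) simp
  also have "\<dots> = emeasure (lebesgue_time T) {..T}"
    unfolding lebesgue_time_restrict by (rule emeasure_restrict_space[symmetric]) auto
  finally show ?thesis .
qed

lemma liminf_cmult_ennreal:
  fixes f :: "nat \<Rightarrow> ennreal"
  shows "c * liminf f \<le> liminf (\<lambda>n. c * f n)"
  unfolding liminf_SUP_INF SUP_mult_left_ennreal
  by (intro SUP_mono INF_greatest bexI[of _ _ UNIV] mult_left_mono INF_lower) auto

lemma nn_integral_le_imp_AE_le:
  fixes f g :: "'b \<Rightarrow> ennreal"
  assumes [measurable]: "f \<in> borel_measurable N" "g \<in> borel_measurable N"
    and le: "AE z in N. f z \<le> g z" and int: "(\<integral>\<^sup>+z. g z \<partial>N) \<le> (\<integral>\<^sup>+z. f z \<partial>N)" and fin: "(\<integral>\<^sup>+z. f z \<partial>N) \<noteq> \<infinity>"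
  shows "AE z in N. g z \<le> f z"
proof (rule ccontr)
  assume "\<not> ?thesis"
  from nn_integral_less[OF _ _ fin le this] have "(\<integral>\<^sup>+z. f z \<partial>N) < (\<integral>\<^sup>+z. g z \<partial>N)" by measurable
  then show False using int by simp
qed

section \<open>Prices and contributions with a single jump\<close>

context usual_filtered_space
begin

text \<open>f may be infinite, so no differences are formed. On the set where g < f and g \<le> n
  the smaller integral is finite, and the assumed comparison of integrals forces this set to be
  null.\<close>

lemma AE_le_of_set_integrals:
  fixes f g :: "'a \<Rightarrow> ennreal"
  assumes sub: "subalgebra M G" and f[measurable]: "f \<in> borel_measurable G" and g[measurable]: "g \<in> borel_measurable G"
    and fin: "\<And>\<omega>. g \<omega> < top"
    and le: "\<And>A. A \<in> sets G \<Longrightarrow> (\<integral>\<^sup>+\<omega>\<in>A. f \<omega> \<partial>M) \<le> (\<integral>\<^sup>+\<omega>\<in>A. g \<omega> \<partial>M)"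
  shows "AE \<omega> in M. f \<omega> \<le> g \<omega>"
proof -
  have space_G: "space G = space M" using sub by (simp add: subalgebra_def)
  define A where "A n = {\<omega> \<in> space M. g \<omega> < f \<omega> \<and> g \<omega> \<le> of_nat n}" for n :: nat
  have A: "A n \<in> sets G" for n unfolding A_def space_G[symmetric] by measurable
  have [measurable]: "A n \<in> sets M" for n using A sub by (auto simp: subalgebra_def)
  have [measurable]: "f \<in> borel_measurable M" "g \<in> borel_measurable M"
    by (rule measurable_from_subalg[OF sub f] measurable_from_subalg[OF sub g])+
  have "AE \<omega> in M. f \<omega> * indicator (A n) \<omega> \<le> g \<omega> * indicator (A n) \<omega>" for n
  proof (rule nn_integral_le_imp_AE_le)
    show "AE \<omega> in M. g \<omega> * indicator (A n) \<omega> \<le> f \<omega> * indicator (A n) \<omega>"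
      by (auto simp: A_def indicator_def)
    have "(\<integral>\<^sup>+\<omega>\<in>A n. g \<omega> \<partial>M) \<le> (\<integral>\<^sup>+\<omega>. of_nat n \<partial>M)"
      by (intro nn_integral_mono) (auto simp: A_def indicator_def)
    also have "\<dots> < \<infinity>" by (simp add: emeasure_space_1 of_nat_less_top)
    finally show "(\<integral>\<^sup>+\<omega>\<in>A n. g \<omega> \<partial>M) \<noteq> \<infinity>" by simp
  qed (use le[OF A] in auto)
  then have "AE \<omega> in M. \<forall>n. f \<omega> * indicator (A n) \<omega> \<le> g \<omega> * indicator (A n) \<omega>"
    by (subst AE_all_countable) auto
  then show ?thesis
    using AE_space
  proof eventually_elim
    case (elim \<omega>)
    show ?case
    proof (rule ccontr)
      assume *: "\<not> f \<omega> \<le> g \<omega>"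
      obtain n where "g \<omega> < of_nat n" using fin[of \<omega>] ennreal_Ex_less_of_nat by blast
      then have "\<omega> \<in> A n" using elim(2) * by (auto simp: A_def)
      then show False using elim(1)[rule_format, of n] * by simp
    qed
  qed
qed

lemma price_expectation:
  assumes \<psi>: "price_process M F T \<psi>" and t: "t \<le> T" "t < \<infinity>"
  shows "(\<integral>\<^sup>+\<omega>. ennreal (\<psi> \<omega> t) \<partial>M) \<le> 1"
proof -
  obtain \<rho> X where \<rho>: "bounded_positive M T \<rho>" and X: "exponential_martingale M F T X"
    and eq: "AE \<omega> in M. \<psi> \<omega> t = discount \<rho> \<omega> t * X \<omega> t"
    using \<psi> t unfolding price_process_def by blast
  have X': "integrable M (\<lambda>\<omega>. X \<omega> t)" "\<forall>\<omega>\<in>space M. 0 < X \<omega> t" "(\<integral>\<omega>. X \<omega> t \<partial>M) = 1"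
    using X t by (auto simp: exponential_martingale_def)
  have "(\<integral>\<^sup>+\<omega>. ennreal (\<psi> \<omega> t) \<partial>M) \<le> (\<integral>\<^sup>+\<omega>. ennreal (X \<omega> t) \<partial>M)"
  proof (rule nn_integral_mono_AE)
    show "AE \<omega> in M. ennreal (\<psi> \<omega> t) \<le> ennreal (X \<omega> t)"
      using eq AE_space
    proof eventually_elim
      case (elim \<omega>)
      then have "discount \<rho> \<omega> t * X \<omega> t \<le> 1 * X \<omega> t"
        using X'(2) discount_le_1[OF \<rho> elim(2) t(1)] by (intro mult_right_mono) (auto intro: less_imp_le)
      then show ?case using elim by (simp add: ennreal_leI)
    qed
  qed
  also have "\<dots> = ennreal (\<integral>\<omega>. X \<omega> t \<partial>M)"
    by (rule nn_integral_eq_integral[OF X'(1)]) (use X'(2) in \<open>auto intro: less_imp_le\<close>)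
  finally show ?thesis using X'(3) by simp
qed

lemma price_jointly_measurable:
  assumes \<psi>: "price_process M F T \<psi>" shows "jointly_measurable (\<lambda>\<omega> t. \<psi> \<omega> t)"
  using \<psi> by (intro progressive_measurable right_continuous_progressive) (auto simp: price_process_def)

lemma price_jointly_measurable_ennreal:
  assumes \<psi>: "price_process M F T \<psi>" shows "jointly_measurable (\<lambda>\<omega> t. ennreal (\<psi> \<omega> t))"
  using measurable_compose[OF price_jointly_measurable[OF \<psi>] measurable_ennreal] by (simp add: case_prod_beta')

lemma increasing_path_jump: "0 \<le> a \<Longrightarrow> increasing_path T (\<lambda>t. if s \<le> t then a else 0)"
  unfolding increasing_path_def using cadlag_jump[of s a] by (auto simp: mono_on_def cadlag_path_def)

text \<open>If \<omega> lies in A, all levels in (0, 1] are reached exactly at s; otherwise there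
  are no levels at all.\<close>

lemma nn_integral_stieltjes_jump:
  assumes f: "f \<in> borel_measurable (restrict_space borel {..T})" and s: "s \<le> T"
  shows "(\<integral>\<^sup>+t. f t \<partial>stieltjes_measure T (\<lambda>t. if s \<le> t then indicator A \<omega> else 0)) = f s * indicator A \<omega>"
proof -
  let ?C = "\<lambda>t. if s \<le> t then indicator A \<omega> else (0::real)"
  have hit: "hitting T ?C y = s" if "0 < y" "y \<le> indicator A \<omega>" for y
  proof -
    have "{v. v \<le> T \<and> y \<le> ?C v} = {s..T}" using that by auto
    then show ?thesis using s by (simp add: hitting_def min_absorb2)
  qed
  have "(\<integral>\<^sup>+t. f t \<partial>stieltjes_measure T ?C) = (\<integral>\<^sup>+y. f (hitting T ?C y) * indicator {0<..?C T} y \<partial>lborel)"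
    by (rule nn_integral_stieltjes[OF increasing_path_jump f]) simp
  also have "\<dots> = (\<integral>\<^sup>+y. f s * indicator {0<..indicator A \<omega> :: real} y \<partial>lborel)"
    using s hit by (intro nn_integral_cong) (auto simp: indicator_def)
  also have "\<dots> = f s * indicator A \<omega>"
    by (subst nn_integral_cmult_indicator) (auto simp: indicator_def)
  finally show ?thesis .
qed

end

section \<open>One agent facing a fixed aggregate contribution\<close>

text \<open>Uniform integrability enters through \<open>payoff_hat_finite\<close>.
  \<open>gradient_edge\<close> covers zero total contribution; elsewhere the Inada condition will
  place the candidate in the open quadrant, where u is smooth.\<close>

locale consumer = usual_filtered_space M F T + utility u
  for M :: "'a measure" and F :: "ennreal \<Rightarrow> 'a measure" and T :: ennreal and u :: "real \<Rightarrow> real \<Rightarrow> real" +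
  fixes \<psi>x \<psi>c r :: "'a process" and w :: real and D xh Ch :: "'a process"
  assumes w_pos: "0 < w"
    and price: "price_assumption M F T \<psi>x \<psi>c r"
    and hat_budget: "(xh, Ch) \<in> budget_set M F T \<psi>x \<psi>c w"
    and D_optional: "optional M F T D"
    and D_nonneg: "\<And>\<omega> t. \<omega> \<in> space M \<Longrightarrow> t \<le> T \<Longrightarrow> 0 \<le> D \<omega> t"
    and payoff_hat_finite: "payoff M T r u xh Ch D < \<infinity>"
    and gradient_edge: "AE (\<omega>, t) in M \<Otimes>\<^sub>M lebesgue_time T.
       Ch \<omega> t + D \<omega> t = 0 \<longrightarrow> gradient_exists u (xh \<omega> t) (Ch \<omega> t + D \<omega> t)"
begin

abbreviation PT :: "('a \<times> ennreal) measure" where "PT \<equiv> M \<Otimes>\<^sub>M lebesgue_time T"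

definition Q :: "'a process" where "Q \<omega> t = Ch \<omega> t + D \<omega> t"

text \<open>The budget set without its budget: a convex cone on which expenditure is additive, so
  that plans can be mixed and scaled freely.\<close>

definition plan :: "'a process \<Rightarrow> 'a process \<Rightarrow> bool" where
  "plan x C \<longleftrightarrow> optional M F T x \<and> optional M F T C \<and>
     (\<forall>\<omega>\<in>space M. \<forall>t\<le>T. 0 \<le> x \<omega> t \<and> 0 \<le> C \<omega> t) \<and>
     (AE \<omega> in M. right_continuous_path T (C \<omega>) \<and> mono_on {..T} (C \<omega>))"

lemma budget_iff: "(x, C) \<in> budget_set M F T \<psi>x \<psi>c w \<longleftrightarrow> plan x C \<and> expenditure M T \<psi>x \<psi>c x C \<le> ennreal w"
  by (auto simp: budget_set_def plan_def)

lemma plan_hat: "plan xh Ch" using hat_budget by (simp add: budget_iff)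

lemma prices: "price_process M F T \<psi>x" "price_process M F T \<psi>c" "optional M F T r" "bounded_positive M T r"
  using price by (auto simp: price_assumption_def)

sublocale PT: pair_sigma_finite M "lebesgue_time T" ..

lemma optional_measurable_PT:
  "optional M F T X \<Longrightarrow> (\<lambda>z. X (fst z) (snd z)) \<in> borel_measurable PT"
  using progressive_measurable[OF optional_progressive'] by (simp add: case_prod_beta')

lemma space_PT: "z \<in> space PT \<longleftrightarrow> fst z \<in> space M \<and> snd z \<le> T"
  by (cases z) (auto simp: space_pair_measure)

lemma planD:
  assumes "plan x C"
  shows "optional M F T x" "optional M F T C"
    "\<omega> \<in> space M \<Longrightarrow> t \<le> T \<Longrightarrow> 0 \<le> x \<omega> t" "\<omega> \<in> space M \<Longrightarrow> t \<le> T \<Longrightarrow> 0 \<le> C \<omega> t"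
  using assms by (auto simp: plan_def)

lemma plan_contribution:
  assumes "plan x C" shows "contribution C"
proof -
  have "AE \<omega> in M. right_continuous_path T (C \<omega>) \<and> mono_on {..T} (C \<omega>)" using assms by (simp add: plan_def)
  then have "AE \<omega> in M. increasing_path T (C \<omega>)"
    using AE_space by eventually_elim (use planD(4)[OF assms] in \<open>auto simp: increasing_path_def\<close>)
  moreover have "adapted F T C"
    using progressive_adapted[OF optional_progressive'[OF planD(2)[OF assms]]] by (simp add: adapted_def)
  ultimately show ?thesis by (simp add: contribution_def)
qed

lemma plan_zero: "plan x C \<Longrightarrow> plan x (\<lambda>_ _. 0)" "plan x C \<Longrightarrow> plan (\<lambda>_ _. 0) C"
  by (auto simp: plan_def optional_iff right_continuous_path_def mono_on_def)

lemma plan_lincomb: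
  assumes p: "plan x C" "plan x' C'" and ab: "0 \<le> a" "0 \<le> b"
  shows "plan (\<lambda>\<omega> t. a * x \<omega> t + b * x' \<omega> t) (\<lambda>\<omega> t. a * C \<omega> t + b * C' \<omega> t)"
  unfolding plan_def
proof (intro conjI ballI allI impI)
  have [measurable]: "(\<lambda>z. x (fst z) (snd z)) \<in> borel_measurable (optional_sigma M F T)"
    "(\<lambda>z. C (fst z) (snd z)) \<in> borel_measurable (optional_sigma M F T)"
    "(\<lambda>z. x' (fst z) (snd z)) \<in> borel_measurable (optional_sigma M F T)"
    "(\<lambda>z. C' (fst z) (snd z)) \<in> borel_measurable (optional_sigma M F T)"
    using planD(1,2)[OF p(1)] planD(1,2)[OF p(2)] by (auto simp: optional_iff)
  show "optional M F T (\<lambda>\<omega> t. a * x \<omega> t + b * x' \<omega> t)" "optional M F T (\<lambda>\<omega> t. a * C \<omega> t + b * C' \<omega> t)"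
    unfolding optional_iff by measurable
  have "AE \<omega> in M. increasing_path T (C \<omega>)" "AE \<omega> in M. increasing_path T (C' \<omega>)"
    using plan_contribution[OF p(1)] plan_contribution[OF p(2)] by (auto simp: contribution_def)
  then show "AE \<omega> in M. right_continuous_path T (\<lambda>t. a * C \<omega> t + b * C' \<omega> t) \<and> mono_on {..T} (\<lambda>t. a * C \<omega> t + b * C' \<omega> t)"
  proof eventually_elim
    case (elim \<omega>)
    then show ?case using increasing_path_lincomb[OF elim ab] by (simp add: increasing_path_def)
  qed
qed (use ab planD[OF p(1)] planD[OF p(2)] in auto)

definition cost_x :: "'a process \<Rightarrow> ennreal" where
  "cost_x x = (\<integral>\<^sup>+z. ennreal (\<psi>x (fst z) (snd z)) * ennreal (x (fst z) (snd z)) \<partial>PT)"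

definition cost_c :: "'a process \<Rightarrow> ennreal" where
  "cost_c C = (\<integral>\<^sup>+\<omega>. (\<integral>\<^sup>+t. ennreal (\<psi>c \<omega> t) \<partial>stieltjes_measure T (C \<omega>)) \<partial>M)"

lemma \<psi>x_measurable [measurable]: "(\<lambda>z. \<psi>x (fst z) (snd z)) \<in> borel_measurable PT"
  using price_jointly_measurable[OF prices(1)] by (simp add: case_prod_beta')

lemma \<psi>c_measurable [measurable]: "(\<lambda>z. \<psi>c (fst z) (snd z)) \<in> borel_measurable PT"
  using price_jointly_measurable[OF prices(2)] by (simp add: case_prod_beta')

lemma expenditure_eq:
  assumes p: "plan x C"
  shows "expenditure M T \<psi>x \<psi>c x C = cost_x x + cost_c C"
proof -
  have [measurable]: "(\<lambda>z. x (fst z) (snd z)) \<in> borel_measurable PT" by (rule optional_measurable_PT[OF planD(1)[OF p]])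
  have m: "(\<lambda>z. ennreal (\<psi>x (fst z) (snd z) * x (fst z) (snd z))) \<in> borel_measurable PT" by measurable
  have "expenditure M T \<psi>x \<psi>c x C
      = (\<integral>\<^sup>+\<omega>. (\<integral>\<^sup>+t. ennreal (\<psi>x \<omega> t * x \<omega> t) \<partial>lebesgue_time T) \<partial>M) + cost_c C"
    unfolding expenditure_def cost_c_def
    using lebesgue_time.borel_measurable_nn_integral_fst[OF m]
    by (intro nn_integral_add stieltjes_integral_measurable[OF plan_contribution[OF p]]
        price_jointly_measurable_ennreal[OF prices(2)]) simp
  also have "(\<integral>\<^sup>+\<omega>. (\<integral>\<^sup>+t. ennreal (\<psi>x \<omega> t * x \<omega> t) \<partial>lebesgue_time T) \<partial>M)
      = (\<integral>\<^sup>+z. ennreal (\<psi>x (fst z) (snd z) * x (fst z) (snd z)) \<partial>PT)"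
    using lebesgue_time.nn_integral_fst[OF m] by simp
  also have "\<dots> = cost_x x"
    unfolding cost_x_def
    by (intro nn_integral_cong ennreal_mult'') (use planD(3)[OF p] in \<open>auto simp: space_pair_measure\<close>)
  finally show ?thesis .
qed

lemma cost_x_lincomb:
  assumes p: "plan x C" "plan x' C'" and ab: "0 \<le> a" "0 \<le> b"
  shows "cost_x (\<lambda>\<omega> t. a * x \<omega> t + b * x' \<omega> t) = ennreal a * cost_x x + ennreal b * cost_x x'"
proof -
  have [measurable]: "(\<lambda>z. x (fst z) (snd z)) \<in> borel_measurable PT" "(\<lambda>z. x' (fst z) (snd z)) \<in> borel_measurable PT"
    by (rule optional_measurable_PT[OF planD(1)[OF p(1)]] optional_measurable_PT[OF planD(1)[OF p(2)]])+
  have "cost_x (\<lambda>\<omega> t. a * x \<omega> t + b * x' \<omega> t) = (\<integral>\<^sup>+z. ennreal a * (ennreal (\<psi>x (fst z) (snd z)) * ennreal (x (fst z) (snd z)))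
      + ennreal b * (ennreal (\<psi>x (fst z) (snd z)) * ennreal (x' (fst z) (snd z))) \<partial>PT)"
    unfolding cost_x_def
  proof (rule nn_integral_cong)
    fix z assume "z \<in> space PT"
    then have "0 \<le> x (fst z) (snd z)" "0 \<le> x' (fst z) (snd z)"
      using planD(3)[OF p(1)] planD(3)[OF p(2)] by (auto simp: space_PT)
    then show "ennreal (\<psi>x (fst z) (snd z)) * ennreal (a * x (fst z) (snd z) + b * x' (fst z) (snd z))
        = ennreal a * (ennreal (\<psi>x (fst z) (snd z)) * ennreal (x (fst z) (snd z)))
        + ennreal b * (ennreal (\<psi>x (fst z) (snd z)) * ennreal (x' (fst z) (snd z)))"
      using ab by (simp add: ennreal_plus ennreal_mult algebra_simps)
  qed
  also have "\<dots> = ennreal a * cost_x x + ennreal b * cost_x x'"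
    unfolding cost_x_def by (subst nn_integral_add) (auto simp: nn_integral_cmult)
  finally show ?thesis .
qed

lemma cost_c_lincomb:
  assumes p: "plan x C" "plan x' C'" and ab: "0 \<le> a" "0 \<le> b"
  shows "cost_c (\<lambda>\<omega> t. a * C \<omega> t + b * C' \<omega> t) = ennreal a * cost_c C + ennreal b * cost_c C'"
proof -
  note j = price_jointly_measurable_ennreal[OF prices(2)]
  have inc: "AE \<omega> in M. increasing_path T (C \<omega>)" "AE \<omega> in M. increasing_path T (C' \<omega>)"
    using plan_contribution[OF p(1)] plan_contribution[OF p(2)] by (auto simp: contribution_def)
  have [measurable]: "(\<lambda>\<omega>. \<integral>\<^sup>+t. ennreal (\<psi>c \<omega> t) \<partial>stieltjes_measure T (C \<omega>)) \<in> borel_measurable M"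
    "(\<lambda>\<omega>. \<integral>\<^sup>+t. ennreal (\<psi>c \<omega> t) \<partial>stieltjes_measure T (C' \<omega>)) \<in> borel_measurable M"
    by (rule stieltjes_integral_measurable[OF _ j] plan_contribution[OF p(1)] plan_contribution[OF p(2)])+
  have "cost_c (\<lambda>\<omega> t. a * C \<omega> t + b * C' \<omega> t)
      = (\<integral>\<^sup>+\<omega>. ennreal a * (\<integral>\<^sup>+t. ennreal (\<psi>c \<omega> t) \<partial>stieltjes_measure T (C \<omega>))
        + ennreal b * (\<integral>\<^sup>+t. ennreal (\<psi>c \<omega> t) \<partial>stieltjes_measure T (C' \<omega>)) \<partial>M)"
    unfolding cost_c_def
  proof (rule nn_integral_cong_AE)
    show "AE \<omega> in M. (\<integral>\<^sup>+t. ennreal (\<psi>c \<omega> t) \<partial>stieltjes_measure T (\<lambda>t. a * C \<omega> t + b * C' \<omega> t))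
      = ennreal a * (\<integral>\<^sup>+t. ennreal (\<psi>c \<omega> t) \<partial>stieltjes_measure T (C \<omega>))
        + ennreal b * (\<integral>\<^sup>+t. ennreal (\<psi>c \<omega> t) \<partial>stieltjes_measure T (C' \<omega>))"
      using inc AE_space
    proof eventually_elim
      case (elim \<omega>)
      show ?case by (rule nn_integral_stieltjes_lincomb[OF elim(1,2) ab jointly_measurable_path[OF j elim(3)]])
    qed
  qed
  also have "\<dots> = ennreal a * cost_c C + ennreal b * cost_c C'"
    unfolding cost_c_def by (subst nn_integral_add) (auto simp: nn_integral_cmult)
  finally show ?thesis .
qed

lemma expenditure_lincomb:
  assumes p: "plan x C" "plan x' C'" and ab: "0 \<le> a" "0 \<le> b"
  shows "expenditure M T \<psi>x \<psi>c (\<lambda>\<omega> t. a * x \<omega> t + b * x' \<omega> t) (\<lambda>\<omega> t. a * C \<omega> t + b * C' \<omega> t)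
    = ennreal a * expenditure M T \<psi>x \<psi>c x C + ennreal b * expenditure M T \<psi>x \<psi>c x' C'"
  unfolding expenditure_eq[OF p(1)] expenditure_eq[OF p(2)] expenditure_eq[OF plan_lincomb[OF p ab]]
    cost_x_lincomb[OF p ab] cost_c_lincomb[OF p ab]
  by (simp add: algebra_simps)

lemma stieltjes_zero: "(\<integral>\<^sup>+t. f t \<partial>stieltjes_measure T (\<lambda>_. 0)) = 0"
proof -
  have inc: "increasing_path T (\<lambda>_. 0)" by (simp add: increasing_path_def mono_on_def right_continuous_path_def)
  have "emeasure (stieltjes_measure T (\<lambda>_. 0)) {..T} = 0" using emeasure_stieltjes_atMost[OF inc] by simp
  then have "space (stieltjes_measure T (\<lambda>_. 0)) \<in> null_sets (stieltjes_measure T (\<lambda>_. 0))"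
    using sets.top[of "stieltjes_measure T (\<lambda>_. 0)"] by (intro null_setsI) auto
  then have "AE t in stieltjes_measure T (\<lambda>_. 0). f t = 0" by (rule AE_I') auto
  then show ?thesis by (subst nn_integral_cong_AE[where v="\<lambda>_. 0"]) auto
qed

lemma cost_zero: "cost_x (\<lambda>_ _. 0) = 0" "cost_c (\<lambda>_ _. 0) = 0"
  by (simp_all add: cost_x_def cost_c_def stieltjes_zero)

text \<open>Discounted one-sided marginal utilities, defined everywhere and optional; they coincide
  with \<^const>\<open>marginal_x\<close> and \<^const>\<open>marginal_c\<close> wherever the gradient exists.\<close>

definition mx :: "'a \<Rightarrow> ennreal \<Rightarrow> ennreal" where
  "mx \<omega> t = ennreal (discount r \<omega> t) * slope_x (xh \<omega> t) (Q \<omega> t)"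

definition mc :: "'a \<Rightarrow> ennreal \<Rightarrow> ennreal" where
  "mc \<omega> t = ennreal (discount r \<omega> t) * slope_c (xh \<omega> t) (Q \<omega> t)"

lemma Q_nonneg: "\<omega> \<in> space M \<Longrightarrow> t \<le> T \<Longrightarrow> 0 \<le> Q \<omega> t"
  using planD(4)[OF plan_hat] D_nonneg by (simp add: Q_def)

lemma Q_optional: "optional M F T Q"
proof -
  have [measurable]: "(\<lambda>z. Ch (fst z) (snd z)) \<in> borel_measurable (optional_sigma M F T)"
    "(\<lambda>z. D (fst z) (snd z)) \<in> borel_measurable (optional_sigma M F T)"
    using planD(2)[OF plan_hat] D_optional by (auto simp: optional_iff)
  show ?thesis unfolding optional_iff Q_def by measurable
qed

lemma marginal_optional: "optional M F T mx" "optional M F T mc"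
proof -
  have [measurable]: "(\<lambda>z. discount r (fst z) (snd z)) \<in> borel_measurable (optional_sigma M F T)"
    using discount_optional[OF prices(3,4)] by (simp add: optional_iff)
  have x: "(\<lambda>z. xh (fst z) (snd z)) \<in> borel_measurable (optional_sigma M F T)"
    and q: "(\<lambda>z. Q (fst z) (snd z)) \<in> borel_measurable (optional_sigma M F T)"
    using planD(1)[OF plan_hat] Q_optional by (auto simp: optional_iff)
  have [measurable]: "(\<lambda>z. slope_x (xh (fst z) (snd z)) (Q (fst z) (snd z))) \<in> borel_measurable (optional_sigma M F T)"
    "(\<lambda>z. slope_c (xh (fst z) (snd z)) (Q (fst z) (snd z))) \<in> borel_measurable (optional_sigma M F T)"
    by (rule measurable_slope[OF x q]; use planD(3)[OF plan_hat] Q_nonneg in \<open>auto simp: space_optional_sigma\<close>)+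
  show "optional M F T mx" "optional M F T mc" unfolding optional_iff mx_def mc_def by measurable
qed

lemma marginal_measurable [measurable]:
  "(\<lambda>z. mx (fst z) (snd z)) \<in> borel_measurable PT" "(\<lambda>z. mc (fst z) (snd z)) \<in> borel_measurable PT"
  by (rule optional_measurable_PT[OF marginal_optional(1)] optional_measurable_PT[OF marginal_optional(2)])+

lemma discount_measurable [measurable]: "(\<lambda>z. discount r (fst z) (snd z)) \<in> borel_measurable PT"
  by (rule optional_measurable_PT[OF discount_optional[OF prices(3,4)]])

definition Lx :: "'a process \<Rightarrow> ennreal" where
  "Lx x = (\<integral>\<^sup>+z. mx (fst z) (snd z) * ennreal (x (fst z) (snd z)) \<partial>PT)"

definition Lc :: "'a process \<Rightarrow> ennreal" where
  "Lc C = (\<integral>\<^sup>+z. mc (fst z) (snd z) * ennreal (C (fst z) (snd z)) \<partial>PT)"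

lemma utility_measurable:
  assumes p: "plan x C"
  shows "(\<lambda>z. u (x (fst z) (snd z)) (C (fst z) (snd z) + D (fst z) (snd z))) \<in> borel_measurable PT"
proof (rule measurable_u)
  have [measurable]: "(\<lambda>z. C (fst z) (snd z)) \<in> borel_measurable PT" "(\<lambda>z. D (fst z) (snd z)) \<in> borel_measurable PT"
    by (rule optional_measurable_PT[OF planD(2)[OF p]] optional_measurable_PT[OF D_optional])+
  show "(\<lambda>z. C (fst z) (snd z) + D (fst z) (snd z)) \<in> borel_measurable PT" by measurable
qed (use planD(3,4)[OF p] D_nonneg in \<open>auto simp: space_PT intro: optional_measurable_PT[OF planD(1)[OF p]]\<close>)

lemma payoff_eq:
  assumes p: "plan x C"
  shows "payoff M T r u x C D
    = (\<integral>\<^sup>+z. ennreal (discount r (fst z) (snd z)) * ennreal (u (x (fst z) (snd z)) (C (fst z) (snd z) + D (fst z) (snd z))) \<partial>PT)"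
proof -
  note [measurable] = utility_measurable[OF p]
  have m: "(\<lambda>z. ennreal (discount r (fst z) (snd z) * u (x (fst z) (snd z)) (C (fst z) (snd z) + D (fst z) (snd z)))) \<in> borel_measurable PT"
    by measurable
  have "payoff M T r u x C D = (\<integral>\<^sup>+z. ennreal (discount r (fst z) (snd z) * u (x (fst z) (snd z)) (C (fst z) (snd z) + D (fst z) (snd z))) \<partial>PT)"
    unfolding payoff_def using lebesgue_time.nn_integral_fst[OF m] by simp
  also have "\<dots> = (\<integral>\<^sup>+z. ennreal (discount r (fst z) (snd z)) * ennreal (u (x (fst z) (snd z)) (C (fst z) (snd z) + D (fst z) (snd z))) \<partial>PT)"
    by (intro nn_integral_cong ennreal_mult') (simp add: discount_pos less_imp_le)
  finally show ?thesis .
qed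

text \<open>Time is sigma-finite, so some strictly positive h has a finite integral, also for T =
  \<infinity>. Prices at finite times have mean at most 1, which makes a deterministic multiple of h
  affordable.\<close>

lemma positive_plan:
  obtains x0 where "plan x0 (\<lambda>_ _. 0)" "(x0, \<lambda>_ _. 0) \<in> budget_set M F T \<psi>x \<psi>c w"
    "\<And>\<omega> t. \<omega> \<in> space M \<Longrightarrow> t \<le> T \<Longrightarrow> 0 < x0 \<omega> t"
proof -
  obtain h where h[measurable]: "h \<in> borel_measurable (lebesgue_time T)" and hfin: "(\<integral>\<^sup>+t. h t \<partial>lebesgue_time T) \<noteq> \<infinity>"
    and hpos: "\<And>t. t \<le> T \<Longrightarrow> 0 < h t \<and> h t < \<infinity>"
    using lebesgue_time.Ex_finite_integrable_function[of T] by auto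
  obtain H where H: "(\<integral>\<^sup>+t. h t \<partial>lebesgue_time T) = ennreal H" "0 \<le> H"
    using hfin by (cases "\<integral>\<^sup>+t. h t \<partial>lebesgue_time T") auto
  \<comment> \<open>The added 1 guards against H = 0 and still gives \<kappa> H \<le> w.\<close>
  define \<kappa> where "\<kappa> = w / (H + 1)"
  have \<kappa>: "0 < \<kappa>" "\<kappa> * H \<le> w" using w_pos H(2) by (auto simp: \<kappa>_def field_simps)
  define x0 :: "'a process" where "x0 \<omega> t = \<kappa> * enn2real (h t)" for \<omega> t
  have pos: "0 < x0 \<omega> t" if "t \<le> T" for \<omega> t
    using hpos[OF that] \<kappa> by (simp add: x0_def enn2real_positive_iff)
  have "snd \<in> measurable (optional_sigma M F T) (lebesgue_time T)"
    unfolding measurable_cong_sets[OF refl sets_lebesgue_time]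
    by (rule measurable_restrict_space2[OF _ measurable_time_optional]) (auto simp: space_optional_sigma)
  from measurable_compose[OF this h]
  have [measurable]: "(\<lambda>z. h (snd z)) \<in> borel_measurable (optional_sigma M F T)" .
  have p: "plan x0 (\<lambda>_ _. 0)"
    unfolding plan_def
  proof (intro conjI ballI allI impI)
    show "optional M F T x0" unfolding optional_iff x0_def by measurable
    show "AE \<omega> in M. right_continuous_path T (\<lambda>_. 0) \<and> mono_on {..T} (\<lambda>_. 0 :: real)"
      by (simp add: right_continuous_path_def mono_on_def)
  qed (use pos in \<open>auto simp: optional_iff intro: less_imp_le\<close>)
  have [measurable]: "(\<lambda>z. h (snd z)) \<in> borel_measurable PT" by (rule measurable_compose[OF measurable_snd h])
  have "cost_x x0 \<le> ennreal w"
  proof -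
    have "cost_x x0 = (\<integral>\<^sup>+z. ennreal \<kappa> * (ennreal (\<psi>x (fst z) (snd z)) * h (snd z)) \<partial>PT)"
      unfolding cost_x_def
    proof (rule nn_integral_cong)
      fix z assume "z \<in> space PT"
      then have "ennreal (enn2real (h (snd z))) = h (snd z)" using hpos[of "snd z"] by (simp add: space_PT)
      then show "ennreal (\<psi>x (fst z) (snd z)) * ennreal (x0 (fst z) (snd z))
          = ennreal \<kappa> * (ennreal (\<psi>x (fst z) (snd z)) * h (snd z))"
        using \<kappa> by (simp add: x0_def ennreal_mult' mult.left_commute)
    qed
    also have "\<dots> = ennreal \<kappa> * (\<integral>\<^sup>+z. ennreal (\<psi>x (fst z) (snd z)) * h (snd z) \<partial>PT)"
      by (rule nn_integral_cmult) measurable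
    also have "(\<integral>\<^sup>+z. ennreal (\<psi>x (fst z) (snd z)) * h (snd z) \<partial>PT)
        = (\<integral>\<^sup>+t. (\<integral>\<^sup>+\<omega>. ennreal (\<psi>x \<omega> t) * h t \<partial>M) \<partial>lebesgue_time T)"
      using PT.nn_integral_snd[of "\<lambda>z. ennreal (\<psi>x (fst z) (snd z)) * h (snd z)"] by simp
    also have "\<dots> \<le> (\<integral>\<^sup>+t. h t \<partial>lebesgue_time T)"
    proof (rule nn_integral_mono_AE)
      show "AE t in lebesgue_time T. (\<integral>\<^sup>+\<omega>. ennreal (\<psi>x \<omega> t) * h t \<partial>M) \<le> h t"
        using AE_lebesgue_time_finite AE_space
      proof eventually_elim
        case (elim t)
        have [measurable]: "(\<lambda>\<omega>. \<psi>x \<omega> t) \<in> borel_measurable M"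
          using prices(1) elim by (intro measurable_F_M[of _ t]) (auto simp: price_process_def adapted_def)
        have "(\<integral>\<^sup>+\<omega>. ennreal (\<psi>x \<omega> t) * h t \<partial>M) = (\<integral>\<^sup>+\<omega>. ennreal (\<psi>x \<omega> t) \<partial>M) * h t"
          by (rule nn_integral_multc) measurable
        also have "\<dots> \<le> 1 * h t"
          using elim by (intro mult_right_mono price_expectation[OF prices(1)]) (auto simp: less_top)
        finally show ?case by simp
      qed
    qed
    also have "ennreal \<kappa> * (\<integral>\<^sup>+t. h t \<partial>lebesgue_time T) = ennreal (\<kappa> * H)" using \<kappa> H by (simp add: ennreal_mult')
    also have "\<dots> \<le> ennreal w" using \<kappa> by (intro ennreal_leI)
    finally show ?thesis by (simp add: mult_left_mono)
  qed
  then have "(x0, \<lambda>_ _. 0) \<in> budget_set M F T \<psi>x \<psi>c w"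
    unfolding budget_iff using p by (simp add: expenditure_eq[OF p] cost_zero)
  then show thesis using p pos by (intro that) auto
qed


text \<open>The raw process that is to be projected. It is built from \<open>mc\<close>, which is
  measurable everywhere, and not from \<open>marginal_c\<close>, which is controlled only where the
  gradient exists.\<close>

definition remaining :: "'a \<Rightarrow> ennreal \<Rightarrow> ennreal" where
  "remaining \<omega> s = (\<integral>\<^sup>+t. mc \<omega> t * indicator {s..} t \<partial>lebesgue_time T)"

lemma remaining_measurable: "jointly_measurable remaining"
  unfolding remaining_def
  by (rule jointly_measurable_remaining) (use marginal_measurable(2) in \<open>simp add: case_prod_beta'\<close>)

lemma Lc_eq:
  assumes p: "plan x C"
  shows "Lc C = (\<integral>\<^sup>+\<omega>. (\<integral>\<^sup>+t. remaining \<omega> t \<partial>stieltjes_measure T (C \<omega>)) \<partial>M)"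
proof -
  have [measurable]: "(\<lambda>z. C (fst z) (snd z)) \<in> borel_measurable PT" by (rule optional_measurable_PT[OF planD(2)[OF p]])
  have "(\<lambda>z. mc (fst z) (snd z) * ennreal (C (fst z) (snd z))) \<in> borel_measurable PT" by measurable
  from lebesgue_time.nn_integral_fst[OF this]
  have "Lc C = (\<integral>\<^sup>+\<omega>. (\<integral>\<^sup>+t. mc \<omega> t * ennreal (C \<omega> t) \<partial>lebesgue_time T) \<partial>M)"
    by (simp add: Lc_def)
  also have "\<dots> = (\<integral>\<^sup>+\<omega>. (\<integral>\<^sup>+t. remaining \<omega> t \<partial>stieltjes_measure T (C \<omega>)) \<partial>M)"
  proof (rule nn_integral_cong_AE)
    have "AE \<omega> in M. increasing_path T (C \<omega>)" using plan_contribution[OF p] by (simp add: contribution_def)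
    then show "AE \<omega> in M. (\<integral>\<^sup>+t. mc \<omega> t * ennreal (C \<omega> t) \<partial>lebesgue_time T) = (\<integral>\<^sup>+t. remaining \<omega> t \<partial>stieltjes_measure T (C \<omega>))"
      using AE_space
    proof eventually_elim
      case (elim \<omega>)
      have "(\<lambda>t. mc (fst (\<omega>, t)) (snd (\<omega>, t))) \<in> borel_measurable (lebesgue_time T)"
        by (rule measurable_compose[OF measurable_Pair1'[OF elim(2)] marginal_measurable(2)])
      then have "mc \<omega> \<in> borel_measurable (lebesgue_time T)" by simp
      from nn_integral_contribution[OF elim(1) this] show ?case by (simp add: remaining_def)
    qed
  qed
  finally show ?thesis .
qed

lemma payoff_hat_eq:
  "payoff M T r u xh Ch D
    = (\<integral>\<^sup>+z. ennreal (discount r (fst z) (snd z)) * ennreal (u (xh (fst z) (snd z)) (Q (fst z) (snd z))) \<partial>PT)"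
  unfolding payoff_eq[OF plan_hat] Q_def ..

lemma utility_hat_measurable [measurable]:
  "(\<lambda>z. u (xh (fst z) (snd z)) (Q (fst z) (snd z))) \<in> borel_measurable PT"
  using utility_measurable[OF plan_hat] by (simp add: Q_def)

lemma gradient_AE:
  assumes pos: "AE z in PT. \<not> (xh (fst z) (snd z) = 0 \<and> 0 < Q (fst z) (snd z))"
  shows "AE z in PT. gradient_exists u (xh (fst z) (snd z)) (Q (fst z) (snd z))"
proof -
  have "AE z in PT. Q (fst z) (snd z) = 0 \<longrightarrow> gradient_exists u (xh (fst z) (snd z)) (Q (fst z) (snd z))"
    using gradient_edge by (simp add: case_prod_beta' Q_def)
  then show ?thesis
    using pos AE_space
  proof eventually_elim
    case (elim z)
    then have "0 \<le> xh (fst z) (snd z)" "0 \<le> Q (fst z) (snd z)"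
      using planD(3)[OF plan_hat] Q_nonneg by (auto simp: space_PT)
    then show ?case
      using elim gradient_interior[of "xh (fst z) (snd z)" "Q (fst z) (snd z)"]
      by (cases "Q (fst z) (snd z) = 0") (simp, auto simp: less_le)
  qed
qed

section \<open>Consequences of a gradient along the candidate\<close>

context
  assumes grad: "AE z in PT. gradient_exists u (xh (fst z) (snd z)) (Q (fst z) (snd z))"
begin

lemma marginal_AE:
  "AE z in PT. mx (fst z) (snd z) = marginal_x r u xh Q (fst z) (snd z)
     \<and> mc (fst z) (snd z) = marginal_c r u xh Q (fst z) (snd z)"
  using grad AE_space
proof eventually_elim
  case (elim z)
  then show ?case
    using slope_eq_partial[OF elim(1)] planD(3)[OF plan_hat] Q_nonneg
    by (auto simp: space_PT mx_def mc_def marginal_x_def marginal_c_def)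
qed

lemma cond_remaining_eq:
  assumes \<tau>: "\<tau> \<in> stopping_times M F T"
  shows "AE \<omega> in M. cond_remaining M F T (marginal_c r u xh Q) \<tau> \<omega>
    = nn_cond_exp M (pre_sigma \<tau>) (\<lambda>\<omega>. remaining \<omega> (\<tau> \<omega>)) \<omega>"
proof -
  have st: "stopping_time F \<tau>" using \<tau> by (auto simp: stopping_times_def)
  interpret sigma_finite_subalgebra M "pre_sigma \<tau>" by (rule finite_subalgebra_pre_sigma[OF st])
  let ?f = "\<lambda>\<omega>. \<integral>\<^sup>+t. marginal_c r u xh Q \<omega> t * indicator {\<tau> \<omega>..} t \<partial>lebesgue_time T"
  have m: "(\<lambda>\<omega>. remaining \<omega> (\<tau> \<omega>)) \<in> borel_measurable M"
    by (rule jointly_measurable_stopping[OF remaining_measurable \<tau>])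
  have "AE z in PT. mc (fst z) (snd z) = marginal_c r u xh Q (fst z) (snd z)"
    using marginal_AE by eventually_elim simp
  from PT.AE_pair[OF this]
  have eq: "AE \<omega> in M. remaining \<omega> (\<tau> \<omega>) = ?f \<omega>"
  proof eventually_elim
    case (elim \<omega>)
    show ?case unfolding remaining_def
      by (rule nn_integral_cong_AE) (use elim in \<open>auto elim!: eventually_mono\<close>)
  qed
  have mf: "?f \<in> borel_measurable M" by (rule AE_eq_measurable_M[OF m _ eq]) simp
  have "AE \<omega> in M. ?f \<omega> = remaining \<omega> (\<tau> \<omega>)" using eq by eventually_elim simp
  from nn_cond_exp_cong[OF this mf m] show ?thesis unfolding cond_remaining_def .
qed

text \<open>The two notions use different integrands, which agree almost everywhere for P \<otimes>
  dt, and one is in conditional, the other in integrated form.\<close>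

lemma optional_version_iff:
  "optional_version M F T (marginal_c r u xh Q) Y \<longleftrightarrow> optional_projection remaining Y"
proof
  assume Y: "optional_version M F T (marginal_c r u xh Q) Y"
  then have opt: "optional M F T Y" by (simp add: optional_version_def)
  show "optional_projection remaining Y"
    unfolding optional_projection_def
  proof (intro conjI ballI opt)
    fix \<tau> B assume \<tau>: "\<tau> \<in> stopping_times M F T" and B[measurable]: "B \<in> sets (pre_sigma \<tau>)"
    have st: "stopping_time F \<tau>" using \<tau> by (auto simp: stopping_times_def)
    interpret sigma_finite_subalgebra M "pre_sigma \<tau>" by (rule finite_subalgebra_pre_sigma[OF st])
    have m: "(\<lambda>\<omega>. remaining \<omega> (\<tau> \<omega>)) \<in> borel_measurable M"
      by (rule jointly_measurable_stopping[OF remaining_measurable \<tau>])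
    have "AE \<omega> in M. Y \<omega> (\<tau> \<omega>) = cond_remaining M F T (marginal_c r u xh Q) \<tau> \<omega>"
      using Y \<tau> by (simp add: optional_version_def)
    then have "AE \<omega> in M. Y \<omega> (\<tau> \<omega>) * indicator B \<omega> = indicator B \<omega> * nn_cond_exp M (pre_sigma \<tau>) (\<lambda>\<omega>. remaining \<omega> (\<tau> \<omega>)) \<omega>"
      using cond_remaining_eq[OF \<tau>] by eventually_elim (simp add: mult.commute)
    then have "(\<integral>\<^sup>+\<omega>\<in>B. Y \<omega> (\<tau> \<omega>) \<partial>M)
        = (\<integral>\<^sup>+\<omega>. indicator B \<omega> * nn_cond_exp M (pre_sigma \<tau>) (\<lambda>\<omega>. remaining \<omega> (\<tau> \<omega>)) \<omega> \<partial>M)"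
      by (rule nn_integral_cong_AE)
    also have "\<dots> = (\<integral>\<^sup>+\<omega>. indicator B \<omega> * remaining \<omega> (\<tau> \<omega>) \<partial>M)"
      by (rule nn_cond_exp_intg[OF _ m]) measurable
    finally show "(\<integral>\<^sup>+\<omega>\<in>B. Y \<omega> (\<tau> \<omega>) \<partial>M) = (\<integral>\<^sup>+\<omega>\<in>B. remaining \<omega> (\<tau> \<omega>) \<partial>M)"
      by (simp add: mult.commute)
  qed
next
  assume Y: "optional_projection remaining Y"
  show "optional_version M F T (marginal_c r u xh Q) Y"
    unfolding optional_version_def
  proof (intro conjI ballI)
    show "optional M F T Y" using Y by (simp add: optional_projection_def)
    fix \<tau> assume \<tau>: "\<tau> \<in> stopping_times M F T"
    show "AE \<omega> in M. Y \<omega> (\<tau> \<omega>) = cond_remaining M F T (marginal_c r u xh Q) \<tau> \<omega>"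
      using optional_projectionD[OF remaining_measurable Y \<tau>] cond_remaining_eq[OF \<tau>] by eventually_elim simp
  qed
qed

lemma stopping_timesI: "stopping_time F \<tau> \<Longrightarrow> (\<And>\<omega>. \<tau> \<omega> \<le> T) \<Longrightarrow> \<tau> \<in> stopping_times M F T"
  by (simp add: stopping_times_def)

text \<open>Y and \<open>remaining\<close> have equal integrals at stopping times. The one-sided
  comparison, applied in both directions, yields equality of the integrals against dC, even when
  they are infinite.\<close>

lemma Lc_projection:
  assumes p: "plan x C" and Y: "optional_projection remaining Y"
  shows "Lc C = (\<integral>\<^sup>+\<omega>. (\<integral>\<^sup>+t. Y \<omega> t \<partial>stieltjes_measure T (C \<omega>)) \<partial>M)"
proof -
  have j: "jointly_measurable Y"
    using optional_measurable_PT[of Y] Y by (simp add: optional_projection_def case_prod_beta')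
  have eq: "(\<integral>\<^sup>+\<omega>\<in>A. Y \<omega> (\<tau> \<omega>) \<partial>M) = (\<integral>\<^sup>+\<omega>\<in>A. remaining \<omega> (\<tau> \<omega>) \<partial>M)"
    if "stopping_time F \<tau>" "\<And>\<omega>. \<tau> \<omega> \<le> T" "A \<in> sets (pre_sigma \<tau>)" for \<tau> A
    using Y stopping_timesI[OF that(1,2)] that(3) by (simp add: optional_projection_def)
  show ?thesis
    unfolding Lc_eq[OF p]
    by (intro antisym stieltjes_integral_mono[OF plan_contribution[OF p]] remaining_measurable j; simp add: eq)
qed

text \<open>\<open>Y \<le> \<lambda> \<psi>\<^sub>c\<close> at all stopping times means \<open>Y \<le> \<lambda> \<psi>\<^sub>c\<close> almost everywhere for \<open>P \<otimes> dC\<close>.\<close>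

context
  fixes lam :: real and Y
  assumes lam: "0 < lam" and Y: "optional_projection remaining Y"
    and bound: "\<forall>\<tau>\<in>stopping_times M F T. AE \<omega> in M.
      cond_remaining M F T (marginal_c r u xh Q) \<tau> \<omega> \<le> ennreal (lam * \<psi>c \<omega> (\<tau> \<omega>))"
begin

lemma bound_Y:
  assumes \<tau>: "\<tau> \<in> stopping_times M F T"
  shows "AE \<omega> in M. Y \<omega> (\<tau> \<omega>) \<le> ennreal (lam * \<psi>c \<omega> (\<tau> \<omega>))"
  using bound[rule_format, OF \<tau>] optional_projectionD[OF remaining_measurable Y \<tau>] cond_remaining_eq[OF \<tau>]
  by eventually_elim simp

lemma Y_measurable [measurable]: "(\<lambda>z. Y (fst z) (snd z)) \<in> borel_measurable PT"
  using optional_measurable_PT[of Y] Y by (simp add: optional_projection_def)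

lemma excess_zero:
  assumes p: "plan x C"
  shows "(\<integral>\<^sup>+\<omega>. (\<integral>\<^sup>+t. Y \<omega> t - ennreal (lam * \<psi>c \<omega> t) \<partial>stieltjes_measure T (C \<omega>)) \<partial>M) = 0"
proof -
  have "(\<integral>\<^sup>+\<omega>. (\<integral>\<^sup>+t. Y \<omega> t - ennreal (lam * \<psi>c \<omega> t) \<partial>stieltjes_measure T (C \<omega>)) \<partial>M)
      \<le> (\<integral>\<^sup>+\<omega>. (\<integral>\<^sup>+t. 0 \<partial>stieltjes_measure T (C \<omega>)) \<partial>M)"
  proof (rule stieltjes_integral_mono[OF plan_contribution[OF p]])
    show "jointly_measurable (\<lambda>\<omega> t. Y \<omega> t - ennreal (lam * \<psi>c \<omega> t))" unfolding case_prod_beta' by measurable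
    fix \<tau> A assume "stopping_time F \<tau>" "\<And>\<omega>. \<tau> \<omega> \<le> T" "A \<in> sets (pre_sigma \<tau>)"
    then have "AE \<omega> in M. Y \<omega> (\<tau> \<omega>) \<le> ennreal (lam * \<psi>c \<omega> (\<tau> \<omega>))" by (intro bound_Y stopping_timesI)
    then have "AE \<omega> in M. (Y \<omega> (\<tau> \<omega>) - ennreal (lam * \<psi>c \<omega> (\<tau> \<omega>))) * indicator A \<omega> = 0"
      by eventually_elim (auto simp: diff_eq_0_iff_ennreal intro: le_less_trans)
    then have "(\<integral>\<^sup>+\<omega>\<in>A. (Y \<omega> (\<tau> \<omega>) - ennreal (lam * \<psi>c \<omega> (\<tau> \<omega>))) \<partial>M) = (\<integral>\<^sup>+\<omega>. 0 \<partial>M)"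
      by (rule nn_integral_cong_AE)
    then show "(\<integral>\<^sup>+\<omega>\<in>A. (Y \<omega> (\<tau> \<omega>) - ennreal (lam * \<psi>c \<omega> (\<tau> \<omega>))) \<partial>M) \<le> (\<integral>\<^sup>+\<omega>\<in>A. 0 \<partial>M)" by simp
  qed simp
  then show ?thesis by simp
qed

text \<open>With truncated subtraction the balance would fail by the excess of Y over \<lambda>
  \<psi>c, and that excess vanishes. The identity holds for every plan, including infinite values;
  it gives both the bound on \<open>Lc\<close> and the equivalence of zero slack with equality when
  the cost is finite.\<close>

lemma slack_eq:
  assumes p: "plan x C"
  shows "(\<integral>\<^sup>+\<omega>. (\<integral>\<^sup>+t. ennreal (lam * \<psi>c \<omega> t) - Y \<omega> t \<partial>stieltjes_measure T (C \<omega>)) \<partial>M) + Lc C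
    = ennreal lam * cost_c C"
proof -
  let ?I = "\<lambda>f. \<integral>\<^sup>+\<omega>. (\<integral>\<^sup>+t. f \<omega> t \<partial>stieltjes_measure T (C \<omega>)) \<partial>M"
  note con = plan_contribution[OF p]
  have m: "jointly_measurable (\<lambda>\<omega> t. ennreal (lam * \<psi>c \<omega> t) - Y \<omega> t)"
    "jointly_measurable (\<lambda>\<omega> t. Y \<omega> t - ennreal (lam * \<psi>c \<omega> t))"
    "jointly_measurable (\<lambda>\<omega> t. ennreal (lam * \<psi>c \<omega> t))" "jointly_measurable Y"
    "jointly_measurable (\<lambda>\<omega> t. ennreal (\<psi>c \<omega> t))"
    unfolding case_prod_beta' by measurable
  have path: "f \<omega> \<in> borel_measurable (stieltjes_measure T (C \<omega>))" if "jointly_measurable f" "\<omega> \<in> space M"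
    for f :: "'a \<Rightarrow> ennreal \<Rightarrow> ennreal" and \<omega>
    using jointly_measurable_path[OF that] by (simp add: measurable_cong_sets[OF sets_stieltjes_measure refl])
  have add: "?I (\<lambda>\<omega> t. f \<omega> t + g \<omega> t) = ?I f + ?I g" if f: "jointly_measurable f" and g: "jointly_measurable g"
    for f g :: "'a \<Rightarrow> ennreal \<Rightarrow> ennreal"
  proof -
    have "?I (\<lambda>\<omega> t. f \<omega> t + g \<omega> t)
        = (\<integral>\<^sup>+\<omega>. (\<integral>\<^sup>+t. f \<omega> t \<partial>stieltjes_measure T (C \<omega>)) + (\<integral>\<^sup>+t. g \<omega> t \<partial>stieltjes_measure T (C \<omega>)) \<partial>M)"
      by (intro nn_integral_cong nn_integral_add path f g)
    also have "\<dots> = ?I f + ?I g"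
      by (intro nn_integral_add stieltjes_integral_measurable con f g)
    finally show ?thesis .
  qed
  have "?I (\<lambda>\<omega> t. ennreal (lam * \<psi>c \<omega> t) - Y \<omega> t) + ?I Y = ?I (\<lambda>\<omega> t. (ennreal (lam * \<psi>c \<omega> t) - Y \<omega> t) + Y \<omega> t)"
    using add[OF m(1,4)] by simp
  \<comment> \<open>Both sides are the maximum of Y and \<lambda> \<psi>c.\<close>
  also have "(\<lambda>\<omega> t. (ennreal (lam * \<psi>c \<omega> t) - Y \<omega> t) + Y \<omega> t)
      = (\<lambda>\<omega> t. ennreal (lam * \<psi>c \<omega> t) + (Y \<omega> t - ennreal (lam * \<psi>c \<omega> t)))"
  proof (intro ext)
    fix \<omega> t
    show "(ennreal (lam * \<psi>c \<omega> t) - Y \<omega> t) + Y \<omega> t = ennreal (lam * \<psi>c \<omega> t) + (Y \<omega> t - ennreal (lam * \<psi>c \<omega> t))"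
    proof (cases "Y \<omega> t \<le> ennreal (lam * \<psi>c \<omega> t)")
      case True
      moreover from this have "Y \<omega> t - ennreal (lam * \<psi>c \<omega> t) = 0"
        by (auto simp: diff_eq_0_iff_ennreal intro: le_less_trans)
      ultimately show ?thesis by (simp add: diff_add_cancel_ennreal)
    next
      case False
      then show ?thesis by (auto simp: add_diff_inverse_ennreal diff_eq_0_iff_ennreal not_le)
    qed
  qed
  also have "?I \<dots> = ?I (\<lambda>\<omega> t. ennreal (lam * \<psi>c \<omega> t)) + ?I (\<lambda>\<omega> t. Y \<omega> t - ennreal (lam * \<psi>c \<omega> t))"
    by (rule add[OF m(3,2)])
  also have "\<dots> = ?I (\<lambda>\<omega> t. ennreal (lam * \<psi>c \<omega> t))" using excess_zero[OF p] by simp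
  also have "\<dots> = (\<integral>\<^sup>+\<omega>. ennreal lam * (\<integral>\<^sup>+t. ennreal (\<psi>c \<omega> t) \<partial>stieltjes_measure T (C \<omega>)) \<partial>M)"
  proof (rule nn_integral_cong)
    fix \<omega> assume "\<omega> \<in> space M"
    from nn_integral_cmult[OF path[OF m(5) this], of "ennreal lam"]
    show "(\<integral>\<^sup>+t. ennreal (lam * \<psi>c \<omega> t) \<partial>stieltjes_measure T (C \<omega>))
        = ennreal lam * (\<integral>\<^sup>+t. ennreal (\<psi>c \<omega> t) \<partial>stieltjes_measure T (C \<omega>))"
      using lam by (simp add: ennreal_mult')
  qed
  also have "\<dots> = ennreal lam * cost_c C"
    unfolding cost_c_def by (rule nn_integral_cmult[OF stieltjes_integral_measurable[OF con m(5)]])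
  finally show ?thesis using Lc_projection[OF p Y] by simp
qed

text \<open>The positive part is the excess, hence zero, so the form \<infinity> - \<infinity> never
  arises.\<close>

lemma stieltjes_expectation_eq:
  assumes p: "plan x C"
  shows "stieltjes_expectation M T (\<lambda>\<omega> t. enn2ereal (Y \<omega> t) - ereal (lam * \<psi>c \<omega> t)) C
    = - enn2ereal (\<integral>\<^sup>+\<omega>. (\<integral>\<^sup>+t. ennreal (lam * \<psi>c \<omega> t) - Y \<omega> t \<partial>stieltjes_measure T (C \<omega>)) \<partial>M)"
proof -
  \<comment> \<open>Prices are positive at finite times. If T = \<infinity>, the value at the end
    point is zero only almost surely, which costs a null set.\<close>
  have nonneg: "AE \<omega> in M. \<forall>t\<le>T. 0 \<le> \<psi>c \<omega> t"
  proof -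
    have *: "\<forall>\<omega>\<in>space M. \<forall>t\<le>T. t < \<infinity> \<longrightarrow> 0 < \<psi>c \<omega> t" using prices(2) by (simp add: price_process_def)
    show ?thesis
    proof (cases "T = \<infinity>")
      case True
      then have "AE \<omega> in M. \<psi>c \<omega> T = 0" using price by (simp add: price_assumption_def)
      then show ?thesis
        using AE_space
      proof eventually_elim
        case (elim \<omega>)
        show ?case
        proof (intro allI impI)
          fix t assume "t \<le> T"
          then show "0 \<le> \<psi>c \<omega> t" using * elim True by (cases "t = \<infinity>") (auto simp: less_top intro: less_imp_le)
        qed
      qed
    next
      case False
      then have "t \<le> T \<Longrightarrow> t < \<infinity>" for t by (auto simp: less_top intro: le_less_trans)
      then show ?thesis using * by (intro AE_I2) (auto intro: less_imp_le)
    qed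
  qed
  have conv: "e2ennreal (enn2ereal a - ereal b) = a - ennreal b" "e2ennreal (- (enn2ereal a - ereal b)) = ennreal b - a"
    if "0 \<le> b" for a b
    using that by (cases a; simp add: ennreal_minus e2ennreal_neg)+
  have pos: "(\<integral>\<^sup>+\<omega>. (\<integral>\<^sup>+t. e2ennreal (enn2ereal (Y \<omega> t) - ereal (lam * \<psi>c \<omega> t)) \<partial>stieltjes_measure T (C \<omega>)) \<partial>M)
      = (\<integral>\<^sup>+\<omega>. (\<integral>\<^sup>+t. Y \<omega> t - ennreal (lam * \<psi>c \<omega> t) \<partial>stieltjes_measure T (C \<omega>)) \<partial>M)"
  proof (rule nn_integral_cong_AE)
    show "AE \<omega> in M. (\<integral>\<^sup>+t. e2ennreal (enn2ereal (Y \<omega> t) - ereal (lam * \<psi>c \<omega> t)) \<partial>stieltjes_measure T (C \<omega>))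
      = (\<integral>\<^sup>+t. Y \<omega> t - ennreal (lam * \<psi>c \<omega> t) \<partial>stieltjes_measure T (C \<omega>))"
      using nonneg by eventually_elim (use lam in \<open>auto intro!: nn_integral_cong conv(1)\<close>)
  qed
  have neg: "(\<integral>\<^sup>+\<omega>. (\<integral>\<^sup>+t. e2ennreal (- (enn2ereal (Y \<omega> t) - ereal (lam * \<psi>c \<omega> t))) \<partial>stieltjes_measure T (C \<omega>)) \<partial>M)
      = (\<integral>\<^sup>+\<omega>. (\<integral>\<^sup>+t. ennreal (lam * \<psi>c \<omega> t) - Y \<omega> t \<partial>stieltjes_measure T (C \<omega>)) \<partial>M)"
  proof (rule nn_integral_cong_AE)
    show "AE \<omega> in M. (\<integral>\<^sup>+t. e2ennreal (- (enn2ereal (Y \<omega> t) - ereal (lam * \<psi>c \<omega> t))) \<partial>stieltjes_measure T (C \<omega>))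
      = (\<integral>\<^sup>+t. ennreal (lam * \<psi>c \<omega> t) - Y \<omega> t \<partial>stieltjes_measure T (C \<omega>))"
      using nonneg by eventually_elim (use lam in \<open>auto intro!: nn_integral_cong conv(2)\<close>)
  qed
  show ?thesis
    unfolding stieltjes_expectation_def pos neg excess_zero[OF p] by (simp add: zero_ennreal.rep_eq)
qed

end

lemma payoff_gradient:
  assumes p: "plan x C"
  shows "payoff M T r u x C D + (Lx xh + Lc Ch) \<le> payoff M T r u xh Ch D + (Lx x + Lc C)"
proof -
  let ?d = "\<lambda>z. ennreal (discount r (fst z) (snd z))"
  have [measurable]: "(\<lambda>z. x (fst z) (snd z)) \<in> borel_measurable PT" "(\<lambda>z. C (fst z) (snd z)) \<in> borel_measurable PT"
    "(\<lambda>z. xh (fst z) (snd z)) \<in> borel_measurable PT" "(\<lambda>z. Ch (fst z) (snd z)) \<in> borel_measurable PT"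
    by (rule optional_measurable_PT[OF planD(1)[OF p]] optional_measurable_PT[OF planD(2)[OF p]]
        optional_measurable_PT[OF planD(1)[OF plan_hat]] optional_measurable_PT[OF planD(2)[OF plan_hat]])+
  note [measurable] = utility_measurable[OF p]
  have "payoff M T r u x C D + (Lx xh + Lc Ch)
      = (\<integral>\<^sup>+z. ?d z * ennreal (u (x (fst z) (snd z)) (C (fst z) (snd z) + D (fst z) (snd z)))
        + (mx (fst z) (snd z) * ennreal (xh (fst z) (snd z)) + mc (fst z) (snd z) * ennreal (Ch (fst z) (snd z))) \<partial>PT)"
    unfolding payoff_eq[OF p] Lx_def Lc_def by (simp add: nn_integral_add)
  also have "\<dots> \<le> (\<integral>\<^sup>+z. ?d z * ennreal (u (xh (fst z) (snd z)) (Q (fst z) (snd z)))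
        + (mx (fst z) (snd z) * ennreal (x (fst z) (snd z)) + mc (fst z) (snd z) * ennreal (C (fst z) (snd z))) \<partial>PT)"
  proof (rule nn_integral_mono_AE)
    show "AE z in PT. ?d z * ennreal (u (x (fst z) (snd z)) (C (fst z) (snd z) + D (fst z) (snd z)))
        + (mx (fst z) (snd z) * ennreal (xh (fst z) (snd z)) + mc (fst z) (snd z) * ennreal (Ch (fst z) (snd z)))
      \<le> ?d z * ennreal (u (xh (fst z) (snd z)) (Q (fst z) (snd z)))
        + (mx (fst z) (snd z) * ennreal (x (fst z) (snd z)) + mc (fst z) (snd z) * ennreal (C (fst z) (snd z)))"
      using grad marginal_AE AE_space
    proof eventually_elim
      case (elim z)
      obtain \<omega> t where z: "z = (\<omega>, t)" "\<omega> \<in> space M" "t \<le> T" using elim(3) by (cases z) (auto simp: space_PT)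
      have g: "gradient_exists u (xh \<omega> t) (Ch \<omega> t + D \<omega> t)" using elim(1) z by (simp add: Q_def)
      have "ennreal (u (x \<omega> t) (C \<omega> t + D \<omega> t)) + (partial_x u (xh \<omega> t) (Ch \<omega> t + D \<omega> t) * ennreal (xh \<omega> t)
            + partial_c u (xh \<omega> t) (Ch \<omega> t + D \<omega> t) * ennreal (Ch \<omega> t))
          \<le> ennreal (u (xh \<omega> t) (Ch \<omega> t + D \<omega> t)) + (partial_x u (xh \<omega> t) (Ch \<omega> t + D \<omega> t) * ennreal (x \<omega> t)
            + partial_c u (xh \<omega> t) (Ch \<omega> t + D \<omega> t) * ennreal (C \<omega> t))"
        by (rule concave_gradient[OF g]) (use z planD(3,4)[OF p] planD(3,4)[OF plan_hat] D_nonneg in auto)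
      from mult_left_mono[OF this, of "ennreal (discount r \<omega> t)"] show ?case
        using elim(2) z by (simp add: Q_def marginal_x_def marginal_c_def algebra_simps)
    qed
  qed
  also have "\<dots> = payoff M T r u xh Ch D + (Lx x + Lc C)"
    unfolding payoff_hat_eq Lx_def Lc_def by (simp add: nn_integral_add)
  finally show ?thesis .
qed

end


lemma discount_neq_0: "ennreal (discount r \<omega> t) \<noteq> 0"
  using discount_pos[of r \<omega> t] by (simp add: ennreal_eq_0_iff not_le)

lemma Lx_cmult:
  assumes p: "plan x C" and k: "0 \<le> k"
  shows "Lx (\<lambda>\<omega> t. k * x \<omega> t) = ennreal k * Lx x" "Lc (\<lambda>\<omega> t. k * C \<omega> t) = ennreal k * Lc C"
proof -
  have [measurable]: "(\<lambda>z. x (fst z) (snd z)) \<in> borel_measurable PT" "(\<lambda>z. C (fst z) (snd z)) \<in> borel_measurable PT"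
    by (rule optional_measurable_PT[OF planD(1)[OF p]] optional_measurable_PT[OF planD(2)[OF p]])+
  show "Lx (\<lambda>\<omega> t. k * x \<omega> t) = ennreal k * Lx x" "Lc (\<lambda>\<omega> t. k * C \<omega> t) = ennreal k * Lc C"
    using k by (simp_all add: Lx_def Lc_def ennreal_mult' mult.left_commute nn_integral_cmult)
qed

lemma L_zero: "Lx (\<lambda>_ _. 0) = 0" "Lc (\<lambda>_ _. 0) = 0"
  by (simp_all add: Lx_def Lc_def)

section \<open>Necessity: interior consumption, the multiplier and the first-order
  conditions\<close>

context
  assumes opt: "\<And>x C. (x, C) \<in> budget_set M F T \<psi>x \<psi>c w \<Longrightarrow> payoff M T r u x C D \<le> payoff M T r u xh Ch D"
begin

text \<open>Difference quotients along a feasible direction, shifted by the value at the optimum.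
  By concavity they dominate the payoff at the end point, so they are nonnegative and Fatou's
  lemma applies.\<close>

lemma quotient_liminf:
  assumes b: "(x, C) \<in> budget_set M F T \<psi>x \<psi>c w"
  defines "G \<equiv> \<lambda>n z. u (xh (fst z) (snd z)) (Ch (fst z) (snd z) + D (fst z) (snd z))
      + (u (xh (fst z) (snd z) + 1 / real (Suc n) * (x (fst z) (snd z) - xh (fst z) (snd z)))
           (Ch (fst z) (snd z) + D (fst z) (snd z) + 1 / real (Suc n) * (C (fst z) (snd z) - Ch (fst z) (snd z)))
         - u (xh (fst z) (snd z)) (Ch (fst z) (snd z) + D (fst z) (snd z))) / (1 / real (Suc n))"
  shows "(\<lambda>z. ennreal (G n z)) \<in> borel_measurable PT"
    and "(\<integral>\<^sup>+z. ennreal (discount r (fst z) (snd z)) * liminf (\<lambda>n. ennreal (G n z)) \<partial>PT) \<le> payoff M T r u xh Ch D"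
proof -
  have p: "plan x C" using b by (simp add: budget_iff)
  let ?d = "\<lambda>z. ennreal (discount r (fst z) (snd z))"
  let ?U = "payoff M T r u xh Ch D"
  define \<theta> where "\<theta> n = 1 / real (Suc n)" for n
  have \<theta>: "0 < \<theta> n" "\<theta> n \<le> 1" for n by (simp_all add: \<theta>_def)
  define x' where "x' n \<omega> t = (1 - \<theta> n) * xh \<omega> t + \<theta> n * x \<omega> t" for n \<omega> t
  define C' where "C' n \<omega> t = (1 - \<theta> n) * Ch \<omega> t + \<theta> n * C \<omega> t" for n \<omega> t
  have p': "plan (x' n) (C' n)" for n
    unfolding x'_def[abs_def] C'_def[abs_def] by (rule plan_lincomb[OF plan_hat p]) (use \<theta>[of n] in auto)
  have b': "(x' n, C' n) \<in> budget_set M F T \<psi>x \<psi>c w" for n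
  proof -
    have "expenditure M T \<psi>x \<psi>c (x' n) (C' n)
        = ennreal (1 - \<theta> n) * expenditure M T \<psi>x \<psi>c xh Ch + ennreal (\<theta> n) * expenditure M T \<psi>x \<psi>c x C"
      unfolding x'_def[abs_def] C'_def[abs_def] by (rule expenditure_lincomb[OF plan_hat p]) (use \<theta>[of n] in auto)
    also have "\<dots> \<le> ennreal (1 - \<theta> n) * ennreal w + ennreal (\<theta> n) * ennreal w"
      using b hat_budget by (intro add_mono mult_left_mono) (auto simp: budget_iff)
    also have "\<dots> = ennreal w"
      using \<theta>[of n] w_pos by (simp add: ennreal_mult'[symmetric] ennreal_plus[symmetric] algebra_simps del: ennreal_plus)
    finally show ?thesis using p' by (simp add: budget_iff)
  qed
  have G: "G n z = u (xh (fst z) (snd z)) (Ch (fst z) (snd z) + D (fst z) (snd z))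
      + (u (x' n (fst z) (snd z)) (C' n (fst z) (snd z) + D (fst z) (snd z))
         - u (xh (fst z) (snd z)) (Ch (fst z) (snd z) + D (fst z) (snd z))) / \<theta> n" for n z
  proof -
    have "xh \<omega> t + 1 / real (Suc n) * (x \<omega> t - xh \<omega> t) = x' n \<omega> t"
      "Ch \<omega> t + D \<omega> t + 1 / real (Suc n) * (C \<omega> t - Ch \<omega> t) = C' n \<omega> t + D \<omega> t" for \<omega> t
      unfolding x'_def C'_def \<theta>_def by (simp_all add: algebra_simps del: of_nat_Suc)
    then show ?thesis unfolding G_def \<theta>_def by (simp only:)
  qed
  note [measurable] = utility_measurable[OF plan_hat] utility_measurable[OF p']
  show Gm[measurable]: "(\<lambda>z. ennreal (G n z)) \<in> borel_measurable PT" for n unfolding G by measurable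
  have Gint: "(\<integral>\<^sup>+z. ?d z * ennreal (G n z) \<partial>PT) \<le> ?U" for n
  proof -
    \<comment> \<open>G is arranged so that \<theta> G + (1 - \<theta>) u(optimum) = u(mixed plan).
      Integrated, with U the optimal payoff, optimality gives \<theta> X + (1 - \<theta>) U \<le> U
      and hence X \<le> U.\<close>
    let ?X = "\<integral>\<^sup>+z. ?d z * ennreal (G n z) \<partial>PT"
    have "ennreal (\<theta> n) * ?X + ennreal (1 - \<theta> n) * ?U
        = (\<integral>\<^sup>+z. ?d z * (ennreal (\<theta> n) * ennreal (G n z)
          + ennreal (1 - \<theta> n) * ennreal (u (xh (fst z) (snd z)) (Ch (fst z) (snd z) + D (fst z) (snd z)))) \<partial>PT)"
      unfolding payoff_eq[OF plan_hat]
      by (simp add: nn_integral_cmult[symmetric] nn_integral_add[symmetric] algebra_simps)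
    also have "\<dots> = payoff M T r u (x' n) (C' n) D"
      unfolding payoff_eq[OF p']
    proof (rule nn_integral_cong)
      fix z assume "z \<in> space PT"
      then obtain \<omega> t where z: "z = (\<omega>, t)" "\<omega> \<in> space M" "t \<le> T" by (cases z) (auto simp: space_PT)
      have nn: "0 \<le> xh \<omega> t" "0 \<le> Ch \<omega> t" "0 \<le> x \<omega> t" "0 \<le> C \<omega> t" "0 \<le> D \<omega> t"
        using z planD(3,4)[OF plan_hat] planD(3,4)[OF p] D_nonneg by auto
      let ?u = "u (xh \<omega> t) (Ch \<omega> t + D \<omega> t)"
      have "?u + \<theta> n * (u (xh \<omega> t + (x \<omega> t - xh \<omega> t)) (Ch \<omega> t + D \<omega> t + (C \<omega> t - Ch \<omega> t)) - ?u)
          \<le> u (xh \<omega> t + \<theta> n * (x \<omega> t - xh \<omega> t)) (Ch \<omega> t + D \<omega> t + \<theta> n * (C \<omega> t - Ch \<omega> t))"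
        by (rule u_concave) (use nn \<theta>[of n] in auto)
      then have "\<theta> n * (u (x \<omega> t) (C \<omega> t + D \<omega> t) - ?u) \<le> u (x' n \<omega> t) (C' n \<omega> t + D \<omega> t) - ?u"
        by (simp add: x'_def C'_def algebra_simps)
      then have "u (x \<omega> t) (C \<omega> t + D \<omega> t) \<le> G n z"
        using \<theta>[of n] by (simp add: G z field_simps)
      then have "0 \<le> G n z" using u_nonneg[of "x \<omega> t" "C \<omega> t + D \<omega> t"] nn by simp
      moreover have "\<theta> n * G n z + (1 - \<theta> n) * ?u = u (x' n \<omega> t) (C' n \<omega> t + D \<omega> t)"
        using \<theta>[of n] by (simp add: G z field_simps)
      moreover have "0 \<le> ?u" using u_nonneg nn by simp
      ultimately have "ennreal (\<theta> n) * ennreal (G n z) + ennreal (1 - \<theta> n) * ennreal ?u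
          = ennreal (u (x' n \<omega> t) (C' n \<omega> t + D \<omega> t))"
        using \<theta>[of n] by (simp add: ennreal_mult'[symmetric] ennreal_plus[symmetric] del: ennreal_plus)
      then show "?d z * (ennreal (\<theta> n) * ennreal (G n z)
          + ennreal (1 - \<theta> n) * ennreal (u (xh (fst z) (snd z)) (Ch (fst z) (snd z) + D (fst z) (snd z))))
          = ?d z * ennreal (u (x' n (fst z) (snd z)) (C' n (fst z) (snd z) + D (fst z) (snd z)))"
        using z by simp
    qed
    also have "\<dots> \<le> ?U" by (rule opt[OF b'])
    finally have le: "ennreal (\<theta> n) * ?X + ennreal (1 - \<theta> n) * ?U \<le> ?U" .
    obtain U where U: "?U = ennreal U" "0 \<le> U" using payoff_hat_finite by (cases ?U) auto
    show ?thesis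
    proof (cases ?X)
      case top
      then show ?thesis using le U \<theta>[of n] by (simp add: ennreal_mult_top)
    next
      case (real X)
      then have "ennreal (\<theta> n * X + (1 - \<theta> n) * U) \<le> ennreal U"
        using le U \<theta>[of n] by (simp add: ennreal_mult' ennreal_plus)
      then have "\<theta> n * X + (1 - \<theta> n) * U \<le> U" using U by (simp add: ennreal_le_iff)
      then have "\<theta> n * X \<le> \<theta> n * U" by (simp add: algebra_simps)
      then have "X \<le> U" using \<theta>[of n] by simp
      then show ?thesis using real U by (simp add: ennreal_leI)
    qed
  qed
  have "(\<integral>\<^sup>+z. ?d z * liminf (\<lambda>n. ennreal (G n z)) \<partial>PT) \<le> (\<integral>\<^sup>+z. liminf (\<lambda>n. ?d z * ennreal (G n z)) \<partial>PT)"
    by (intro nn_integral_mono liminf_cmult_ennreal)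
  also have "\<dots> \<le> liminf (\<lambda>n. \<integral>\<^sup>+z. ?d z * ennreal (G n z) \<partial>PT)"
    by (rule nn_integral_liminf) measurable
  also have "\<dots> \<le> limsup (\<lambda>n. \<integral>\<^sup>+z. ?d z * ennreal (G n z) \<partial>PT)"
    by (rule Liminf_le_Limsup) simp
  also have "\<dots> \<le> ?U" by (rule Limsup_bounded) (simp add: Gint)
  finally show "(\<integral>\<^sup>+z. ?d z * liminf (\<lambda>n. ennreal (G n z)) \<partial>PT) \<le> ?U" .
qed

text \<open>The test direction points to a strictly positive consumption and zero contribution.
  Where consumption vanishes while the total contribution is positive, the quotients tend to
  \<infinity>; the finite bound on their integral allows this only on a null set.\<close>

lemma interior_consumption: "AE z in PT. \<not> (xh (fst z) (snd z) = 0 \<and> 0 < Q (fst z) (snd z))"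
proof -
  obtain x0 where x0: "plan x0 (\<lambda>_ _. 0)" "(x0, \<lambda>_ _. 0) \<in> budget_set M F T \<psi>x \<psi>c w"
    "\<And>\<omega> t. \<omega> \<in> space M \<Longrightarrow> t \<le> T \<Longrightarrow> 0 < x0 \<omega> t"
    using positive_plan by blast
  let ?G = "\<lambda>z. liminf (\<lambda>n. ennreal (u (xh (fst z) (snd z)) (Ch (fst z) (snd z) + D (fst z) (snd z))
      + (u (xh (fst z) (snd z) + 1 / real (Suc n) * (x0 (fst z) (snd z) - xh (fst z) (snd z)))
           (Ch (fst z) (snd z) + D (fst z) (snd z) + 1 / real (Suc n) * (0 - Ch (fst z) (snd z)))
         - u (xh (fst z) (snd z)) (Ch (fst z) (snd z) + D (fst z) (snd z))) / (1 / real (Suc n))))"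
  note [measurable] = quotient_liminf(1)[OF x0(2)]
  have "(\<integral>\<^sup>+z. ennreal (discount r (fst z) (snd z)) * ?G z \<partial>PT) \<noteq> \<infinity>"
    using quotient_liminf(2)[OF x0(2)] payoff_hat_finite by (auto simp: top_unique)
  then have "AE z in PT. ennreal (discount r (fst z) (snd z)) * ?G z \<noteq> \<infinity>"
    by (rule nn_integral_PInf_AE[rotated]) measurable
  then show ?thesis
    using AE_space
  proof eventually_elim
    case (elim z)
    then obtain \<omega> t where z: "z = (\<omega>, t)" "\<omega> \<in> space M" "t \<le> T" by (cases z) (auto simp: space_PT)
    show ?case
    proof
      assume *: "xh (fst z) (snd z) = 0 \<and> 0 < Q (fst z) (snd z)"
      have "?G z = top"
        using inada_liminf[of "x0 \<omega> t" "Ch \<omega> t" "D \<omega> t" 0] x0(3)[OF z(2,3)] planD(4)[OF plan_hat z(2,3)]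
          D_nonneg[OF z(2,3)] * by (simp add: z Q_def del: of_nat_Suc)
      then show False using elim(1) by (simp only: ennreal_mult_top discount_neq_0 if_False infinity_ennreal_def)
    qed
  qed
qed

lemmas optimal_gradient = gradient_AE[OF interior_consumption]

text \<open>In the gradient inequality against the zero plan, the utility of that plan is
  nonnegative and L vanishes there, so L at the optimum is at most the optimal payoff.\<close>

lemma L_hat_finite: "Lx xh + Lc Ch \<noteq> \<infinity>"
proof -
  have "payoff M T r u (\<lambda>_ _. 0) (\<lambda>_ _. 0) D + (Lx xh + Lc Ch) \<le> payoff M T r u xh Ch D + (Lx (\<lambda>_ _. 0) + Lc (\<lambda>_ _. 0))"
    by (rule payoff_gradient[OF optimal_gradient plan_zero(1)[OF plan_zero(2)[OF plan_hat]]])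
  then have "Lx xh + Lc Ch \<le> payoff M T r u xh Ch D"
    by (auto simp: L_zero intro: order_trans[rotated])
  then show ?thesis using payoff_hat_finite by (auto simp: top_unique)
qed

text \<open>L at the optimum is carried along so that signed directional derivatives become sums of
  nonnegative terms. Only the finite payoff is cancelled at the end.\<close>

lemma L_le:
  assumes b: "(x, C) \<in> budget_set M F T \<psi>x \<psi>c w"
  shows "Lx x + Lc C \<le> Lx xh + Lc Ch"
proof -
  have p: "plan x C" using b by (simp add: budget_iff)
  let ?d = "\<lambda>z. ennreal (discount r (fst z) (snd z))"
  define G where "G z = liminf (\<lambda>n. ennreal (u (xh (fst z) (snd z)) (Ch (fst z) (snd z) + D (fst z) (snd z))
      + (u (xh (fst z) (snd z) + 1 / real (Suc n) * (x (fst z) (snd z) - xh (fst z) (snd z)))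
           (Ch (fst z) (snd z) + D (fst z) (snd z) + 1 / real (Suc n) * (C (fst z) (snd z) - Ch (fst z) (snd z)))
         - u (xh (fst z) (snd z)) (Ch (fst z) (snd z) + D (fst z) (snd z))) / (1 / real (Suc n))))" for z
  note [measurable] = quotient_liminf(1)[OF b]
  have [measurable]: "(\<lambda>z. x (fst z) (snd z)) \<in> borel_measurable PT" "(\<lambda>z. C (fst z) (snd z)) \<in> borel_measurable PT"
    "(\<lambda>z. xh (fst z) (snd z)) \<in> borel_measurable PT" "(\<lambda>z. Ch (fst z) (snd z)) \<in> borel_measurable PT"
    by (rule optional_measurable_PT[OF planD(1)[OF p]] optional_measurable_PT[OF planD(2)[OF p]]
        optional_measurable_PT[OF planD(1)[OF plan_hat]] optional_measurable_PT[OF planD(2)[OF plan_hat]])+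
  have [measurable]: "G \<in> borel_measurable PT" unfolding G_def by measurable
  have "payoff M T r u xh Ch D + (Lx x + Lc C)
      = (\<integral>\<^sup>+z. ?d z * ennreal (u (xh (fst z) (snd z)) (Q (fst z) (snd z)))
        + (mx (fst z) (snd z) * ennreal (x (fst z) (snd z)) + mc (fst z) (snd z) * ennreal (C (fst z) (snd z))) \<partial>PT)"
    unfolding payoff_hat_eq Lx_def Lc_def by (simp add: nn_integral_add)
  also have "\<dots> \<le> (\<integral>\<^sup>+z. ?d z * G z
        + (mx (fst z) (snd z) * ennreal (xh (fst z) (snd z)) + mc (fst z) (snd z) * ennreal (Ch (fst z) (snd z))) \<partial>PT)"
  proof (rule nn_integral_mono_AE)
    show "AE z in PT. ?d z * ennreal (u (xh (fst z) (snd z)) (Q (fst z) (snd z)))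
        + (mx (fst z) (snd z) * ennreal (x (fst z) (snd z)) + mc (fst z) (snd z) * ennreal (C (fst z) (snd z)))
      \<le> ?d z * G z + (mx (fst z) (snd z) * ennreal (xh (fst z) (snd z)) + mc (fst z) (snd z) * ennreal (Ch (fst z) (snd z)))"
      using optimal_gradient marginal_AE[OF optimal_gradient] AE_space
    proof eventually_elim
      case (elim z)
      obtain \<omega> t where z: "z = (\<omega>, t)" "\<omega> \<in> space M" "t \<le> T" using elim(3) by (cases z) (auto simp: space_PT)
      have g: "gradient_exists u (xh \<omega> t) (Ch \<omega> t + D \<omega> t)" using elim(1) z by (simp add: Q_def)
      have "ennreal (u (xh \<omega> t) (Ch \<omega> t + D \<omega> t)) + (partial_x u (xh \<omega> t) (Ch \<omega> t + D \<omega> t) * ennreal (x \<omega> t)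
            + partial_c u (xh \<omega> t) (Ch \<omega> t + D \<omega> t) * ennreal (C \<omega> t))
          \<le> G z + (partial_x u (xh \<omega> t) (Ch \<omega> t + D \<omega> t) * ennreal (xh \<omega> t)
            + partial_c u (xh \<omega> t) (Ch \<omega> t + D \<omega> t) * ennreal (Ch \<omega> t))"
        unfolding G_def z fst_conv snd_conv
        by (rule gradient_liminf[OF g]) (use z planD(3,4)[OF p] planD(3,4)[OF plan_hat] D_nonneg in auto)
      from mult_left_mono[OF this, of "ennreal (discount r \<omega> t)"] show ?case
        using elim(2) z by (simp add: Q_def marginal_x_def marginal_c_def distrib_left mult.assoc)
    qed
  qed
  also have "\<dots> = (\<integral>\<^sup>+z. ?d z * G z \<partial>PT) + (Lx xh + Lc Ch)"
    unfolding Lx_def Lc_def by (simp add: nn_integral_add)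
  also have "\<dots> \<le> payoff M T r u xh Ch D + (Lx xh + Lc Ch)"
    unfolding G_def by (intro add_right_mono quotient_liminf(2)[OF b])
  finally show ?thesis using payoff_hat_finite by (auto simp: ennreal_add_left_cancel_le)
qed

lemma multiplier:
  obtains lam where "0 < lam" "Lx xh + Lc Ch = ennreal (lam * w)"
    "\<And>x C. plan x C \<Longrightarrow> expenditure M T \<psi>x \<psi>c x C < \<infinity> \<Longrightarrow> Lx x + Lc C \<le> ennreal lam * expenditure M T \<psi>x \<psi>c x C"
proof -
  obtain l where l: "Lx xh + Lc Ch = ennreal l" "0 \<le> l"
    using L_hat_finite by (cases "Lx xh + Lc Ch") auto
  define lam where "lam = l / w"
  have lam: "0 \<le> lam" "lam * w = l" using l w_pos by (auto simp: lam_def)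
  have dom: "Lx x + Lc C \<le> ennreal lam * expenditure M T \<psi>x \<psi>c x C"
    if p: "plan x C" and fin: "expenditure M T \<psi>x \<psi>c x C < \<infinity>" for x C
  proof -
    obtain e where e: "expenditure M T \<psi>x \<psi>c x C = ennreal e" "0 \<le> e"
      using fin by (cases "expenditure M T \<psi>x \<psi>c x C") auto
    \<comment> \<open>Every multiple k of the plan whose cost k e stays within w competes with the
      optimum, and L scales by the same factor.\<close>
    have scale: "ennreal k * (Lx x + Lc C) \<le> ennreal l" if k: "0 \<le> k" "k * e \<le> w" for k
    proof -
      have "plan (\<lambda>\<omega> t. k * x \<omega> t) (\<lambda>\<omega> t. k * C \<omega> t)"
        using plan_lincomb[OF p p k(1), of 0] by simp
      moreover have "expenditure M T \<psi>x \<psi>c (\<lambda>\<omega> t. k * x \<omega> t) (\<lambda>\<omega> t. k * C \<omega> t) \<le> ennreal w"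
        using expenditure_lincomb[OF p p k(1), of 0] e k by (simp add: ennreal_mult'[symmetric] ennreal_leI)
      ultimately have "Lx (\<lambda>\<omega> t. k * x \<omega> t) + Lc (\<lambda>\<omega> t. k * C \<omega> t) \<le> Lx xh + Lc Ch"
        by (intro L_le) (simp add: budget_iff)
      then show ?thesis using l by (simp add: Lx_cmult[OF p k(1)] distrib_left)
    qed
    have "ennreal 1 * (Lx x + Lc C) \<noteq> top \<or> w < e"
      using scale[of 1] by (auto simp: top_unique)
    \<comment> \<open>A positive admissible scaling that exists even for e = 0; it shows that L is
      finite.\<close>
    define k0 where "k0 = w / (e + 1)"
    have k0: "0 < k0" "k0 * e \<le> w" using w_pos e by (auto simp: k0_def field_simps)
    have "Lx x + Lc C \<noteq> top"
      using scale[of k0] k0 by (auto simp: ennreal_mult_top top_unique)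
    then obtain q where q: "Lx x + Lc C = ennreal q" "0 \<le> q" by (cases "Lx x + Lc C") auto
    have sc: "k * q \<le> l" if "0 \<le> k" "k * e \<le> w" for k
      using scale[OF that] q that l by (simp add: ennreal_mult'[symmetric] ennreal_le_iff)
    have "q \<le> lam * e"
    proof (cases "e = 0")
      case True
      have "q = 0"
      proof (rule ccontr)
        assume "q \<noteq> 0"
        then have "0 < q" using q by simp
        \<comment> \<open>A plan without cost can be scaled arbitrarily; this factor would push L to
          l + 1, above the optimum.\<close>
        then have "(l + 1) / q * q \<le> l" using l True w_pos by (intro sc) auto
        then show False using \<open>0 < q\<close> by simp
      qed
      then show ?thesis using True by simp
    next
      case False
      then have "w / e * q \<le> l" using e w_pos by (intro sc) auto
      then show ?thesis using False e w_pos by (simp add: lam_def field_simps)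
    qed
    then show ?thesis using q e lam by (simp add: ennreal_mult'[symmetric] ennreal_leI)
  qed
  \<comment> \<open>A zero multiplier would make L vanish at a strictly positive consumption,
    although u_x > 0 wherever the gradient exists and P \<otimes> dt has positive mass.\<close>
  have "lam \<noteq> 0"
  proof
    assume "lam = 0"
    obtain x0 where x0: "plan x0 (\<lambda>_ _. 0)" "(x0, \<lambda>_ _. 0) \<in> budget_set M F T \<psi>x \<psi>c w"
      "\<And>\<omega> t. \<omega> \<in> space M \<Longrightarrow> t \<le> T \<Longrightarrow> 0 < x0 \<omega> t"
      using positive_plan by blast
    have [measurable]: "(\<lambda>z. x0 (fst z) (snd z)) \<in> borel_measurable PT" by (rule optional_measurable_PT[OF planD(1)[OF x0(1)]])
    have "expenditure M T \<psi>x \<psi>c x0 (\<lambda>_ _. 0) < \<infinity>"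
      using x0(2) by (auto simp: budget_iff intro: le_less_trans)
    from dom[OF x0(1) this] \<open>lam = 0\<close> have "Lx x0 = 0" by (simp add: L_zero)
    then have "AE z in PT. mx (fst z) (snd z) * ennreal (x0 (fst z) (snd z)) = 0"
      unfolding Lx_def by (subst (asm) nn_integral_0_iff_AE) auto
    then have "AE z in PT. False"
      using optimal_gradient marginal_AE[OF optimal_gradient] AE_space
    proof eventually_elim
      case (elim z)
      obtain \<omega> t where z: "z = (\<omega>, t)" "\<omega> \<in> space M" "t \<le> T" using elim(4) by (cases z) (auto simp: space_PT)
      have "0 < partial_x u (xh \<omega> t) (Q \<omega> t)"
        by (rule partial_x_pos) (use elim(2) z planD(3)[OF plan_hat] Q_nonneg in auto)
      then show ?case
        using elim(1,3) z x0(3)[OF z(2,3)] discount_pos[of r \<omega> t]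
        by (auto simp: marginal_x_def ennreal_eq_0_iff not_le)
    qed
    then have "space PT \<in> null_sets PT" using AE_iff_null[of PT "\<lambda>_. False"] by simp
    then have "emeasure PT (space PT) = 0" by (rule null_setsD1)
    moreover have "emeasure PT (space PT) = emeasure M (space M) * emeasure (lebesgue_time T) {..T}"
      unfolding space_pair_measure
      using lebesgue_time.emeasure_pair_measure_Times[of "space M" M "space (lebesgue_time T)" T]
        sets.top[of "lebesgue_time T"] by simp
    ultimately show False using emeasure_lebesgue_time_pos[OF T_pos] by (simp add: emeasure_space_1)
  qed
  then show thesis using that[of lam] lam l dom by simp
qed

lemma necessity:
  "\<exists>lam>0.
     expenditure M T \<psi>x \<psi>c xh Ch = ennreal w \<and>
     (\<forall>\<tau>\<in>stopping_times M F T. AE \<omega> in M.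
        cond_remaining M F T (marginal_c r u xh Q) \<tau> \<omega> \<le> ennreal (lam * \<psi>c \<omega> (\<tau> \<omega>))) \<and>
     (\<exists>Y. optional_version M F T (marginal_c r u xh Q) Y \<and>
        stieltjes_expectation M T (\<lambda>\<omega> t. enn2ereal (Y \<omega> t) - ereal (lam * \<psi>c \<omega> t)) Ch = 0) \<and>
     (AE z in PT. marginal_x r u xh Q (fst z) (snd z) \<le> ennreal (lam * \<psi>x (fst z) (snd z)) \<and>
        (0 < xh (fst z) (snd z) \<longrightarrow> marginal_x r u xh Q (fst z) (snd z) = ennreal (lam * \<psi>x (fst z) (snd z))))"
proof -
  note grad = optimal_gradient
  obtain lam where lam: "0 < lam" "Lx xh + Lc Ch = ennreal (lam * w)"
    and dom: "\<And>x C. plan x C \<Longrightarrow> expenditure M T \<psi>x \<psi>c x C < \<infinity>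
      \<Longrightarrow> Lx x + Lc C \<le> ennreal lam * expenditure M T \<psi>x \<psi>c x C"
    using multiplier by blast
  have exp_le: "expenditure M T \<psi>x \<psi>c xh Ch \<le> ennreal w" using hat_budget by (simp add: budget_iff)
  then obtain e where e: "expenditure M T \<psi>x \<psi>c xh Ch = ennreal e" "0 \<le> e"
    by (cases "expenditure M T \<psi>x \<psi>c xh Ch") (auto simp: top_unique)
  \<comment> \<open>L at the optimum equals \<lambda> w and is at most \<lambda> times the
    expenditure, so with \<lambda> > 0 the budget is exhausted.\<close>
  have "ennreal (lam * w) \<le> ennreal (lam * e)"
    using dom[OF plan_hat] e lam by (simp add: ennreal_mult')
  then have "w \<le> e" using lam e by (simp add: ennreal_le_iff)
  then have exp: "expenditure M T \<psi>x \<psi>c xh Ch = ennreal w" using exp_le e by (simp add: antisym ennreal_leI)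
  then have cost: "cost_x xh + cost_c Ch = ennreal w" by (simp add: expenditure_eq[OF plan_hat])
  then have cost_fin: "cost_x xh \<noteq> top" "cost_c Ch \<noteq> top" by (auto simp: ennreal_add_eq_top)
  \<comment> \<open>Setting one component to zero splits the joint bound into one for consumption
    and one for contributions.\<close>
  have Lx_dom: "Lx x \<le> ennreal lam * cost_x x" if "plan x C" "cost_x x \<noteq> top" for x C
    using dom[OF plan_zero(1)[OF that(1)]] that by (simp add: expenditure_eq[OF plan_zero(1)[OF that(1)]] cost_zero L_zero less_top)
  have Lc_dom: "Lc C \<le> ennreal lam * cost_c C" if "plan x C" "cost_c C \<noteq> top" for x C
    using dom[OF plan_zero(2)[OF that(1)]] that by (simp add: expenditure_eq[OF plan_zero(2)[OF that(1)]] cost_zero L_zero less_top)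
  \<comment> \<open>The two separate inequalities have the same finite sums on both sides, so each
    is an equality.\<close>
  have eqs: "Lx xh = ennreal lam * cost_x xh" "Lc Ch = ennreal lam * cost_c Ch"
  proof -
    obtain a b where ab: "cost_x xh = ennreal a" "cost_c Ch = ennreal b" "0 \<le> a" "0 \<le> b"
      using cost_fin by (cases "cost_x xh"; cases "cost_c Ch") auto
    have le: "Lx xh \<le> ennreal (lam * a)" "Lc Ch \<le> ennreal (lam * b)"
      using Lx_dom[OF plan_hat cost_fin(1)] Lc_dom[OF plan_hat cost_fin(2)] ab lam by (simp_all add: ennreal_mult')
    then obtain p q where pq: "Lx xh = ennreal p" "Lc Ch = ennreal q" "0 \<le> p" "0 \<le> q"
      by (cases "Lx xh"; cases "Lc Ch") (auto simp: top_unique)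
    have "a + b = w" using cost ab w_pos by (simp add: ennreal_plus[symmetric] del: ennreal_plus)
    moreover have "p + q = lam * w" using lam pq w_pos by (simp add: ennreal_plus[symmetric] del: ennreal_plus)
    moreover have "p \<le> lam * a" "q \<le> lam * b" using le pq ab lam by (auto simp: ennreal_le_iff)
    moreover have "lam * (a + b) = lam * a + lam * b" by (rule distrib_left)
    ultimately have "p = lam * a" "q = lam * b" by auto
    then show "Lx xh = ennreal lam * cost_x xh" "Lc Ch = ennreal lam * cost_c Ch"
      using pq ab lam by (simp_all add: ennreal_mult')
  qed
  have bound: "AE \<omega> in M. cond_remaining M F T (marginal_c r u xh Q) \<tau> \<omega> \<le> ennreal (lam * \<psi>c \<omega> (\<tau> \<omega>))"
    if \<tau>: "\<tau> \<in> stopping_times M F T" for \<tau>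
  proof -
    have st: "stopping_time F \<tau>" and \<tau>le: "AE \<omega> in M. \<tau> \<omega> \<le> T" using \<tau> by (auto simp: stopping_times_def)
    interpret S: sigma_finite_subalgebra M "pre_sigma \<tau>" by (rule finite_subalgebra_pre_sigma[OF st])
    have m: "(\<lambda>\<omega>. remaining \<omega> (\<tau> \<omega>)) \<in> borel_measurable M"
      by (rule jointly_measurable_stopping[OF remaining_measurable \<tau>])
    have "progressive borel \<psi>c"
      using prices(2) by (intro right_continuous_progressive) (auto simp: price_process_def)
    then have [measurable]: "(\<lambda>\<omega>. \<psi>c \<omega> (\<tau> \<omega>)) \<in> borel_measurable (pre_sigma \<tau>)" by (rule progressive_stopped[OF _ \<tau>])
    have [measurable]: "(\<lambda>\<omega>. \<psi>c \<omega> (\<tau> \<omega>)) \<in> borel_measurable M"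
      by (rule measurable_from_subalg[OF subalgebra_pre_sigma[OF st]]) measurable
    have "AE \<omega> in M. nn_cond_exp M (pre_sigma \<tau>) (\<lambda>\<omega>. remaining \<omega> (\<tau> \<omega>)) \<omega> \<le> ennreal (lam * \<psi>c \<omega> (\<tau> \<omega>))"
    proof (rule AE_le_of_set_integrals[OF subalgebra_pre_sigma[OF st]])
      fix A assume A: "A \<in> sets (pre_sigma \<tau>)"
      have [measurable]: "A \<in> sets M" by (rule pre_sigma_subset[OF st A])
      \<comment> \<open>One unit contributed at \<tau> on A: dC is a point mass at \<tau>, which
        turns L and the cost into integrals over A.\<close>
      let ?C = "\<lambda>\<omega> t. if \<tau> \<omega> \<le> t then indicator A \<omega> else (0::real)"
      have p: "plan (\<lambda>_ _. 0) ?C"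
        unfolding plan_def
      proof (intro conjI)
        show "optional M F T ?C" by (rule stopping_jump_optional[OF st A])
        show "AE \<omega> in M. right_continuous_path T (?C \<omega>) \<and> mono_on {..T} (?C \<omega>)"
          using increasing_path_jump[of "indicator A _"] by (intro AE_I2) (auto simp: increasing_path_def)
      qed (auto simp: optional_iff)
      have jump: "(\<integral>\<^sup>+\<omega>. (\<integral>\<^sup>+t. f \<omega> t \<partial>stieltjes_measure T (?C \<omega>)) \<partial>M) = (\<integral>\<^sup>+\<omega>\<in>A. f \<omega> (\<tau> \<omega>) \<partial>M)"
        if f: "jointly_measurable f" for f :: "'a \<Rightarrow> ennreal \<Rightarrow> ennreal"
      proof (rule nn_integral_cong_AE)
        show "AE \<omega> in M. (\<integral>\<^sup>+t. f \<omega> t \<partial>stieltjes_measure T (?C \<omega>)) = f \<omega> (\<tau> \<omega>) * indicator A \<omega>"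
          using \<tau>le AE_space
        proof eventually_elim
          case (elim \<omega>)
          show ?case by (rule nn_integral_stieltjes_jump[OF jointly_measurable_path[OF f elim(2)] elim(1)])
        qed
      qed
      have "(\<integral>\<^sup>+\<omega>\<in>A. nn_cond_exp M (pre_sigma \<tau>) (\<lambda>\<omega>. remaining \<omega> (\<tau> \<omega>)) \<omega> \<partial>M)
          = (\<integral>\<^sup>+\<omega>. indicator A \<omega> * remaining \<omega> (\<tau> \<omega>) \<partial>M)"
        using S.nn_cond_exp_intg[OF _ m, of "indicator A"] A by (simp add: mult.commute)
      also have "\<dots> = Lc ?C" unfolding Lc_eq[OF p] jump[OF remaining_measurable] by (simp add: mult.commute)
      \<comment> \<open>With infinite cost the bound is trivial because \<lambda> > 0.\<close>
      also have "\<dots> \<le> ennreal lam * cost_c ?C"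
        using Lc_dom[OF p] lam by (cases "cost_c ?C = top") (auto simp: ennreal_mult_top)
      also have "cost_c ?C = (\<integral>\<^sup>+\<omega>\<in>A. ennreal (\<psi>c \<omega> (\<tau> \<omega>)) \<partial>M)"
        unfolding cost_c_def by (rule jump[OF price_jointly_measurable_ennreal[OF prices(2)]])
      also have "ennreal lam * \<dots> = (\<integral>\<^sup>+\<omega>\<in>A. ennreal (lam * \<psi>c \<omega> (\<tau> \<omega>)) \<partial>M)"
        using lam by (simp add: ennreal_mult' mult.assoc nn_integral_cmult)
      finally show "(\<integral>\<^sup>+\<omega>\<in>A. nn_cond_exp M (pre_sigma \<tau>) (\<lambda>\<omega>. remaining \<omega> (\<tau> \<omega>)) \<omega> \<partial>M)
          \<le> (\<integral>\<^sup>+\<omega>\<in>A. ennreal (lam * \<psi>c \<omega> (\<tau> \<omega>)) \<partial>M)" .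
    qed auto
    with cond_remaining_eq[OF grad \<tau>] show ?thesis by eventually_elim simp
  qed
  obtain Y where Y: "optional_projection remaining Y"
    using optional_projection_exists[OF remaining_measurable] by blast
  have bound': "\<forall>\<tau>\<in>stopping_times M F T. AE \<omega> in M.
      cond_remaining M F T (marginal_c r u xh Q) \<tau> \<omega> \<le> ennreal (lam * \<psi>c \<omega> (\<tau> \<omega>))" using bound by blast
  have "(\<integral>\<^sup>+\<omega>. (\<integral>\<^sup>+t. ennreal (lam * \<psi>c \<omega> t) - Y \<omega> t \<partial>stieltjes_measure T (Ch \<omega>)) \<partial>M) + Lc Ch = 0 + Lc Ch"
    using slack_eq[OF grad lam(1) Y bound' plan_hat] eqs by simp
  \<comment> \<open>Finiteness permits the cancellation that leaves zero slack.\<close>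
  moreover have "Lc Ch \<noteq> top" using L_hat_finite by auto
  ultimately have "(\<integral>\<^sup>+\<omega>. (\<integral>\<^sup>+t. ennreal (lam * \<psi>c \<omega> t) - Y \<omega> t \<partial>stieltjes_measure T (Ch \<omega>)) \<partial>M) = 0"
    by (metis ennreal_add_diff_cancel_right)
  then have cond3: "stieltjes_expectation M T (\<lambda>\<omega> t. enn2ereal (Y \<omega> t) - ereal (lam * \<psi>c \<omega> t)) Ch = 0"
    unfolding stieltjes_expectation_eq[OF grad lam(1) Y bound' plan_hat] by (simp add: zero_ennreal.rep_eq)
  have mx_le: "AE z in PT. mx (fst z) (snd z) \<le> ennreal (lam * \<psi>x (fst z) (snd z))"
  proof -
    \<comment> \<open>The optional sigma-algebra is generated by cadlag processes, while \<psi>x is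
      only assumed right-continuous. An optional process that agrees with it almost everywhere makes
      the test set below optional.\<close>
    obtain \<psi>' :: "'a process" where \<psi>': "optional M F T \<psi>'"
      "\<And>\<omega>. \<omega> \<in> space M \<Longrightarrow> AE t in lebesgue_time T. \<psi>' \<omega> t = \<psi>x \<omega> t"
      using right_continuous_optional_AE[of \<psi>x] prices(1) unfolding price_process_def by blast
    have [measurable]: "(\<lambda>z. \<psi>' (fst z) (snd z)) \<in> borel_measurable PT" by (rule optional_measurable_PT[OF \<psi>'(1)])
    have eq: "AE z in PT. \<psi>' (fst z) (snd z) = \<psi>x (fst z) (snd z)"
      by (rule PT.AE_pair_measure) (measurable, use \<psi>'(2) in auto)
    obtain x0 where x0: "plan x0 (\<lambda>_ _. 0)" "(x0, \<lambda>_ _. 0) \<in> budget_set M F T \<psi>x \<psi>c w"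
      "\<And>\<omega> t. \<omega> \<in> space M \<Longrightarrow> t \<le> T \<Longrightarrow> 0 < x0 \<omega> t"
      using positive_plan by blast
    \<comment> \<open>Supported on the set where the inequality fails. The positive plan x0 takes
      the place of the constant 1, which keeps the cost finite.\<close>
    define x1 :: "'a process" where "x1 \<omega> t = (if ennreal (lam * \<psi>' \<omega> t) < mx \<omega> t then x0 \<omega> t else 0)" for \<omega> t
    have p: "plan x1 (\<lambda>_ _. 0)"
      unfolding plan_def
    proof (intro conjI)
      have [measurable]: "(\<lambda>z. \<psi>' (fst z) (snd z)) \<in> borel_measurable (optional_sigma M F T)"
        "(\<lambda>z. mx (fst z) (snd z)) \<in> borel_measurable (optional_sigma M F T)"
        "(\<lambda>z. x0 (fst z) (snd z)) \<in> borel_measurable (optional_sigma M F T)"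
        using \<psi>'(1) marginal_optional(1) planD(1)[OF x0(1)] by (auto simp: optional_iff)
      show "optional M F T x1" unfolding optional_iff x1_def by measurable
      show "AE \<omega> in M. right_continuous_path T (\<lambda>_. 0) \<and> mono_on {..T} (\<lambda>_. 0::real)"
        by (simp add: right_continuous_path_def mono_on_def)
      show "\<forall>\<omega>\<in>space M. \<forall>t\<le>T. 0 \<le> x1 \<omega> t \<and> 0 \<le> (0::real)"
        using planD(3)[OF x0(1)] by (simp add: x1_def)
    qed (simp add: optional_iff)
    have [measurable]: "(\<lambda>z. x1 (fst z) (snd z)) \<in> borel_measurable PT" by (rule optional_measurable_PT[OF planD(1)[OF p]])
    have "cost_x x1 \<le> cost_x x0"
      unfolding cost_x_def using planD(3)[OF x0(1)]
      by (intro nn_integral_mono mult_left_mono ennreal_leI) (auto simp: x1_def space_PT)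
    also have "cost_x x0 \<le> ennreal w"
      using x0(2) unfolding budget_iff expenditure_eq[OF x0(1)] by (simp add: cost_zero expenditure_eq[OF x0(1)])
    finally have fin: "cost_x x1 \<noteq> top" by (auto simp: top_unique)
    have cost1: "(\<integral>\<^sup>+z. ennreal (lam * \<psi>x (fst z) (snd z)) * ennreal (x1 (fst z) (snd z)) \<partial>PT) = ennreal lam * cost_x x1"
      unfolding cost_x_def using lam by (simp add: ennreal_mult' mult.assoc nn_integral_cmult)
    have "AE z in PT. mx (fst z) (snd z) * ennreal (x1 (fst z) (snd z))
        \<le> ennreal (lam * \<psi>x (fst z) (snd z)) * ennreal (x1 (fst z) (snd z))"
    proof (rule nn_integral_le_imp_AE_le)
      show "AE z in PT. ennreal (lam * \<psi>x (fst z) (snd z)) * ennreal (x1 (fst z) (snd z))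
          \<le> mx (fst z) (snd z) * ennreal (x1 (fst z) (snd z))"
        using eq by eventually_elim (auto simp: x1_def intro!: mult_right_mono)
      show "(\<integral>\<^sup>+z. mx (fst z) (snd z) * ennreal (x1 (fst z) (snd z)) \<partial>PT)
          \<le> (\<integral>\<^sup>+z. ennreal (lam * \<psi>x (fst z) (snd z)) * ennreal (x1 (fst z) (snd z)) \<partial>PT)"
        unfolding cost1 using Lx_dom[OF p fin] by (simp add: Lx_def)
      show "(\<integral>\<^sup>+z. ennreal (lam * \<psi>x (fst z) (snd z)) * ennreal (x1 (fst z) (snd z)) \<partial>PT) \<noteq> \<infinity>"
        unfolding cost1 using fin by (simp add: ennreal_mult_eq_top_iff)
    qed measurable
    then show ?thesis
      using eq AE_space
    proof eventually_elim
      case (elim z)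
      show ?case
      proof (rule ccontr)
        assume "\<not> ?case"
        then have less: "ennreal (lam * \<psi>x (fst z) (snd z)) < mx (fst z) (snd z)" by simp
        then have "x1 (fst z) (snd z) = x0 (fst z) (snd z)" using elim(2) by (simp add: x1_def)
        moreover have "0 < x0 (fst z) (snd z)" using elim(3) x0(3) by (simp add: space_PT)
        ultimately have "ennreal (lam * \<psi>x (fst z) (snd z)) * ennreal (x1 (fst z) (snd z))
            < mx (fst z) (snd z) * ennreal (x1 (fst z) (snd z))"
          using less by (intro ennreal_mult_strict_right_mono) auto
        then show False using elim(1) by simp
      qed
    qed
  qed
  have [measurable]: "(\<lambda>z. xh (fst z) (snd z)) \<in> borel_measurable PT" by (rule optional_measurable_PT[OF planD(1)[OF plan_hat]])
  have costh: "(\<integral>\<^sup>+z. ennreal (lam * \<psi>x (fst z) (snd z)) * ennreal (xh (fst z) (snd z)) \<partial>PT) = ennreal lam * cost_x xh"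
    unfolding cost_x_def using lam by (simp add: ennreal_mult' mult.assoc nn_integral_cmult)
  \<comment> \<open>After multiplication by the optimal consumption both sides of the inequality
    just shown have the same finite integral, so they agree almost everywhere.\<close>
  have "AE z in PT. ennreal (lam * \<psi>x (fst z) (snd z)) * ennreal (xh (fst z) (snd z))
      \<le> mx (fst z) (snd z) * ennreal (xh (fst z) (snd z))"
  proof (rule nn_integral_le_imp_AE_le)
    show "AE z in PT. mx (fst z) (snd z) * ennreal (xh (fst z) (snd z))
        \<le> ennreal (lam * \<psi>x (fst z) (snd z)) * ennreal (xh (fst z) (snd z))"
      using mx_le by eventually_elim (rule mult_right_mono, auto)
    show "(\<integral>\<^sup>+z. ennreal (lam * \<psi>x (fst z) (snd z)) * ennreal (xh (fst z) (snd z)) \<partial>PT)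
        \<le> (\<integral>\<^sup>+z. mx (fst z) (snd z) * ennreal (xh (fst z) (snd z)) \<partial>PT)"
      unfolding costh using eqs by (simp add: Lx_def)
    show "(\<integral>\<^sup>+z. mx (fst z) (snd z) * ennreal (xh (fst z) (snd z)) \<partial>PT) \<noteq> \<infinity>"
      using L_hat_finite by (auto simp: Lx_def)
  qed measurable
  then have cond4: "AE z in PT. marginal_x r u xh Q (fst z) (snd z) \<le> ennreal (lam * \<psi>x (fst z) (snd z)) \<and>
        (0 < xh (fst z) (snd z) \<longrightarrow> marginal_x r u xh Q (fst z) (snd z) = ennreal (lam * \<psi>x (fst z) (snd z)))"
    using mx_le marginal_AE[OF grad]
  proof eventually_elim
    case (elim z)
    have "mx (fst z) (snd z) = ennreal (lam * \<psi>x (fst z) (snd z))" if "0 < xh (fst z) (snd z)"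
    proof (rule ccontr)
      assume "\<not> ?thesis"
      then have "mx (fst z) (snd z) < ennreal (lam * \<psi>x (fst z) (snd z))" using elim(2) by simp
      then have "mx (fst z) (snd z) * ennreal (xh (fst z) (snd z))
          < ennreal (lam * \<psi>x (fst z) (snd z)) * ennreal (xh (fst z) (snd z))"
        using that by (intro ennreal_mult_strict_right_mono) auto
      then show False using elim(1) by simp
    qed
    then show ?case using elim(2,3) by simp
  qed
  show ?thesis
    using lam(1) exp bound' cond3 cond4 optional_version_iff[OF grad] Y by blast
qed

end

section \<open>Sufficiency of the first-order conditions\<close>

lemma sufficiency:
  assumes lam: "0 < lam" and exp: "expenditure M T \<psi>x \<psi>c xh Ch = ennreal w"
    and bound: "\<forall>\<tau>\<in>stopping_times M F T. AE \<omega> in M.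
        cond_remaining M F T (marginal_c r u xh Q) \<tau> \<omega> \<le> ennreal (lam * \<psi>c \<omega> (\<tau> \<omega>))"
    and Y: "optional_version M F T (marginal_c r u xh Q) Y"
    and cond3: "stieltjes_expectation M T (\<lambda>\<omega> t. enn2ereal (Y \<omega> t) - ereal (lam * \<psi>c \<omega> t)) Ch = 0"
    and cond4: "AE z in PT. marginal_x r u xh Q (fst z) (snd z) \<le> ennreal (lam * \<psi>x (fst z) (snd z)) \<and>
        (0 < xh (fst z) (snd z) \<longrightarrow> marginal_x r u xh Q (fst z) (snd z) = ennreal (lam * \<psi>x (fst z) (snd z)))"
    and b: "(x, C) \<in> budget_set M F T \<psi>x \<psi>c w"
  shows "payoff M T r u x C D \<le> payoff M T r u xh Ch D"
proof -
  \<comment> \<open>For c > 0 the slope u_x(0, c) is infinite while the price is finite, so the last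
    condition excludes zero consumption there. This secures the gradient before L is used.\<close>
  have "AE z in PT. \<not> (xh (fst z) (snd z) = 0 \<and> 0 < Q (fst z) (snd z))"
    using cond4
  proof eventually_elim
    case (elim z)
    show ?case
    proof
      assume *: "xh (fst z) (snd z) = 0 \<and> 0 < Q (fst z) (snd z)"
      then have "marginal_x r u xh Q (fst z) (snd z) = top"
        by (simp add: marginal_x_def partial_x_inada ennreal_mult_top discount_neq_0)
      then show False using elim by (simp add: top_unique)
    qed
  qed
  then have grad: "AE z in PT. gradient_exists u (xh (fst z) (snd z)) (Q (fst z) (snd z))" by (rule gradient_AE)
  have proj: "optional_projection remaining Y" using Y optional_version_iff[OF grad] by simp
  note slack = slack_eq[OF grad lam proj bound]
  have p: "plan x C" using b by (simp add: budget_iff)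
  have [measurable]: "(\<lambda>z. xh (fst z) (snd z)) \<in> borel_measurable PT" "(\<lambda>z. x (fst z) (snd z)) \<in> borel_measurable PT"
    by (rule optional_measurable_PT[OF planD(1)[OF plan_hat]] optional_measurable_PT[OF planD(1)[OF p]])+
  have cost: "(\<integral>\<^sup>+z. ennreal (lam * \<psi>x (fst z) (snd z)) * ennreal (y (fst z) (snd z)) \<partial>PT) = ennreal lam * cost_x y"
    if [measurable]: "(\<lambda>z. y (fst z) (snd z)) \<in> borel_measurable PT" for y
    unfolding cost_x_def using lam by (simp add: ennreal_mult' mult.assoc nn_integral_cmult)
  have Lx: "Lx x \<le> ennreal lam * cost_x x"
  proof -
    have "Lx x \<le> (\<integral>\<^sup>+z. ennreal (lam * \<psi>x (fst z) (snd z)) * ennreal (x (fst z) (snd z)) \<partial>PT)"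
      unfolding Lx_def
    proof (rule nn_integral_mono_AE)
      show "AE z in PT. mx (fst z) (snd z) * ennreal (x (fst z) (snd z))
          \<le> ennreal (lam * \<psi>x (fst z) (snd z)) * ennreal (x (fst z) (snd z))"
        using cond4 marginal_AE[OF grad] by eventually_elim (rule mult_right_mono, auto)
    qed
    then show ?thesis by (simp add: cost)
  qed
  have Lxh: "Lx xh = ennreal lam * cost_x xh"
  proof -
    have "Lx xh = (\<integral>\<^sup>+z. ennreal (lam * \<psi>x (fst z) (snd z)) * ennreal (xh (fst z) (snd z)) \<partial>PT)"
      unfolding Lx_def
    proof (rule nn_integral_cong_AE)
      show "AE z in PT. mx (fst z) (snd z) * ennreal (xh (fst z) (snd z))
          = ennreal (lam * \<psi>x (fst z) (snd z)) * ennreal (xh (fst z) (snd z))"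
        using cond4 marginal_AE[OF grad]
      proof eventually_elim
        case (elim z)
        then show ?case by (cases "0 < xh (fst z) (snd z)") (auto simp: not_less ennreal_neg)
      qed
    qed
    then show ?thesis by (simp add: cost)
  qed
  \<comment> \<open>The extended expectation is minus the slack, so the third condition says that
    the slack is zero.\<close>
  have "(\<integral>\<^sup>+\<omega>. (\<integral>\<^sup>+t. ennreal (lam * \<psi>c \<omega> t) - Y \<omega> t \<partial>stieltjes_measure T (Ch \<omega>)) \<partial>M) = 0"
    using cond3 unfolding stieltjes_expectation_eq[OF grad lam proj bound plan_hat]
    by (simp only: ereal_uminus_zero_iff) (metis enn2ereal_inject zero_ennreal.rep_eq)
  then have Lch: "Lc Ch = ennreal lam * cost_c Ch" using slack[OF plan_hat] by simp
  have Lc: "Lc C \<le> ennreal lam * cost_c C" unfolding slack[OF p, symmetric] by simp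
  have hat: "Lx xh + Lc Ch = ennreal lam * ennreal w"
    unfolding Lxh Lch distrib_left[symmetric] using exp by (simp add: expenditure_eq[OF plan_hat])
  have "payoff M T r u x C D + (Lx xh + Lc Ch) \<le> payoff M T r u xh Ch D + (Lx x + Lc C)"
    by (rule payoff_gradient[OF grad p])
  also have "Lx x + Lc C \<le> ennreal lam * (cost_x x + cost_c C)"
    using Lx Lc by (simp add: distrib_left add_mono)
  also have "\<dots> \<le> ennreal lam * ennreal w"
    using b by (intro mult_left_mono) (auto simp: budget_iff expenditure_eq[OF p])
  finally have "payoff M T r u x C D + (Lx xh + Lc Ch) \<le> payoff M T r u xh Ch D + ennreal lam * ennreal w"
    by (simp add: add_left_mono)
  then have "ennreal lam * ennreal w + payoff M T r u x C D \<le> ennreal lam * ennreal w + payoff M T r u xh Ch D"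
    unfolding hat by (simp only: add.commute)
  moreover have "ennreal lam * ennreal w \<noteq> top" by (simp add: ennreal_mult_eq_top_iff)
  ultimately show ?thesis unfolding ennreal_add_left_cancel_le by simp
qed

end

text \<open>With tolerance 1 the function is bounded by an integrable g plus a tail whose integral
  is at most 1.\<close>

lemma uniformly_integrable_finite:
  assumes H: "uniformly_integrable N H" and f: "f \<in> H"
  shows "(\<integral>\<^sup>+z. ennreal \<bar>f z\<bar> \<partial>N) < \<infinity>"
proof -
  obtain g where g: "integrable N g" "\<forall>z\<in>space N. 0 \<le> g z"
    "(\<integral>\<^sup>+z. ennreal \<bar>f z\<bar> * indicator {z. g z < \<bar>f z\<bar>} z \<partial>N) \<le> ennreal 1"
    using H f unfolding uniformly_integrable_def by (meson zero_less_one)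
  have [measurable]: "f \<in> borel_measurable N" "g \<in> borel_measurable N"
    using H f g(1) by (auto simp: uniformly_integrable_def)
  have "(\<integral>\<^sup>+z. ennreal \<bar>f z\<bar> \<partial>N)
      \<le> (\<integral>\<^sup>+z. ennreal \<bar>f z\<bar> * indicator {z. g z < \<bar>f z\<bar>} z + ennreal (g z) \<partial>N)"
    by (intro nn_integral_mono) (auto simp: indicator_def not_less ennreal_leI)
  also have "\<dots> = (\<integral>\<^sup>+z. ennreal \<bar>f z\<bar> * indicator {z. g z < \<bar>f z\<bar>} z \<partial>N) + (\<integral>\<^sup>+z. ennreal (g z) \<partial>N)"
  proof (rule nn_integral_add)
    have "(\<lambda>z. if g z < \<bar>f z\<bar> then ennreal \<bar>f z\<bar> else 0) \<in> borel_measurable N" by measurable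
    then show "(\<lambda>z. ennreal \<bar>f z\<bar> * indicator {z. g z < \<bar>f z\<bar>} z) \<in> borel_measurable N"
      by (rule measurable_cong[THEN iffD1, rotated]) (simp add: indicator_def)
  qed measurable
  also have "\<dots> \<le> 1 + (\<integral>\<^sup>+z. ennreal (g z) \<partial>N)" using g(3) by (intro add_right_mono) simp
  also have "(\<integral>\<^sup>+z. ennreal (g z) \<partial>N) = ennreal (\<integral>z. g z \<partial>N)"
    by (rule nn_integral_eq_integral[OF g(1)]) (use g(2) in auto)
  finally show ?thesis by (auto simp: top_unique less_top[symmetric])
qed

text \<open>Smoothness ends at the edge of the quadrant, so gradients on {Q = 0} are assumed;
  elsewhere they are derived, from optimality in one direction and from the last condition in the
  other.\<close>

theorem proposition4p2:
  fixes M :: "'a measure" and F :: "ennreal \<Rightarrow> 'a measure" and T :: ennreal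
    and n i :: nat and w :: "nat \<Rightarrow> real"
    and \<psi>x \<psi>c r :: "'a process"
    and u :: "nat \<Rightarrow> real \<Rightarrow> real \<Rightarrow> real"
    and xh Ch :: "nat \<Rightarrow> 'a process"
  defines "D \<equiv> aggregate ({1..n} - {i}) Ch"
  defines "Q \<equiv> (\<lambda>\<omega> t. Ch i \<omega> t + D \<omega> t)"
  assumes "usual_filtered_space M F T"
    and "1 < n" and "i \<in> {1..n}"
    and "\<forall>j\<in>{1..n}. 0 < w j"
    and "utility_assumption M F T n w \<psi>x \<psi>c r u"
    and "price_assumption M F T \<psi>x \<psi>c r"
    and "\<forall>j\<in>{1..n} - {i}. (xh j, Ch j) \<in> budget_set M F T \<psi>x \<psi>c (w j)"
    and "(xh i, Ch i) \<in> budget_set M F T \<psi>x \<psi>c (w i)"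
    and "AE (\<omega>, t) in M \<Otimes>\<^sub>M lebesgue_time T.
           Q \<omega> t = 0 \<longrightarrow> gradient_exists (u i) (xh i \<omega> t) (Q \<omega> t)"
  shows "payoff M T r (u i) (xh i) (Ch i) D
           = (SUP (x, C) \<in> budget_set M F T \<psi>x \<psi>c (w i). payoff M T r (u i) x C D)
     \<longleftrightarrow> (\<exists>lam>0.
           expenditure M T \<psi>x \<psi>c (xh i) (Ch i) = ennreal (w i) \<and>
           (\<forall>\<tau>\<in>stopping_times M F T. AE \<omega> in M.
              cond_remaining M F T (marginal_c r (u i) (xh i) Q) \<tau> \<omega>
                \<le> ennreal (lam * \<psi>c \<omega> (\<tau> \<omega>))) \<and>
           (\<exists>Y. optional_version M F T (marginal_c r (u i) (xh i) Q) Y \<and>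
              stieltjes_expectation M T
                (\<lambda>\<omega> t. enn2ereal (Y \<omega> t) - ereal (lam * \<psi>c \<omega> t)) (Ch i) = 0) \<and>
           (AE (\<omega>, t) in M \<Otimes>\<^sub>M lebesgue_time T.
              marginal_x r (u i) (xh i) Q \<omega> t \<le> ennreal (lam * \<psi>x \<omega> t) \<and>
              (0 < xh i \<omega> t \<longrightarrow>
                 marginal_x r (u i) (xh i) Q \<omega> t = ennreal (lam * \<psi>x \<omega> t))))"
proof -
  interpret usual_filtered_space M F T by fact
  let ?J = "{1..n} - {i}"
  have budget: "(xh j, Ch j) \<in> budget_set M F T \<psi>x \<psi>c (w j)" if "j \<in> {1..n}" for j
    using that assms(9,10) by (cases "j = i") auto
  have Ch_optional: "optional M F T (Ch j)" and Ch_nonneg: "\<omega> \<in> space M \<Longrightarrow> t \<le> T \<Longrightarrow> 0 \<le> Ch j \<omega> t"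
    if "j \<in> {1..n}" for j \<omega> t
    using budget[OF that] by (auto simp: budget_set_def)
  have D_optional: "optional M F T D"
  proof -
    have "(\<lambda>z. Ch j (fst z) (snd z)) \<in> borel_measurable (optional_sigma M F T)" if "j \<in> ?J" for j
      using Ch_optional[of j] that by (simp add: optional_iff)
    then show ?thesis
      unfolding D_def aggregate_def optional_iff by (rule borel_measurable_sum)
  qed
  have total: "aggregate {1..n} Ch \<omega> t = Ch i \<omega> t + D \<omega> t" for \<omega> t
    unfolding D_def aggregate_def using sum.remove[of "{1..n}" i "\<lambda>j. Ch j \<omega> t"] assms(5) by simp
  interpret utility "u i"
    using assms(5,7) by unfold_locales (simp add: utility_assumption_def)
  \<comment> \<open>The given strategies form a member of the uniformly integrable family, which
    makes the candidate's payoff finite.\<close>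
  have finite: "payoff M T r (u i) (xh i) (Ch i) D < \<infinity>"
  proof -
    let ?f = "\<lambda>(\<omega>, t). discount r \<omega> t * u i (xh i \<omega> t) (aggregate {1..n} Ch \<omega> t)"
    let ?H = "{\<lambda>(\<omega>, t). discount r \<omega> t * u i (x i \<omega> t) (aggregate {1..n} C \<omega> t) | x C.
             \<forall>j\<in>{1..n}. (x j, C j) \<in> budget_set M F T \<psi>x \<psi>c (w j)}"
    have H: "uniformly_integrable (M \<Otimes>\<^sub>M lebesgue_time T) ?H"
      using assms(5,7) by (simp add: utility_assumption_def)
    have f: "?f \<in> ?H" using budget by blast
    have [measurable]: "?f \<in> borel_measurable (M \<Otimes>\<^sub>M lebesgue_time T)"
      using H f by (simp add: uniformly_integrable_def)
    have "payoff M T r (u i) (xh i) (Ch i) D = (\<integral>\<^sup>+\<omega>. (\<integral>\<^sup>+t. ennreal (?f (\<omega>, t)) \<partial>lebesgue_time T) \<partial>M)"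
      unfolding payoff_def total prod.case ..
    also have "\<dots> = (\<integral>\<^sup>+z. ennreal (?f z) \<partial>(M \<Otimes>\<^sub>M lebesgue_time T))"
      by (rule lebesgue_time.nn_integral_fst) measurable
    also have "\<dots> \<le> (\<integral>\<^sup>+z. ennreal \<bar>?f z\<bar> \<partial>(M \<Otimes>\<^sub>M lebesgue_time T))"
      by (intro nn_integral_mono ennreal_leI abs_ge_self)
    also have "\<dots> < \<infinity>" by (rule uniformly_integrable_finite[OF H f])
    finally show ?thesis .
  qed
  interpret C: consumer M F T "u i" \<psi>x \<psi>c r "w i" D "xh i" "Ch i"
  proof
    show "0 < w i" using assms(5,6) by blast
    show "price_assumption M F T \<psi>x \<psi>c r" by fact
    show "(xh i, Ch i) \<in> budget_set M F T \<psi>x \<psi>c (w i)" by fact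
    show "optional M F T D" by (rule D_optional)
    show "0 \<le> D \<omega> t" if "\<omega> \<in> space M" "t \<le> T" for \<omega> t
      unfolding D_def aggregate_def using Ch_nonneg that by (intro sum_nonneg) auto
    show "payoff M T r (u i) (xh i) (Ch i) D < \<infinity>" by (rule finite)
    show "AE (\<omega>, t) in M \<Otimes>\<^sub>M lebesgue_time T.
        Ch i \<omega> t + D \<omega> t = 0 \<longrightarrow> gradient_exists (u i) (xh i \<omega> t) (Ch i \<omega> t + D \<omega> t)"
      using assms(11) by (simp add: Q_def)
  qed
  have CQ: "C.Q = Q" by (intro ext) (simp add: C.Q_def Q_def)
  have sup: "payoff M T r (u i) (xh i) (Ch i) D
      = (SUP (x, C) \<in> budget_set M F T \<psi>x \<psi>c (w i). payoff M T r (u i) x C D)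
    \<longleftrightarrow> (\<forall>x C. (x, C) \<in> budget_set M F T \<psi>x \<psi>c (w i) \<longrightarrow>
          payoff M T r (u i) x C D \<le> payoff M T r (u i) (xh i) (Ch i) D)"
    (is "?U = ?S \<longleftrightarrow> ?opt")
  proof
    assume eq: "?U = ?S"
    show ?opt
    proof (intro allI impI)
      fix x C assume "(x, C) \<in> budget_set M F T \<psi>x \<psi>c (w i)"
      then have "(case (x, C) of (x, C) \<Rightarrow> payoff M T r (u i) x C D) \<le> ?S" by (rule SUP_upper)
      then show "payoff M T r (u i) x C D \<le> ?U" using eq by simp
    qed
  next
    assume ?opt
    show "?U = ?S"
    proof (rule antisym)
      show "?S \<le> ?U" using \<open>?opt\<close> by (intro SUP_least) auto
      have "(case (xh i, Ch i) of (x, C) \<Rightarrow> payoff M T r (u i) x C D) \<le> ?S" by (rule SUP_upper) fact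
      then show "?U \<le> ?S" by simp
    qed
  qed
  show ?thesis
    unfolding sup
    using C.necessity C.sufficiency
    unfolding CQ case_prod_beta' by blast
qed

end
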